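(* Let $n,r\ge 1$ and let $\mathbf{p}=(p_1,\dots,p_r)\in\mathbb{C}[z_1,\dots,z_n]\otimes\mathbb{C}^r$, where each $p_i$ is a polynomial with $\deg(p_i)\le m$ for some fixed $m$. Let $\mathcal{M}=[\mathbf{p}]$ be the submodule of $L_a^2(\mathbb{B}_n)\otimes\mathbb{C}^r$ generated by $\mathbf{p}$. Then $\mathcal{M}$ is $q$-essentially normal for every real $q>n$; that is, with $S_{z_i}$ the restriction of multiplication by $z_i$ to $\mathcal{M}$, for all $1\le i,j\le n$ the commutator $[S_{z_i},S_{z_j}^*]$ belongs to the Schatten class $\mathcal{L}^q$ of $\mathcal{M}$ for every $q>n$.
   Context: $\mathbb{B}_n=\{z\in\mathbb{C}^n:|z|<1\}$. $L_a^2(\mathbb{B}_n)$ is the Bergman space: the Hilbert space of analytic functions on $\mathbb{B}_n$ square integrable with respect to normalized Lebesgue measure. $L_a^2(\mathbb{B}_n)\otimes\mathbb{C}^r$ is identified with $r$-tuples of functions in $L_a^2(\mathbb{B}_n)$, on which $z_i$ acts by $M_{z_i}(f_1,\dots,f_r)=(z_if_1,\dots,z_if_r)$. $[\mathbf{p}]$ is the closure of $\{(p_1f,\dots,p_rf):f\in\mathbb{C}[z_1,\dots,z_n]\}$. $S_{z_i}=M_{z_i}|_{\mathcal{M}}$ is regarded as an operator on $\mathcal{M}$. (The Schatten exponent is called $q$ here to avoid a clash with the polynomials.) *)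

theory Defs
  imports "HOL-Probability.Probability_Measure" "HOL-Analysis.Analysis" "HOL-Library.Poly_Mapping"
begin

subsection \<open>Complex inner product spaces\<close>

text \<open>The inner product is linear in the first argument.  The real inner product, and hence the norm
  and the topology, are those of the class \<^class>\<open>real_inner\<close>.\<close>

class complex_inner = real_inner +
  fixes scaleC :: "complex \<Rightarrow> 'a \<Rightarrow> 'a"
    and cinner :: "'a \<Rightarrow> 'a \<Rightarrow> complex"
  assumes scaleC_add_right: "scaleC c (x + y) = scaleC c x + scaleC c y"
    and scaleC_add_left: "scaleC (c + d) x = scaleC c x + scaleC d x"
    and scaleC_scaleC: "scaleC c (scaleC d x) = scaleC (c * d) x"
    and scaleC_of_real: "scaleC (complex_of_real r) x = r *\<^sub>R x"
    and cinner_commute: "cinner x y = cnj (cinner y x)"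
    and cinner_add_left: "cinner (x + y) z = cinner x z + cinner y z"
    and cinner_scaleC_left: "cinner (scaleC c x) y = c * cinner x y"
    and inner_eq_Re_cinner: "inner x y = Re (cinner x y)"

global_interpretation complex_vector: vector_space "scaleC :: complex \<Rightarrow> 'a \<Rightarrow> 'a::complex_inner"
  defines cdim = complex_vector.dim
proof
  show "scaleC 1 x = x" for x :: 'a
    using scaleC_of_real[of 1 x] by simp
qed (simp_all add: scaleC_add_right scaleC_add_left scaleC_scaleC)

instantiation vec :: (complex_inner, finite) complex_inner
begin

definition scaleC_vec :: "complex \<Rightarrow> 'a ^ 'b \<Rightarrow> 'a ^ 'b"
  where "scaleC_vec c x = (\<chi> k. scaleC c (x $ k))"

definition cinner_vec :: "'a ^ 'b \<Rightarrow> 'a ^ 'b \<Rightarrow> complex"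
  where "cinner_vec x y = (\<Sum>k\<in>UNIV. cinner (x $ k) (y $ k))"

instance
proof
  fix x y z :: "'a ^ 'b" and c d :: complex and r :: real
  show "scaleC c (x + y) = scaleC c x + scaleC c y"
    "scaleC (c + d) x = scaleC c x + scaleC d x"
    "scaleC c (scaleC d x) = scaleC (c * d) x"
    "scaleC (complex_of_real r) x = r *\<^sub>R x"
    by (simp_all add: vec_eq_iff scaleC_vec_def scaleC_add_right scaleC_add_left
        scaleC_scaleC scaleC_of_real)
  show "cinner x y = cnj (cinner y x)"
    unfolding cinner_vec_def cnj_sum by (intro sum.cong refl cinner_commute)
  show "cinner (x + y) z = cinner x z + cinner y z"
    by (simp add: cinner_vec_def cinner_add_left sum.distrib)
  show "cinner (scaleC c x) y = c * cinner x y"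
    by (simp add: cinner_vec_def scaleC_vec_def cinner_scaleC_left sum_distrib_left)
  show "inner x y = Re (cinner x y)"
    by (simp add: cinner_vec_def inner_vec_def inner_eq_Re_cinner)
qed

end

subsection \<open>Operators on a closed subspace\<close>

text \<open>An operator on a closed complex-linear subspace \<open>M\<close> is represented by a function on the ambient
  space; only its values on \<open>M\<close> matter.\<close>

definition adjoint_on :: "'a::complex_inner set \<Rightarrow> ('a \<Rightarrow> 'a) \<Rightarrow> 'a \<Rightarrow> 'a"
  where "adjoint_on M T g = (THE h. h \<in> M \<and> (\<forall>f\<in>M. cinner (T f) g = cinner f h))"

definition commutator :: "('a \<Rightarrow> 'a) \<Rightarrow> ('a \<Rightarrow> 'a) \<Rightarrow> 'a::minus \<Rightarrow> 'a"
  where "commutator A B f = A (B f) - B (A f)"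

definition compact_operator_on :: "'a::complex_inner set \<Rightarrow> ('a \<Rightarrow> 'a) \<Rightarrow> bool"
  where "compact_operator_on M T \<longleftrightarrow>
    (\<forall>f\<in>M. T f \<in> M) \<and>
    (\<forall>f\<in>M. \<forall>g\<in>M. T (f + g) = T f + T g) \<and>
    (\<forall>c. \<forall>f\<in>M. T (scaleC c f) = scaleC c (T f)) \<and>
    compact (closure (T ` (M \<inter> cball 0 1)))"

text \<open>The singular values of \<open>T\<close> are the square roots of the eigenvalues of \<open>T\<^sup>* T\<close>; the multiplicity
  of \<open>s\<close> is the complex dimension of the following eigenspace.\<close>

definition singular_space :: "'a::complex_inner set \<Rightarrow> ('a \<Rightarrow> 'a) \<Rightarrow> real \<Rightarrow> 'a set"
  where "singular_space M T s =
    {f \<in> M. adjoint_on M T (T f) = scaleC (complex_of_real (s\<^sup>2)) f}"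

text \<open>Compact operators whose singular values, counted with multiplicity, are \<open>q\<close>-summable.
  For compact \<open>T\<close> and \<open>s > 0\<close> the space \<open>singular_space M T s\<close> is finite-dimensional, so that the
  convention \<open>cdim V = 0\<close> for infinite-dimensional \<open>V\<close> plays no role.\<close>

definition schatten_class :: "real \<Rightarrow> 'a::complex_inner set \<Rightarrow> ('a \<Rightarrow> 'a) set"
  where "schatten_class q M =
    {T. compact_operator_on M T \<and>
        (\<lambda>s. real (cdim (singular_space M T s)) * s powr q) summable_on {0<..}}"

subsection \<open>The Bergman space of the unit ball\<close>

definition holomorphic_on_vec :: "(complex ^ 'n \<Rightarrow> complex) \<Rightarrow> (complex ^ 'n) set \<Rightarrow> bool"
  where "holomorphic_on_vec f S \<longleftrightarrow>
    (\<forall>z\<in>S. \<exists>D. (f has_derivative D) (at z) \<and> (\<forall>c v. D (c *s v) = c * D v))"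

definition ball_measure :: "(complex ^ 'n) measure"
  where "ball_measure = uniform_measure lborel (ball 0 1)"

text \<open>Functions are normalised to vanish outside the open unit ball, so that equality of elements is
  equality of functions on the ball.\<close>

definition bergman_set :: "(complex ^ 'n \<Rightarrow> complex) set"
  where "bergman_set = {f. holomorphic_on_vec f (ball 0 1) \<and>
    integrable ball_measure (\<lambda>z. (cmod (f z))\<^sup>2) \<and> (\<forall>z. z \<notin> ball 0 1 \<longrightarrow> f z = 0)}"

lemma holomorphic_on_vec_const [simp]: "holomorphic_on_vec (\<lambda>z. c) S"
  unfolding holomorphic_on_vec_def by (auto intro!: exI[of _ "\<lambda>v. 0"])

lemma holomorphic_on_vec_component [simp]: "holomorphic_on_vec (\<lambda>z. z $ i) S"
  unfolding holomorphic_on_vec_def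
  by (auto intro!: exI[of _ "\<lambda>v. v $ i"] bounded_linear_imp_has_derivative bounded_linear_vec_nth)

lemma holomorphic_on_vec_add:
  assumes "holomorphic_on_vec f S" "holomorphic_on_vec g S"
  shows "holomorphic_on_vec (\<lambda>z. f z + g z) S"
  unfolding holomorphic_on_vec_def
proof
  fix z assume z: "z \<in> S"
  obtain D where D: "(f has_derivative D) (at z)" "\<And>c v. D (c *s v) = c * D v"
    using assms(1) z unfolding holomorphic_on_vec_def by blast
  obtain E where E: "(g has_derivative E) (at z)" "\<And>c v. E (c *s v) = c * E v"
    using assms(2) z unfolding holomorphic_on_vec_def by blast
  have "((\<lambda>z. f z + g z) has_derivative (\<lambda>v. D v + E v)) (at z)"
    by (intro has_derivative_add D E)
  moreover have "\<forall>c v. D (c *s v) + E (c *s v) = c * (D v + E v)"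
    by (simp add: D E algebra_simps)
  ultimately show "\<exists>D. ((\<lambda>z. f z + g z) has_derivative D) (at z) \<and> (\<forall>c v. D (c *s v) = c * D v)"
    by blast
qed

lemma holomorphic_on_vec_mult:
  assumes "holomorphic_on_vec f S" "holomorphic_on_vec g S"
  shows "holomorphic_on_vec (\<lambda>z. f z * g z) S"
  unfolding holomorphic_on_vec_def
proof
  fix z assume z: "z \<in> S"
  obtain D where D: "(f has_derivative D) (at z)" "\<And>c v. D (c *s v) = c * D v"
    using assms(1) z unfolding holomorphic_on_vec_def by blast
  obtain E where E: "(g has_derivative E) (at z)" "\<And>c v. E (c *s v) = c * E v"
    using assms(2) z unfolding holomorphic_on_vec_def by blast
  have "((\<lambda>z. f z * g z) has_derivative (\<lambda>v. f z * E v + D v * g z)) (at z)"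
    by (intro has_derivative_mult D E)
  moreover have "\<forall>c v. f z * E (c *s v) + D (c *s v) * g z = c * (f z * E v + D v * g z)"
    by (simp add: D E algebra_simps)
  ultimately show "\<exists>D. ((\<lambda>z. f z * g z) has_derivative D) (at z) \<and> (\<forall>c v. D (c *s v) = c * D v)"
    by (intro exI[of _ "\<lambda>v. f z * E v + D v * g z"]) auto
qed

lemma holomorphic_on_vec_power:
  "holomorphic_on_vec f S \<Longrightarrow> holomorphic_on_vec (\<lambda>z. f z ^ k) S"
  by (induction k) (auto intro: holomorphic_on_vec_mult)

lemma holomorphic_on_vec_sum:
  "(\<And>a. a \<in> A \<Longrightarrow> holomorphic_on_vec (f a) S) \<Longrightarrow> holomorphic_on_vec (\<lambda>z. \<Sum>a\<in>A. f a z) S"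
  by (induction A rule: infinite_finite_induct) (auto intro: holomorphic_on_vec_add)

lemma holomorphic_on_vec_prod:
  "(\<And>a. a \<in> A \<Longrightarrow> holomorphic_on_vec (f a) S) \<Longrightarrow> holomorphic_on_vec (\<lambda>z. \<Prod>a\<in>A. f a z) S"
  by (induction A rule: infinite_finite_induct) (auto intro: holomorphic_on_vec_mult)

lemma holomorphic_on_vec_cong:
  assumes "holomorphic_on_vec f S" "open S" "\<And>z. z \<in> S \<Longrightarrow> f z = g z"
  shows "holomorphic_on_vec g S"
  unfolding holomorphic_on_vec_def
proof
  fix z assume z: "z \<in> S"
  obtain D where D: "(f has_derivative D) (at z)" "\<And>c v. D (c *s v) = c * D v"
    using assms(1) z unfolding holomorphic_on_vec_def by blast
  have "(g has_derivative D) (at z)"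
    by (rule has_derivative_transform_within_open[OF D(1) assms(2) z assms(3)])
  with D(2) show "\<exists>D. (g has_derivative D) (at z) \<and> (\<forall>c v. D (c *s v) = c * D v)"
    by blast
qed

lemma holomorphic_on_vec_imp_continuous_on:
  "holomorphic_on_vec f S \<Longrightarrow> continuous_on S f"
  unfolding holomorphic_on_vec_def
  by (meson continuous_at_imp_continuous_on has_derivative_continuous)

lemma sets_ball_measure [simp, measurable_cong]: "sets ball_measure = sets borel"
  by (simp add: ball_measure_def)

lemma space_ball_measure [simp]: "space ball_measure = UNIV"
  by (simp add: ball_measure_def)


lemma emeasure_unit_ball:
  "emeasure lborel (ball (0 :: complex ^ 'n) 1) \<noteq> 0"
  "emeasure lborel (ball (0 :: complex ^ 'n) 1) \<noteq> \<infinity>"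
proof -
  show "emeasure lborel (ball (0 :: complex ^ 'n) 1) \<noteq> \<infinity>"
    using emeasure_lborel_ball_finite[of "0 :: complex ^ 'n" 1] by auto
  have "unit_ball_vol (real DIM(complex ^ 'n)) > 0"
    by (rule unit_ball_vol_pos) simp
  then show "emeasure lborel (ball (0 :: complex ^ 'n) 1) \<noteq> 0"
    by (metis emeasure_ball ennreal_eq_0_iff mult.right_neutral not_less power_one zero_le_one)
qed

lemma prob_space_ball_measure: "prob_space (ball_measure :: (complex ^ 'n) measure)"
  unfolding ball_measure_def by (rule prob_space_uniform_measure) (use emeasure_unit_ball in auto)

lemma bergman_setD:
  assumes "f \<in> bergman_set"
  shows "holomorphic_on_vec f (ball 0 1)" "integrable ball_measure (\<lambda>z. (cmod (f z))\<^sup>2)"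
    "z \<notin> ball 0 1 \<Longrightarrow> f z = 0"
  using assms by (auto simp: bergman_set_def)

lemma bergman_set_measurable [measurable_dest]:
  assumes "f \<in> bergman_set"
  shows "f \<in> borel_measurable borel"
proof -
  have "(\<lambda>z. indicat_real (ball 0 1) z *\<^sub>R f z) \<in> borel_measurable borel"
    by (intro borel_measurable_continuous_on_indicator holomorphic_on_vec_imp_continuous_on
        bergman_setD(1)[OF assms]) simp
  moreover have "(\<lambda>z. indicat_real (ball 0 1) z *\<^sub>R f z) = f"
    using bergman_setD(3)[OF assms] by (fastforce simp: indicator_def)
  ultimately show ?thesis by simp
qed

lemma integrable_mult_cnj:
  assumes "f \<in> bergman_set" "g \<in> bergman_set"
  shows "integrable ball_measure (\<lambda>z. f z * cnj (g z))"
proof (rule Bochner_Integration.integrable_bound)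
  show "integrable ball_measure (\<lambda>z. (cmod (f z))\<^sup>2 + (cmod (g z))\<^sup>2)"
    using assms by (intro Bochner_Integration.integrable_add bergman_setD)
  have [measurable]: "f \<in> borel_measurable borel" "g \<in> borel_measurable borel"
    using assms by (auto intro: bergman_set_measurable)
  have [measurable]: "cnj \<in> borel_measurable borel"
    by (intro borel_measurable_continuous_onI continuous_on_cnj continuous_on_id)
  show "(\<lambda>z. f z * cnj (g z)) \<in> borel_measurable ball_measure"
    by measurable
  have "a * b \<le> a\<^sup>2 + b\<^sup>2" if "a \<ge> 0" "b \<ge> 0" for a b :: real
    using sum_squares_bound[of a b] mult_nonneg_nonneg[OF that] by linarith
  then show "AE z in ball_measure. norm (f z * cnj (g z)) \<le> norm ((cmod (f z))\<^sup>2 + (cmod (g z))\<^sup>2)"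
    by (simp add: norm_mult)
qed

lemma bergman_set_add:
  assumes "f \<in> bergman_set" "g \<in> bergman_set"
  shows "(\<lambda>z. f z + g z) \<in> bergman_set"
proof -
  have [measurable]: "f \<in> borel_measurable borel" "g \<in> borel_measurable borel"
    using assms by (auto intro: bergman_set_measurable)
  have "integrable ball_measure (\<lambda>z. (cmod (f z + g z))\<^sup>2)"
  proof (rule Bochner_Integration.integrable_bound)
    show "integrable ball_measure (\<lambda>z. 2 * ((cmod (f z))\<^sup>2 + (cmod (g z))\<^sup>2))"
      using assms by (intro integrable_mult_right Bochner_Integration.integrable_add bergman_setD)
    show "(\<lambda>z. (cmod (f z + g z))\<^sup>2) \<in> borel_measurable ball_measure"
      by measurable
    have "(cmod (a + b))\<^sup>2 \<le> 2 * ((cmod a)\<^sup>2 + (cmod b)\<^sup>2)" for a b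
    proof -
      have "(cmod (a + b))\<^sup>2 \<le> (cmod a + cmod b)\<^sup>2"
        by (intro power_mono norm_triangle_ineq) simp
      also have "\<dots> \<le> 2 * ((cmod a)\<^sup>2 + (cmod b)\<^sup>2)"
        using sum_squares_bound[of "cmod a" "cmod b"] by (simp add: power2_sum)
      finally show ?thesis .
    qed
    then show "AE z in ball_measure. norm ((cmod (f z + g z))\<^sup>2)
        \<le> norm (2 * ((cmod (f z))\<^sup>2 + (cmod (g z))\<^sup>2))"
      by simp
  qed
  then show ?thesis
    using bergman_setD(1,3)[OF assms(1)] bergman_setD(1,3)[OF assms(2)]
    by (auto simp: bergman_set_def intro: holomorphic_on_vec_add)
qed

lemma bergman_set_mult:
  assumes "f \<in> bergman_set" "holomorphic_on_vec h (ball 0 1)"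
    and "\<And>z. z \<in> ball 0 1 \<Longrightarrow> cmod (h z) \<le> C"
  shows "(\<lambda>z. h z * f z) \<in> bergman_set"
proof -
  have hol: "holomorphic_on_vec (\<lambda>z. h z * f z) (ball 0 1)"
    by (intro holomorphic_on_vec_mult assms bergman_setD(1))
  have "(\<lambda>z. indicat_real (ball 0 1) z *\<^sub>R (h z * f z)) \<in> borel_measurable borel"
    by (intro borel_measurable_continuous_on_indicator holomorphic_on_vec_imp_continuous_on hol) simp
  moreover have "(\<lambda>z. indicat_real (ball 0 1) z *\<^sub>R (h z * f z)) = (\<lambda>z. h z * f z)"
    using bergman_setD(3)[OF assms(1)] by (fastforce simp: indicator_def)
  ultimately have [measurable]: "(\<lambda>z. h z * f z) \<in> borel_measurable borel"
    by simp
  have "integrable ball_measure (\<lambda>z. (cmod (h z * f z))\<^sup>2)"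
  proof (rule Bochner_Integration.integrable_bound)
    show "integrable ball_measure (\<lambda>z. C\<^sup>2 * (cmod (f z))\<^sup>2)"
      using assms by (intro integrable_mult_right bergman_setD)
    show "(\<lambda>z. (cmod (h z * f z))\<^sup>2) \<in> borel_measurable ball_measure"
      by measurable
    have "(cmod (h z * f z))\<^sup>2 \<le> C\<^sup>2 * (cmod (f z))\<^sup>2" for z
    proof (cases "z \<in> ball 0 1")
      case True
      then have "(cmod (h z))\<^sup>2 \<le> C\<^sup>2"
        by (intro power_mono assms) auto
      then show ?thesis
        by (simp add: norm_mult power_mult_distrib mult_right_mono)
    qed (use bergman_setD(3)[OF assms(1)] in auto)
    then show "AE z in ball_measure. norm ((cmod (h z * f z))\<^sup>2) \<le> norm (C\<^sup>2 * (cmod (f z))\<^sup>2)"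
      by simp
  qed
  then show ?thesis
    using hol bergman_setD(3)[OF assms(1)] by (auto simp: bergman_set_def)
qed

lemma bergman_set_cmult: "f \<in> bergman_set \<Longrightarrow> (\<lambda>z. c * f z) \<in> bergman_set"
  by (rule bergman_set_mult[where C = "cmod c"]) auto

lemma bergman_set_indicator:
  "(\<lambda>z :: complex ^ 'n. if z \<in> ball 0 1 then 1 else 0) \<in> bergman_set"
proof -
  interpret prob_space "ball_measure :: (complex ^ 'n) measure"
    by (rule prob_space_ball_measure)
  have "holomorphic_on_vec (\<lambda>z :: complex ^ 'n. if z \<in> ball 0 1 then 1 else 0) (ball 0 1)"
    by (rule holomorphic_on_vec_cong[of "\<lambda>z. 1"]) auto
  moreover have "integrable ball_measure
      (\<lambda>z :: complex ^ 'n. (cmod (if z \<in> ball 0 1 then 1 else 0))\<^sup>2)"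
    by (rule integrable_const_bound[where B = 1]) (auto intro!: measurable_If_set)
  ultimately show ?thesis
    by (auto simp: bergman_set_def)
qed

lemma bergman_set_eq_0:
  fixes f :: "complex ^ 'n \<Rightarrow> complex"
  assumes "f \<in> bergman_set" "(\<integral>z. (cmod (f z))\<^sup>2 \<partial>ball_measure) = 0"
  shows "f z = 0"
proof -
  define U where "U = {z \<in> ball 0 1. f z \<noteq> 0}"
  have "open U"
  proof -
    have "open (ball 0 1 \<inter> f -` (- {0}))"
      by (intro continuous_open_preimage holomorphic_on_vec_imp_continuous_on
          bergman_setD(1)[OF assms(1)]) auto
    also have "ball 0 1 \<inter> f -` (- {0}) = U"
      by (auto simp: U_def)
    finally show ?thesis .
  qed
  have "AE z in ball_measure. (cmod (f z))\<^sup>2 = 0"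
    using assms bergman_setD(2)[OF assms(1)] by (subst (asm) integral_nonneg_eq_0_iff_AE) auto
  then have "AE z in ball_measure. z \<notin> U"
    by (auto simp: U_def)
  then have "emeasure ball_measure U = 0"
    using \<open>open U\<close> by (subst (asm) AE_iff_measurable[OF _ refl]) auto
  then have "emeasure lborel (ball 0 1 \<inter> U) / emeasure lborel (ball (0 :: complex ^ 'n) 1) = 0"
    unfolding ball_measure_def using \<open>open U\<close> by (subst (asm) emeasure_uniform_measure) auto
  then have "emeasure lborel (ball 0 1 \<inter> U) = 0"
    using emeasure_unit_ball[where 'n = 'n] by (simp add: ennreal_divide_eq_0_iff)
  moreover have "ball 0 1 \<inter> U = U"
    by (auto simp: U_def)
  ultimately have "U \<in> null_sets lborel"
    using \<open>open U\<close> by (auto simp: null_sets_def)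
  then have "negligible U"
    by (simp add: negligible_iff_null_sets null_sets_completionI)
  then have "U = {}"
    using open_not_negligible[OF \<open>open U\<close>] by blast
  then show ?thesis
    using bergman_setD(3)[OF assms(1), of z] by (auto simp: U_def)
qed

typedef (overloaded) 'n bergman = "bergman_set :: (complex ^ 'n \<Rightarrow> complex) set"
  by (rule exI, rule bergman_set_indicator)

setup_lifting type_definition_bergman

instantiation bergman :: (finite) complex_inner
begin

lift_definition zero_bergman :: "'a bergman" is "\<lambda>z. 0"
  using bergman_set_cmult[OF bergman_set_indicator, of 0] by simp

lift_definition plus_bergman :: "'a bergman \<Rightarrow> 'a bergman \<Rightarrow> 'a bergman"
  is "\<lambda>f g z. f z + g z" by (rule bergman_set_add)

lift_definition uminus_bergman :: "'a bergman \<Rightarrow> 'a bergman"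
  is "\<lambda>f z. - f z" using bergman_set_cmult[of _ "- 1"] by simp

definition minus_bergman :: "'a bergman \<Rightarrow> 'a bergman \<Rightarrow> 'a bergman"
  where "minus_bergman f g = f + - g"

lift_definition scaleC_bergman :: "complex \<Rightarrow> 'a bergman \<Rightarrow> 'a bergman"
  is "\<lambda>c f z. c * f z" by (rule bergman_set_cmult)

definition scaleR_bergman :: "real \<Rightarrow> 'a bergman \<Rightarrow> 'a bergman"
  where "scaleR_bergman r = scaleC (complex_of_real r)"

lift_definition cinner_bergman :: "'a bergman \<Rightarrow> 'a bergman \<Rightarrow> complex"
  is "\<lambda>f g. \<integral>z. f z * cnj (g z) \<partial>ball_measure" .

definition inner_bergman :: "'a bergman \<Rightarrow> 'a bergman \<Rightarrow> real"
  where "inner_bergman f g = Re (cinner f g)"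

definition norm_bergman :: "'a bergman \<Rightarrow> real"
  where "norm_bergman f = sqrt (inner f f)"

definition sgn_bergman :: "'a bergman \<Rightarrow> 'a bergman"
  where "sgn_bergman f = inverse (norm f) *\<^sub>R f"

definition dist_bergman :: "'a bergman \<Rightarrow> 'a bergman \<Rightarrow> real"
  where "dist_bergman f g = norm (f - g)"

definition uniformity_bergman :: "('a bergman \<times> 'a bergman) filter"
  where "uniformity_bergman = (INF e\<in>{0<..}. principal {(f, g). dist f g < e})"

definition open_bergman :: "'a bergman set \<Rightarrow> bool"
  where "open_bergman U = (\<forall>x\<in>U. \<forall>\<^sub>F (x', y) in uniformity. x' = x \<longrightarrow> y \<in> U)"

instance
proof
  fix f g h :: "'a bergman" and c d :: complex and r s :: real and U :: "'a bergman set"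
  show "f + g + h = f + (g + h)" by transfer (simp add: algebra_simps)
  show comm: "f + g = g + f" for f g :: "'a bergman" by transfer (simp add: algebra_simps)
  show "0 + f = f" by transfer simp
  show "- f + f = 0" by transfer simp
  show "f - g = f + - g" by (rule minus_bergman_def)
  show sc: "scaleC c (f + g) = scaleC c f + scaleC c g" for c and f g :: "'a bergman"
    by transfer (simp add: algebra_simps)
  show sc2: "scaleC (c + d) f = scaleC c f + scaleC d f" for c d and f :: "'a bergman"
    by transfer (simp add: algebra_simps)
  show sc3: "scaleC c (scaleC d f) = scaleC (c * d) f" for c d and f :: "'a bergman"
    by transfer (simp add: algebra_simps)
  show "scaleC (complex_of_real r) f = r *\<^sub>R f"
    by (simp add: scaleR_bergman_def)
  show "r *\<^sub>R (f + g) = r *\<^sub>R f + r *\<^sub>R g" "(r + s) *\<^sub>R f = r *\<^sub>R f + s *\<^sub>R f"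
    "r *\<^sub>R s *\<^sub>R f = (r * s) *\<^sub>R f"
    by (simp_all add: scaleR_bergman_def sc sc2 sc3)
  show "1 *\<^sub>R f = f"
    unfolding scaleR_bergman_def by transfer simp
  show ccomm: "cinner f g = cnj (cinner g f)" for f g :: "'a bergman"
  proof transfer
    fix f g :: "complex ^ 'a \<Rightarrow> complex"
    have "cnj (\<integral>z. g z * cnj (f z) \<partial>ball_measure) = (\<integral>z. cnj (g z * cnj (f z)) \<partial>ball_measure)"
      by (rule Bochner_Integration.integral_cnj[symmetric])
    then show "(\<integral>z. f z * cnj (g z) \<partial>ball_measure) = cnj (\<integral>z. g z * cnj (f z) \<partial>ball_measure)"
      by (simp add: mult.commute)
  qed
  show cadd: "cinner (f + g) h = cinner f h + cinner g h" for f g h :: "'a bergman"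
    by transfer (simp add: distrib_right integrable_mult_cnj)
  show cscale: "cinner (scaleC c f) g = c * cinner f g" for c and f g :: "'a bergman"
    by transfer (simp add: mult.assoc)
  show "inner f g = Re (cinner f g)"
    by (rule inner_bergman_def)
  show "inner f g = inner g f"
    unfolding inner_bergman_def using ccomm[of f g] by simp
  show "inner (f + g) h = inner f h + inner g h"
    by (simp add: inner_bergman_def cadd)
  show "inner (r *\<^sub>R f) g = r * inner f g"
    by (simp add: inner_bergman_def scaleR_bergman_def cscale)
  have sq: "inner f f = (\<integral>z. (cmod (Rep_bergman f z))\<^sup>2 \<partial>ball_measure)"
  proof -
    have "cinner f f = (\<integral>z. complex_of_real ((cmod (Rep_bergman f z))\<^sup>2) \<partial>ball_measure)"
      unfolding cinner_bergman.rep_eq by (simp only: complex_norm_square)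
    also have "\<dots> = complex_of_real (\<integral>z. (cmod (Rep_bergman f z))\<^sup>2 \<partial>ball_measure)"
      by (rule integral_complex_of_real)
    finally show ?thesis
      by (simp add: inner_bergman_def)
  qed
  show "0 \<le> inner f f"
    unfolding sq by simp
  show "inner f f = 0 \<longleftrightarrow> f = 0"
  proof
    assume "inner f f = 0"
    then have "Rep_bergman f z = 0" for z
      unfolding sq by (intro bergman_set_eq_0 Rep_bergman)
    then show "f = 0"
      by transfer auto
  next
    assume "f = 0"
    then show "inner f f = 0"
      unfolding sq by (simp add: zero_bergman.rep_eq)
  qed
  show "norm f = sqrt (inner f f)" by (rule norm_bergman_def)
  show "sgn f = inverse (norm f) *\<^sub>R f" by (rule sgn_bergman_def)
  show "dist f g = norm (f - g)" by (rule dist_bergman_def)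
  show "uniformity = (INF e\<in>{0<..}. principal {(f, g :: 'a bergman). dist f g < e})"
    by (rule uniformity_bergman_def)
  show "open U = (\<forall>x\<in>U. \<forall>\<^sub>F (x', y) in uniformity. x' = x \<longrightarrow> y \<in> U)"
    by (rule open_bergman_def)
qed

end

subsection \<open>Polynomials\<close>

text \<open>A monomial is a finitely supported exponent vector.\<close>

type_synonym 'n cpoly = "('n \<Rightarrow>\<^sub>0 nat) \<Rightarrow>\<^sub>0 complex"

definition total_degree :: "'n::finite cpoly \<Rightarrow> nat"
  where "total_degree p =
    Max (insert 0 ((\<lambda>a. \<Sum>i\<in>UNIV. Poly_Mapping.lookup a i) ` Poly_Mapping.keys p))"

definition poly_eval :: "'n::finite cpoly \<Rightarrow> complex ^ 'n \<Rightarrow> complex"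
  where "poly_eval p z = (\<Sum>a\<in>Poly_Mapping.keys p.
    Poly_Mapping.lookup p a * (\<Prod>i\<in>UNIV. (z $ i) ^ Poly_Mapping.lookup a i))"

lemma holomorphic_on_vec_poly_eval: "holomorphic_on_vec (poly_eval p) S"
  unfolding poly_eval_def[abs_def]
  by (intro holomorphic_on_vec_sum holomorphic_on_vec_mult holomorphic_on_vec_prod
      holomorphic_on_vec_power) simp_all

lemma bergman_set_poly_eval: "(\<lambda>z. if z \<in> ball 0 1 then poly_eval p z else 0) \<in> bergman_set"
proof -
  have "compact (poly_eval p ` cball 0 1)"
    by (intro compact_continuous_image holomorphic_on_vec_imp_continuous_on
        holomorphic_on_vec_poly_eval) simp
  then obtain C where C: "\<And>z. z \<in> cball 0 1 \<Longrightarrow> cmod (poly_eval p z) \<le> C"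
    by (meson bounded_iff compact_imp_bounded imageI)
  have "(\<lambda>z. poly_eval p z * (if z \<in> ball 0 1 then 1 else 0)) \<in> bergman_set"
    by (rule bergman_set_mult[where C = C, OF bergman_set_indicator holomorphic_on_vec_poly_eval])
      (simp add: C)
  also have "(\<lambda>z. poly_eval p z * (if z \<in> ball 0 1 then 1 else 0)) =
      (\<lambda>z. if z \<in> ball 0 1 then poly_eval p z else 0)"
    by auto
  finally show ?thesis .
qed

lift_definition bergman_of_poly :: "'n::finite cpoly \<Rightarrow> 'n bergman"
  is "\<lambda>p z. if z \<in> ball 0 1 then poly_eval p z else 0"
  by (rule bergman_set_poly_eval)

subsection \<open>Submodules and essential normality\<close>

lift_definition coord_mult :: "'n::finite \<Rightarrow> 'n bergman \<Rightarrow> 'n bergman"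
  is "\<lambda>i f z. z $ i * f z"
proof -
  fix i :: 'n and f :: "complex ^ 'n \<Rightarrow> complex"
  assume f: "f \<in> bergman_set"
  have "cmod (z $ i) \<le> 1" if "z \<in> ball 0 1" for z :: "complex ^ 'n"
    using that Finite_Cartesian_Product.norm_nth_le[of z i] by simp
  then show "(\<lambda>z. z $ i * f z) \<in> bergman_set"
    by (intro bergman_set_mult[where C = 1] f holomorphic_on_vec_component)
qed

definition coord_mult_vec :: "'n::finite \<Rightarrow> 'n bergman ^ 'r \<Rightarrow> 'n bergman ^ 'r"
  where "coord_mult_vec i f = (\<chi> k. coord_mult i (f $ k))"

definition generated_submodule :: "'n::finite cpoly ^ 'r \<Rightarrow> ('n bergman ^ 'r) set"
  where "generated_submodule p = closure (range (\<lambda>f. \<chi> k. bergman_of_poly (p $ k * f)))"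

definition essentially_normal :: "real \<Rightarrow> ('n::finite bergman ^ 'r) set \<Rightarrow> bool"
  where "essentially_normal q M \<longleftrightarrow>
    (\<forall>i j. commutator (coord_mult_vec i) (adjoint_on M (coord_mult_vec j)) \<in> schatten_class q M)"

end

theory Submission
  imports Defs "HOL-Computational_Algebra.Fundamental_Theorem_Algebra"
begin

text \<open>Write \<open>S\<^sub>j\<close> for multiplication by \<open>z\<^sub>j\<close> restricted to \<open>M\<close>. The adjoint \<open>S\<^sub>j\<^sup>* u\<close> is the
  projection of \<open>cnj z\<^sub>j u\<close> to \<open>M\<close>, so for \<open>u, u', v, v'\<close> in \<open>M\<close>

  \<open>\<langle>[S\<^sub>i, S\<^sub>j\<^sup>*] u, u'\<rangle> = \<langle>S\<^sub>j\<^sup>* u - v, S\<^sub>i\<^sup>* u' - v'\<rangle> - \<integral> (cnj z\<^sub>j u - v) cnj (cnj z\<^sub>i u' - v')\<close>,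

  and \<open>S\<^sub>j\<^sup>* u - v\<close> is no longer than \<open>cnj z\<^sub>j u - v\<close>. The form of the commutator is
  therefore bounded by twice the product of the distances of \<open>cnj z\<^sub>j u\<close> and \<open>cnj z\<^sub>i u'\<close>
  from \<open>M\<close> in the \<open>L\<^sup>2\<close> space (\<open>comm_form_identity\<close>), and everything rests on a good choice of
  \<open>v\<close>.

  For \<open>u = p f\<close> the choice is \<open>v = p g\<^sub>j\<close> with \<open>g\<^sub>j = \<partial>\<^sub>j F\<close>, where \<open>F\<close> solves
  \<open>\<Sum> z\<^sub>i \<partial>\<^sub>i F + \<sigma> F = f\<close>. Thus \<open>g\<^sub>j(z)\<close> is the integral of
  \<open>(1 - s)\<^sup>\<sigma> (\<partial>\<^sub>j f)((1 - s) z)\<close> over \<open>0 < s < 1\<close>, and passing from \<open>f\<close> to \<open>g\<^sub>j\<close>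
  imitates multiplication by \<open>cnj z\<^sub>j\<close> near the sphere. By the Euler identity
  \<open>f = \<Sum> z\<^sub>i g\<^sub>i + \<sigma> F\<close>, away from the origin the difference \<open>cnj z\<^sub>j f - g\<^sub>j\<close> is a
  combination of \<open>(1 - |z|\<^sup>2) f\<close>, of \<open>F\<close>, and of radial integrals of derivatives of \<open>f\<close> in
  directions orthogonal to the complex line through \<open>z\<close> (\<open>euler_defect_identity\<close>). A complex
  tangential derivative costs only the inverse of the square root of the distance to the sphere.
  The outcome is \<open>weighted_defect_estimate\<close>: for every \<open>0 < \<theta> < 1\<close>,

  \<open>\<integral> |p (cnj z\<^sub>j f - g\<^sub>j)|\<^sup>2 \<le> C \<integral> (1 - |z|\<^sup>2)\<^sup>\<theta> |p f|\<^sup>2\<close>,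

  where \<open>C\<close> depends on the degree bound of \<open>p\<close>, on \<open>\<theta>\<close> and on the dimension. As \<open>g\<^sub>j\<close> does not
  involve \<open>p\<close> and \<open>C\<close> involves only its degree, the same \<open>g\<^sub>j\<close> serves all components of a vector
  of polynomials, which is why vectors are no harder than single polynomials.

  What makes this possible for a generator with arbitrary zeros is a fact about one complex
  variable: a polynomial of degree at most \<open>m\<close> is dominated on a whole disc by its value at any
  point of a circle whose radius stays away from the moduli of its roots, and among \<open>m + 1\<close>
  equally spaced radii one is suitable (\<open>poly_times_coeff_le_circle_mean\<close>). Applied on complex
  lines, first radially and then tangentially, it bounds \<open>|p(z)|\<^sup>2 |\<partial>\<^sub>x f((1 - s) z)|\<^sup>2\<close> by
  means of \<open>|p f|\<^sup>2\<close> over displaced points. Means over roots of unity are used instead of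
  circle integrals: they give the coefficients of polynomials exactly, and averages become
  finite sums, which are integrated over the ball by affine substitutions
  (\<open>weighted_radial_estimate\<close>).

  It remains to count. Monomials are orthogonal for every rotation invariant weight, and the
  weight \<open>1 - |z|\<^sup>2\<close> leaves at most a fraction \<open>1/(k + 1)\<close> of the square norm of a monomial
  of degree \<open>k\<close> (\<open>monomial_boundary_decay\<close>). Hence the \<open>\<theta>\<close>-weighted square norm of \<open>u\<close> is at
  most a constant times \<open>d\<^sup>-\<^sup>\<theta> |u|\<^sup>2\<close> as soon as \<open>u\<close> is orthogonal to the \<open>r d\<^sup>n\<close> vectors with
  a single monomial entry whose exponents are all below \<open>d\<close>. Therefore at most \<open>2 r d\<^sup>n\<close>
  singular values of the commutator exceed a constant times \<open>d\<^sup>-\<^sup>\<theta>\<close> (\<open>singular_count\<close>), and a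
  dyadic sum gives \<open>q\<close>-summability for \<open>q \<theta> > n\<close>. For \<open>q > n\<close> there is room to choose
  \<open>n / q < \<theta> < 1\<close>.

  The Hilbert space theory takes place on \<open>M\<close>: limits of polynomials in the Bergman norm are
  holomorphic (\<open>poly_sequence_converges\<close>), so \<open>M\<close> is complete and adjoints exist by Riesz
  representation.\<close>

section \<open>Linear substitutions in Lebesgue integrals\<close>

lemma nn_integral_lborel_translate:
  fixes f :: "'a::euclidean_space \<Rightarrow> ennreal"
  assumes [measurable]: "f \<in> borel_measurable borel"
  shows "(\<integral>\<^sup>+x. f (c + x) \<partial>lborel) = (\<integral>\<^sup>+x. f x \<partial>lborel)"
proof -
  have "(\<integral>\<^sup>+x. f x \<partial>lborel) = (\<integral>\<^sup>+x. f x \<partial>distr lborel borel ((+) c))"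
    by (simp add: lborel_distr_plus)
  also have "\<dots> = (\<integral>\<^sup>+x. f (c + x) \<partial>lborel)"
    by (subst nn_integral_distr) simp_all
  finally show ?thesis by simp
qed

text \<open>Both sides equal the double integral of \<open>f (B x + y)\<close> over \<open>x\<close> and over \<open>y\<close> with \<open>B x\<close> in
  the unit ball: translation invariance in one variable gives one side, in the other variable
  the other side. This is uniqueness of Haar measure for a linear map, and it replaces
  determinants by volumes of preimages, which can be estimated from norm bounds.\<close>

lemma nn_integral_linear_ratio:
  fixes B :: "'a::euclidean_space \<Rightarrow> 'a" and f :: "'a \<Rightarrow> ennreal"
  assumes f [measurable]: "f \<in> borel_measurable borel"
    and B: "linear B" "inj B"
  shows "(\<integral>\<^sup>+x. f (B x) \<partial>lborel) * emeasure lborel (ball (0::'a) 1)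
       = (\<integral>\<^sup>+x. f x \<partial>lborel) * emeasure lborel (B -` ball 0 1)"
proof -
  obtain B' where B': "linear B'" "B' \<circ> B = id"
    using linear_injective_left_inverse[OF B] by blast
  have "bij B"
    using B by (simp add: bij_def linear_injective_imp_surjective)
  then have BB': "B (B' x) = x" for x
    using B'(2) by (metis bij_pointE comp_apply id_apply)
  have [measurable]: "B \<in> borel_measurable borel"
    by (intro borel_measurable_continuous_onI linear_continuous_on linear_linear[THEN iffD2] B)
  define I where "I = (indicator (ball (0::'a) 1) :: 'a \<Rightarrow> ennreal)"
  have [measurable]: "I \<in> borel_measurable borel"
    unfolding I_def by (rule borel_measurable_indicator) simp
  have Bd: "B (x + y) = B x + B y" for x y
    using B(1) by (rule linear_add)
  have sym: "I (x - y) = I (y - x)" for x y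
    by (auto simp: I_def indicator_def norm_minus_commute)
  have "(\<integral>\<^sup>+x. f x \<partial>lborel) * emeasure lborel (B -` ball 0 1)
      = (\<integral>\<^sup>+x. (\<integral>\<^sup>+y. f y * I (B x) \<partial>lborel) \<partial>lborel)"
  proof -
    have "emeasure lborel (B -` ball 0 1) = (\<integral>\<^sup>+x. I (B x) \<partial>lborel)"
      using measurable_sets_borel[OF \<open>B \<in> borel_measurable borel\<close>, of "ball 0 1"]
      by (subst nn_integral_indicator[symmetric]) (auto simp: I_def indicator_vimage[symmetric] simp del: nn_integral_indicator intro!: nn_integral_cong split: split_indicator)
    moreover have "(\<integral>\<^sup>+x. (\<integral>\<^sup>+y. f y * I (B x) \<partial>lborel) \<partial>lborel)
        = (\<integral>\<^sup>+x. (\<integral>\<^sup>+y. f y \<partial>lborel) * I (B x) \<partial>lborel)"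
      by (intro nn_integral_cong nn_integral_multc) measurable
    moreover have "\<dots> = (\<integral>\<^sup>+y. f y \<partial>lborel) * (\<integral>\<^sup>+x. I (B x) \<partial>lborel)"
      by (rule nn_integral_cmult) measurable
    ultimately show ?thesis by simp
  qed
  also have "\<dots> = (\<integral>\<^sup>+x. (\<integral>\<^sup>+y. f (B x + y) * I (B x) \<partial>lborel) \<partial>lborel)"
    by (intro nn_integral_cong nn_integral_lborel_translate[symmetric]) measurable
  also have "\<dots> = (\<integral>\<^sup>+y. (\<integral>\<^sup>+x. f (B x + y) * I (B x) \<partial>lborel) \<partial>lborel)"
    by (rule lborel_pair.Fubini'[symmetric]) measurable
  also have "\<dots> = (\<integral>\<^sup>+y. (\<integral>\<^sup>+x. f (B x) * I (B x - y) \<partial>lborel) \<partial>lborel)"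
  proof (rule nn_integral_cong)
    fix y
    have "(\<integral>\<^sup>+x. f (B x) * I (B x - y) \<partial>lborel)
        = (\<integral>\<^sup>+x. f (B (B' y + x)) * I (B (B' y + x) - y) \<partial>lborel)"
      by (rule nn_integral_lborel_translate[symmetric, of "\<lambda>x. f (B x) * I (B x - y)"]) measurable
    then show "(\<integral>\<^sup>+x. f (B x + y) * I (B x) \<partial>lborel) = (\<integral>\<^sup>+x. f (B x) * I (B x - y) \<partial>lborel)"
      by (simp add: Bd BB' add.commute)
  qed
  also have "\<dots> = (\<integral>\<^sup>+x. (\<integral>\<^sup>+y. f (B x) * I (B x - y) \<partial>lborel) \<partial>lborel)"
    by (rule lborel_pair.Fubini') measurable
  also have "\<dots> = (\<integral>\<^sup>+x. f (B x) * emeasure lborel (ball (0::'a) 1) \<partial>lborel)"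
  proof (rule nn_integral_cong)
    fix x
    have "(\<integral>\<^sup>+y. I (B x - y) \<partial>lborel) = (\<integral>\<^sup>+y. I (- B x + y) \<partial>lborel)"
      by (subst sym) simp
    also have "\<dots> = emeasure lborel (ball (0::'a) 1)"
      proof (subst nn_integral_lborel_translate)
      show "(\<integral>\<^sup>+y. I y \<partial>lborel) = emeasure lborel (ball (0::'a) 1)"
        unfolding I_def by (rule nn_integral_indicator) simp
    qed simp
    finally show "(\<integral>\<^sup>+y. f (B x) * I (B x - y) \<partial>lborel) = f (B x) * emeasure lborel (ball (0::'a) 1)"
      by (simp add: nn_integral_cmult)
  qed
  also have "\<dots> = (\<integral>\<^sup>+x. f (B x) \<partial>lborel) * emeasure lborel (ball (0::'a) 1)"
    by (simp add: nn_integral_multc)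
  finally show ?thesis by simp
qed

lemma emeasure_unit_ball_pos:
  "emeasure lborel (ball (0 :: 'a::euclidean_space) 1) \<noteq> 0"
  "emeasure lborel (ball (0 :: 'a::euclidean_space) 1) \<noteq> top"
proof -
  show "emeasure lborel (ball (0 :: 'a) 1) \<noteq> top"
    using emeasure_lborel_ball_finite[of "0 :: 'a" 1] by auto
  have "unit_ball_vol (real DIM('a)) > 0"
    by (rule unit_ball_vol_pos) simp
  then show "emeasure lborel (ball (0 :: 'a) 1) \<noteq> 0"
    by (metis emeasure_ball ennreal_eq_0_iff mult.right_neutral not_less power_one zero_le_one)
qed

text \<open>The preimage of the unit ball under \<open>B\<close> lies in the ball of radius \<open>K\<close>, and translations do
  not change the integral.\<close>

lemma nn_integral_linear_le:
  fixes B :: "'a::euclidean_space \<Rightarrow> 'a" and f :: "'a \<Rightarrow> ennreal"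
  assumes [measurable]: "f \<in> borel_measurable borel"
    and B: "linear B" "\<And>x. norm x \<le> K * norm (B x)" and K: "K \<ge> 0"
  shows "(\<integral>\<^sup>+x. f (B x + b) \<partial>lborel) \<le> ennreal (K ^ DIM('a)) * (\<integral>\<^sup>+x. f x \<partial>lborel)"
proof -
  let ?v = "emeasure lborel (ball (0::'a) 1)"
  have inj: "inj B"
    using B(2) by (intro linear_injective_0[OF B(1), THEN iffD2]) (metis mult_zero_right norm_le_zero_iff norm_zero)
  have sub: "B -` ball 0 1 \<subseteq> cball 0 K"
  proof
    fix x assume "x \<in> B -` ball 0 1"
    then have "norm (B x) \<le> 1" by simp
    then have "K * norm (B x) \<le> K * 1" using K by (intro mult_left_mono) auto
    with B(2)[of x] show "x \<in> cball 0 K" by simp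
  qed
  have "emeasure lborel (B -` ball 0 1) \<le> emeasure lborel (cball (0::'a) K)"
    by (rule emeasure_mono[OF sub]) simp
  also have "\<dots> = ennreal (K ^ DIM('a)) * ?v"
    using K unit_ball_vol_nonneg[of "real DIM('a)"] by (simp add: emeasure_cball emeasure_ball mult.commute flip: ennreal_mult)
  finally have le: "emeasure lborel (B -` ball 0 1) \<le> ennreal (K ^ DIM('a)) * ?v" .
  have "(\<integral>\<^sup>+x. f (B x + b) \<partial>lborel) * ?v = (\<integral>\<^sup>+x. f (x + b) \<partial>lborel) * emeasure lborel (B -` ball 0 1)"
    by (rule nn_integral_linear_ratio[OF _ B(1) inj, of "\<lambda>x. f (x + b)"]) measurable
  also have "(\<integral>\<^sup>+x. f (x + b) \<partial>lborel) = (\<integral>\<^sup>+x. f x \<partial>lborel)"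
    using nn_integral_lborel_translate[of f b] by (simp add: add.commute)
  also have "(\<integral>\<^sup>+x. f x \<partial>lborel) * emeasure lborel (B -` ball 0 1)
      \<le> (\<integral>\<^sup>+x. f x \<partial>lborel) * (ennreal (K ^ DIM('a)) * ?v)"
    by (intro mult_left_mono le) simp
  finally have "(\<integral>\<^sup>+x. f (B x + b) \<partial>lborel) * ?v \<le> (ennreal (K ^ DIM('a)) * (\<integral>\<^sup>+x. f x \<partial>lborel)) * ?v"
    by (simp add: ac_simps)
  then show ?thesis
    using emeasure_unit_ball_pos[where 'a='a]
    by (metis ennreal_mult_le_mult_iff mult.commute)
qed

lemma distr_lborel_isometry:
  fixes B :: "'a::euclidean_space \<Rightarrow> 'a"
  assumes B: "linear B" "\<And>x. norm (B x) = norm x"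
  shows "distr lborel borel B = lborel"
proof (rule measure_eqI)
  have mB [measurable]: "B \<in> borel_measurable borel"
    by (intro borel_measurable_continuous_onI linear_continuous_on linear_linear[THEN iffD2] B)
  have inj: "inj B"
    using B(2) by (intro linear_injective_0[OF B(1), THEN iffD2]) (metis norm_eq_zero)
  fix A assume "A \<in> sets (distr lborel borel B)"
  then have A [measurable]: "A \<in> sets borel" by simp
  have U: "B -` ball 0 1 = ball 0 1" using B(2) by auto
  have "(\<integral>\<^sup>+x. indicator A (B x) \<partial>lborel) * emeasure lborel (ball (0::'a) 1)
       = (\<integral>\<^sup>+x. indicator A x \<partial>lborel) * emeasure lborel (B -` ball 0 1)"
    by (rule nn_integral_linear_ratio[OF _ B(1) inj]) measurable
  then have "(\<integral>\<^sup>+x. indicator A (B x) \<partial>lborel) = (\<integral>\<^sup>+x. indicator A x \<partial>lborel)"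
    using emeasure_unit_ball_pos[where 'a='a] unfolding U
    by (metis ennreal_mult_cancel_left mult.commute)
  moreover have "emeasure (distr lborel borel B) A = (\<integral>\<^sup>+x. indicator A x \<partial>distr lborel borel B)"
    by simp
  ultimately show "emeasure (distr lborel borel B) A = emeasure lborel A"
    by (simp add: nn_integral_distr del: nn_integral_indicator) simp
qed simp

section \<open>Polynomials in one variable and means over circles\<close>

definition unity_root :: "nat \<Rightarrow> nat \<Rightarrow> complex"
  where "unity_root K i = cis (2 * pi * real i / real K)"

lemma norm_unity_root [simp]: "cmod (unity_root K i) = 1"
  by (simp add: unity_root_def)

text \<open>Orthogonality of characters of the cyclic group of order \<open>K\<close>. Because \<open>d\<close> and \<open>l\<close> are both
  below \<open>K\<close>, the finite sum separates powers as exactly as the integral over the circle would.\<close>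

lemma sum_unity_root_power:
  assumes "d < K" "l < K"
  shows "(\<Sum>i<K. unity_root K i ^ d * cnj (unity_root K i) ^ l) = (if d = l then of_nat K else 0)"
proof -
  define z where "z = unity_root K d * cnj (unity_root K l)"
  have pw: "unity_root K i ^ d * cnj (unity_root K i) ^ l = z ^ i" for i
  proof -
    have comm: "unity_root K i ^ d = unity_root K d ^ i" for d
    proof -
      have "real d * (2 * pi * real i / real K) = real i * (2 * pi * real d / real K)" by simp
      then show ?thesis unfolding unity_root_def Complex.DeMoivre by (rule arg_cong)
    qed
    then have "cnj (unity_root K i) ^ l = cnj (unity_root K l) ^ i"
      by (metis complex_cnj_power)
    with comm show ?thesis by (simp add: z_def power_mult_distrib)
  qed
  have K: "K > 0" using assms by simp
  have u: "unity_root K i * cnj (unity_root K i) = 1" for i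
    by (metis complex_norm_square norm_unity_root of_real_1 power_one)
  show ?thesis
  proof (cases "d = l")
    case True
    then have "z = 1" using u by (simp add: z_def)
    then show ?thesis using True unfolding pw by simp
  next
    case False
    have "inj_on (unity_root K) {..<K}"
      using Complex.bij_betw_roots_unity[OF K] unfolding unity_root_def bij_betw_def by blast
    then have ne: "unity_root K d \<noteq> unity_root K l"
      using assms False by (auto dest: inj_onD)
    have "z \<noteq> 1"
    proof
      assume "z = 1"
      then have "unity_root K d * (cnj (unity_root K l) * unity_root K l) = unity_root K l"
        by (simp add: z_def mult.assoc[symmetric])
      then show False using ne u[of l] by (simp add: mult.commute)
    qed
    moreover have "z ^ K = 1"
    proof -
      have "unity_root K i ^ K = 1" for i
      proof -
        have "real K * (2 * pi * real i / real K) = 2 * pi * real i"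
          using K by simp
        then have "unity_root K i ^ K = cis (2 * pi * real i)"
          unfolding unity_root_def Complex.DeMoivre by simp
        also have "\<dots> = 1" by (rule cis_multiple_2pi) simp
        finally show ?thesis .
      qed
      then show ?thesis
        by (simp add: z_def power_mult_distrib flip: complex_cnj_power)
    qed
    ultimately have "(\<Sum>i<K. z ^ i) = 0"
      by (simp add: sum_gp_strict)
    then show ?thesis using False by (simp add: pw)
  qed
qed

lemma coeff_eq_circle_mean:
  assumes "degree k < K" "l < K"
  shows "(\<Sum>i<K. poly k (c * unity_root K i) * cnj (unity_root K i) ^ l) = of_nat K * (coeff k l * c ^ l)"
proof -
  have "poly k x = (\<Sum>d<K. coeff k d * x ^ d)" for x
  proof -
    have "poly k x = (\<Sum>d\<le>degree k. coeff k d * x ^ d)" by (rule poly_altdef)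
    also have "\<dots> = (\<Sum>d<K. coeff k d * x ^ d)"
      using assms by (intro sum.mono_neutral_left) (auto simp: coeff_eq_0)
    finally show ?thesis .
  qed
  then have "(\<Sum>i<K. poly k (c * unity_root K i) * cnj (unity_root K i) ^ l)
      = (\<Sum>i<K. \<Sum>d<K. coeff k d * c ^ d * (unity_root K i ^ d * cnj (unity_root K i) ^ l))"
    by (simp only: sum_distrib_right sum_distrib_left power_mult_distrib mult_ac)
  also have "\<dots> = (\<Sum>d<K. coeff k d * c ^ d * (\<Sum>i<K. unity_root K i ^ d * cnj (unity_root K i) ^ l))"
    by (subst sum.swap) (simp add: sum_distrib_left)
  also have "\<dots> = (\<Sum>d<K. if d = l then of_nat K * (coeff k l * c ^ l) else 0)"
    using assms by (intro sum.cong refl) (auto simp: sum_unity_root_power)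
  also have "\<dots> = of_nat K * (coeff k l * c ^ l)"
    using assms by simp
  finally show ?thesis .
qed

lemma sum_power2_le: "(\<Sum>i<K. a i)\<^sup>2 \<le> real K * (\<Sum>i<K. (a i)\<^sup>2)" for a :: "nat \<Rightarrow> real"
  using Cauchy_Schwarz_ineq_sum[of "\<lambda>i. 1" a "{..<K}"] by simp

lemma coeff_le_circle_mean:
  assumes "degree k < K" "l < K"
  shows "(cmod (coeff k l) * cmod c ^ l)\<^sup>2 \<le> (\<Sum>i<K. (cmod (poly k (c * unity_root K i)))\<^sup>2) / real K"
proof -
  let ?a = "\<lambda>i. cmod (poly k (c * unity_root K i))"
  have K: "real K > 0" using assms by simp
  have "real K * (cmod (coeff k l) * cmod c ^ l)
      = cmod (\<Sum>i<K. poly k (c * unity_root K i) * cnj (unity_root K i) ^ l)"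
    unfolding coeff_eq_circle_mean[OF assms] by (simp add: norm_mult norm_power)
  also have "\<dots> \<le> (\<Sum>i<K. ?a i)"
    by (rule order_trans[OF norm_sum]) (simp add: norm_mult norm_power)
  finally have "(real K * (cmod (coeff k l) * cmod c ^ l))\<^sup>2 \<le> (\<Sum>i<K. ?a i)\<^sup>2"
    by (intro power_mono) auto
  also have "\<dots> \<le> real K * (\<Sum>i<K. (?a i)\<^sup>2)"
    by (rule sum_power2_le)
  finally have "real K * (real K * (cmod (coeff k l) * cmod c ^ l)\<^sup>2) \<le> real K * (\<Sum>i<K. (?a i)\<^sup>2)"
    by (simp add: power_mult_distrib power2_eq_square mult_ac)
  then have "real K * (cmod (coeff k l) * cmod c ^ l)\<^sup>2 \<le> (\<Sum>i<K. (?a i)\<^sup>2)"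
    using K by simp
  then show ?thesis using K by (simp add: field_simps)
qed

text \<open>These are \<open>m + 1\<close> radii in \<open>[1/2, 1)\<close> with spacing \<open>1 / (2 (m + 1))\<close>, one more than
  the number of roots to be avoided.\<close>

definition radius :: "nat \<Rightarrow> nat \<Rightarrow> real"
  where "radius m j = 1 / 2 + real j / (2 * (real m + 1))"

lemma radius_bounds: "j \<le> m \<Longrightarrow> 1 / 2 \<le> radius m j" "j \<le> m \<Longrightarrow> radius m j \<le> 1"
  by (auto simp: radius_def field_simps)

text \<open>Pigeonhole: a root whose modulus is within half the spacing of a radius is so for only one
  radius, and there are fewer than \<open>m + 1\<close> roots.\<close>

lemma good_radius_exists:
  fixes q :: "complex poly"
  assumes q: "q \<noteq> 0" "degree q \<le> m"
  obtains j where "j \<le> m" "\<And>a. poly q a = 0 \<Longrightarrow> \<bar>cmod a - radius m j\<bar> \<ge> 1 / (4 * (real m + 1))"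
proof -
  let ?e = "1 / (4 * (real m + 1))"
  have "\<exists>j\<le>m. \<forall>a. poly q a = 0 \<longrightarrow> \<bar>cmod a - radius m j\<bar> \<ge> ?e"
  proof (rule ccontr)
    assume "\<not> ?thesis"
    then have "\<forall>j\<in>{..m}. \<exists>a. poly q a = 0 \<and> \<bar>cmod a - radius m j\<bar> < ?e"
      by (fastforce simp only: not_le not_all not_imp atMost_iff not_ex de_Morgan_conj)
    then obtain a where a: "\<And>j. j \<le> m \<Longrightarrow> poly q (a j) = 0" "\<And>j. j \<le> m \<Longrightarrow> \<bar>cmod (a j) - radius m j\<bar> < ?e"
      by (metis atMost_iff)
    have "inj_on a {..m}"
    proof (rule inj_onI)
      fix i j assume ij: "i \<in> {..m}" "j \<in> {..m}" "a i = a j"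
      have "\<bar>radius m i - radius m j\<bar> < 2 * ?e"
        using a(2)[of i] a(2)[of j] ij by auto
      also have "radius m i - radius m j = (real i - real j) * (2 * ?e)"
      proof -
        have "2 * ?e = 1 / (2 * (real m + 1))" by (simp add: field_simps)
        then show ?thesis by (simp add: radius_def diff_divide_distrib)
      qed
      finally have "\<bar>real i - real j\<bar> * (2 * ?e) < 1 * (2 * ?e)"
        unfolding abs_mult by simp
      then have "\<bar>real i - real j\<bar> < 1"
        by (rule mult_right_less_imp_less) simp
      then show "i = j" by linarith
    qed
    then have "card {..m} = card (a ` {..m})"
      by (simp add: card_image)
    also have "\<dots> \<le> card {x. poly q x = 0}"
      by (intro card_mono poly_roots_finite q) (auto simp: a)
    also have "\<dots> \<le> degree q"
      by (rule card_poly_roots_bound) (rule q)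
    finally show False using q(2) by simp
  qed
  then show thesis using that by blast
qed

text \<open>Each linear factor satisfies \<open>|y - a| \<le> R + |a|\<close>, while \<open>|x - a|\<close> is at least \<open>e\<close> and
  at least comparable to \<open>|a|\<close> for large \<open>a\<close>; so the quotient of the factors is bounded
  independently of \<open>a\<close>.\<close>

lemma poly_growth_off_roots:
  fixes q :: "complex poly"
  assumes "degree q \<le> m" "e > 0" "e \<le> 1" "cmod x \<le> 1" "cmod y \<le> R"
    and far: "\<And>a. poly q a = 0 \<Longrightarrow> \<bar>cmod a - cmod x\<bar> \<ge> e"
  shows "cmod (poly q y) \<le> ((R + 1) / e + 1) ^ m * cmod (poly q x)"
proof -
  let ?c = "(R + 1) / e + 1"
  have R: "R \<ge> 0" using assms(5) norm_ge_zero order_trans by blast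
  then have c1: "?c \<ge> 1" using assms by simp
  obtain rs where rs: "smult (lead_coeff q) (\<Prod>a\<leftarrow>rs. [:-a, 1:]) = q" "length rs = degree q"
  proof -
    obtain rs where rs: "mset rs = proots q"
      using ex_mset by blast
    have "(\<Prod>a\<leftarrow>rs. [:-a, 1:]) = (\<Prod>a\<in>#proots q. [:-a, 1:])"
      unfolding rs[symmetric] by (metis mset_map prod_mset_prod_list)
    then show thesis
      using that[of rs] complex_poly_decompose_multiset[of q] size_proots_complex[of q] rs
      by (metis size_mset)
  qed
  have qe: "poly q u = lead_coeff q * poly (\<Prod>a\<leftarrow>rs. [:-a, 1:]) u" for u
    using arg_cong[OF rs(1), of "\<lambda>p. poly p u"] by simp
  have far': "a \<in> set rs \<Longrightarrow> \<bar>cmod a - cmod x\<bar> \<ge> e" for a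
  proof -
    assume "a \<in> set rs"
    then have "poly (\<Prod>a\<leftarrow>rs. [:-a, 1:]) a = 0"
      by (induction rs) auto
    then have "poly q a = 0" unfolding qe by simp
    then show ?thesis by (rule far)
  qed
  have "cmod (poly (\<Prod>a\<leftarrow>l. [:-a, 1:]) y) \<le> ?c ^ length l * cmod (poly (\<Prod>a\<leftarrow>l. [:-a, 1:]) x)"
    if "\<And>a. a \<in> set l \<Longrightarrow> \<bar>cmod a - cmod x\<bar> \<ge> e" for l
    using that
  proof (induction l)
    case (Cons a l)
    have e: "\<bar>cmod a - cmod x\<bar> \<ge> e" using Cons.prems by simp
    have x: "\<bar>cmod a - cmod x\<bar> \<le> cmod (x - a)"
      using norm_triangle_ineq3[of a x] by (simp add: norm_minus_commute)
    have "cmod (y - a) \<le> R + cmod a"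
      using norm_triangle_ineq4[of y a] assms by linarith
    also have "\<dots> \<le> (R + 1) + \<bar>cmod a - cmod x\<bar>"
      using assms by linarith
    also have "\<dots> \<le> (R + 1) / e * \<bar>cmod a - cmod x\<bar> + \<bar>cmod a - cmod x\<bar>"
      using e R assms mult_left_mono[OF e, of "(R + 1) / e"] by simp
    also have "\<dots> = ?c * \<bar>cmod a - cmod x\<bar>" by (simp add: algebra_simps)
    also have "\<dots> \<le> ?c * cmod (x - a)" using x c1 by (intro mult_left_mono) auto
    finally have "cmod (y - a) \<le> ?c * cmod (x - a)" .
    then have "cmod (y - a) * cmod (poly (\<Prod>a\<leftarrow>l. [:-a, 1:]) y)
        \<le> (?c * cmod (x - a)) * (?c ^ length l * cmod (poly (\<Prod>a\<leftarrow>l. [:-a, 1:]) x))"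
      using Cons c1 by (intro mult_mono) auto
    moreover have "poly (\<Prod>a\<leftarrow>a # l. [:-a, 1:]) u = (u - a) * poly (\<Prod>a\<leftarrow>l. [:-a, 1:]) u" for u
      by (simp add: algebra_simps)
    ultimately show ?case
      by (simp only: norm_mult mult_ac power_Suc list.size add_0 add_Suc_right add_0_right)
  qed simp
  from this[of rs] have *: "cmod (poly (\<Prod>a\<leftarrow>rs. [:-a, 1:]) y) \<le> ?c ^ degree q * cmod (poly (\<Prod>a\<leftarrow>rs. [:-a, 1:]) x)"
    using far' rs by simp
  have "cmod (poly q y) = cmod (lead_coeff q) * cmod (poly (\<Prod>a\<leftarrow>rs. [:-a, 1:]) y)"
    unfolding qe norm_mult ..
  also have "\<dots> \<le> cmod (lead_coeff q) * (?c ^ degree q * cmod (poly (\<Prod>a\<leftarrow>rs. [:-a, 1:]) x))"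
    by (intro mult_left_mono *) simp
  also have "\<dots> = ?c ^ degree q * cmod (poly q x)"
    unfolding qe norm_mult by (simp only: mult_ac)
  also have "\<dots> \<le> ?c ^ m * cmod (poly q x)"
    using assms c1 by (intro mult_right_mono power_increasing) auto
  finally show ?thesis .
qed

text \<open>The sum over all candidate radii avoids having to choose the good one measurably when the
  polynomial varies with a parameter.\<close>

definition circle_mean :: "nat \<Rightarrow> nat \<Rightarrow> (complex \<Rightarrow> real) \<Rightarrow> real"
  where "circle_mean m K h = (\<Sum>j\<le>m. (\<Sum>i<K. h (of_real (radius m j) * unity_root K i)) / real K)"

text \<open>The key fact of one variable. On the good circle \<open>|q|\<close> is bounded below by a multiple of
  \<open>|q y|\<close>, and the coefficients of \<open>k\<close> are means of its values there. The constant depends on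
  the degree of \<open>q\<close> only, although \<open>k\<close> may have any degree below the number \<open>K\<close> of sample
  points.\<close>

theorem poly_times_coeff_le_circle_mean:
  fixes q k :: "complex poly"
  assumes "degree q \<le> m" "degree k < K" "l < K" "cmod y \<le> R" "R \<ge> 1"
  shows "(cmod (poly q y) * cmod (coeff k l))\<^sup>2
    \<le> (16 * (real m + 1) * R) ^ (2 * m) * 4 ^ l * circle_mean m K (\<lambda>x. (cmod (poly q x * poly k x))\<^sup>2)"
    (is "_ \<le> ?C * _ * circle_mean m K ?h")
proof (cases "q = 0")
  case True
  then show ?thesis by (simp add: circle_mean_def)
next
  case False
  obtain j where j: "j \<le> m" "\<And>a. poly q a = 0 \<Longrightarrow> \<bar>cmod a - radius m j\<bar> \<ge> 1 / (4 * (real m + 1))"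
    using good_radius_exists[OF False assms(1)] by blast
  let ?r = "radius m j"
  have r: "1 / 2 \<le> ?r" "?r \<le> 1" using radius_bounds[OF j(1)] by auto
  let ?c = "(R + 1) / (1 / (4 * (real m + 1))) + 1"
  have "?c = (R + 1) * (4 * (real m + 1)) + 1" by simp
  also have "\<dots> \<le> (2 * R) * (4 * (real m + 1)) + R * (real m + 1)"
  proof (rule add_mono)
    show "(R + 1) * (4 * (real m + 1)) \<le> (2 * R) * (4 * (real m + 1))"
      using assms by (intro mult_right_mono) auto
    show "1 \<le> R * (real m + 1)" using assms mult_mono[of 1 R 1 "real m + 1"] by simp
  qed
  also have "\<dots> \<le> 16 * (real m + 1) * R" using assms by (simp add: algebra_simps)
  finally have c: "?c \<le> 16 * (real m + 1) * R" .
  have c0: "?c \<ge> 0" using assms by simp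
  have *: "(cmod (poly q y))\<^sup>2 \<le> ?C * (cmod (poly q (of_real ?r * unity_root K i)))\<^sup>2" for i
  proof -
    have "cmod (poly q y) \<le> ?c ^ m * cmod (poly q (of_real ?r * unity_root K i))"
      using r j assms by (intro poly_growth_off_roots) (auto simp: norm_mult)
    also have "\<dots> \<le> (16 * (real m + 1) * R) ^ m * cmod (poly q (of_real ?r * unity_root K i))"
      by (intro mult_right_mono power_mono c c0) auto
    finally have "(cmod (poly q y))\<^sup>2 \<le> ((16 * (real m + 1) * R) ^ m * cmod (poly q (of_real ?r * unity_root K i)))\<^sup>2"
      by (intro power_mono) auto
    also have "\<dots> = ?C * (cmod (poly q (of_real ?r * unity_root K i)))\<^sup>2"
      by (simp add: power_mult_distrib power_mult[symmetric] mult.commute)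
    finally show ?thesis .
  qed
  have "(cmod (coeff k l))\<^sup>2 \<le> 4 ^ l * (cmod (coeff k l) * cmod (of_real ?r) ^ l)\<^sup>2"
  proof -
    have "1 \<le> 2 * ?r" using r by simp
    then have "1 \<le> ((2 * ?r) ^ l)\<^sup>2" by (intro one_le_power)
    also have "((2 * ?r) ^ l)\<^sup>2 = 4 ^ l * (?r ^ l)\<^sup>2"
      by (simp add: power_mult_distrib power2_eq_square) (simp flip: power_mult_distrib)
    finally have "(cmod (coeff k l))\<^sup>2 * 1 \<le> (cmod (coeff k l))\<^sup>2 * (4 ^ l * (?r ^ l)\<^sup>2)"
      by (intro mult_left_mono) auto
    then show ?thesis using r by (simp add: power_mult_distrib mult_ac)
  qed
  also have "\<dots> \<le> 4 ^ l * ((\<Sum>i<K. (cmod (poly k (of_real ?r * unity_root K i)))\<^sup>2) / real K)"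
    using coeff_le_circle_mean[OF assms(2,3), of "of_real ?r"] by (intro mult_left_mono) auto
  finally have "(cmod (poly q y) * cmod (coeff k l))\<^sup>2
     \<le> (cmod (poly q y))\<^sup>2 * (4 ^ l * ((\<Sum>i<K. (cmod (poly k (of_real ?r * unity_root K i)))\<^sup>2) / real K))"
    unfolding power_mult_distrib by (intro mult_left_mono) auto
  also have "\<dots> = 4 ^ l * ((\<Sum>i<K. (cmod (poly q y))\<^sup>2 * (cmod (poly k (of_real ?r * unity_root K i)))\<^sup>2) / real K)"
    by (simp add: sum_distrib_left mult_ac)
  also have "\<dots> \<le> 4 ^ l * ((\<Sum>i<K. ?C * ?h (of_real ?r * unity_root K i)) / real K)"
  proof (intro mult_left_mono divide_right_mono sum_mono)
    fix i
    show "(cmod (poly q y))\<^sup>2 * (cmod (poly k (of_real ?r * unity_root K i)))\<^sup>2 \<le> ?C * ?h (of_real ?r * unity_root K i)"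
      using mult_right_mono[OF *[of i], of "(cmod (poly k (of_real ?r * unity_root K i)))\<^sup>2"]
      by (simp add: norm_mult power_mult_distrib mult_ac)
  qed auto
  also have "\<dots> = ?C * 4 ^ l * ((\<Sum>i<K. ?h (of_real ?r * unity_root K i)) / real K)"
    by (simp flip: sum_distrib_left)
  also have "\<dots> \<le> ?C * 4 ^ l * circle_mean m K ?h"
  proof (rule mult_left_mono)
    show "(\<Sum>i<K. ?h (of_real ?r * unity_root K i)) / real K \<le> circle_mean m K ?h"
      unfolding circle_mean_def
      by (rule member_le_sum[of j "{..m}" "\<lambda>j. (\<Sum>i<K. ?h (of_real (radius m j) * unity_root K i)) / real K"])
        (use j in \<open>auto intro!: divide_nonneg_nonneg sum_nonneg\<close>)
  qed (use assms in auto)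
  finally show ?thesis .
qed

section \<open>Polynomials in several variables and the Euler identity\<close>

abbreviation expo :: "('n::finite \<Rightarrow>\<^sub>0 nat) \<Rightarrow> 'n \<Rightarrow> nat" where "expo \<equiv> Poly_Mapping.lookup"
abbreviation pcoeff :: "'n::finite cpoly \<Rightarrow> ('n \<Rightarrow>\<^sub>0 nat) \<Rightarrow> complex" where "pcoeff \<equiv> Poly_Mapping.lookup"

definition monomial_eval :: "('n::finite \<Rightarrow>\<^sub>0 nat) \<Rightarrow> complex ^ 'n \<Rightarrow> complex"
  where "monomial_eval a z = (\<Prod>i\<in>UNIV. (z $ i) ^ expo a i)"

definition expo_deg :: "('n::finite \<Rightarrow>\<^sub>0 nat) \<Rightarrow> nat"
  where "expo_deg a = (\<Sum>i\<in>UNIV. expo a i)"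

lemma poly_eval_altdef: "poly_eval p z = (\<Sum>a\<in>Poly_Mapping.keys p. pcoeff p a * monomial_eval a z)"
  by (simp add: poly_eval_def monomial_eval_def)

lemma poly_eval_superset:
  assumes "finite S" "Poly_Mapping.keys p \<subseteq> S"
  shows "poly_eval p z = (\<Sum>a\<in>S. pcoeff p a * monomial_eval a z)"
  unfolding poly_eval_altdef using assms
  by (intro sum.mono_neutral_left) (auto simp: in_keys_iff)

lemma poly_eval_0 [simp]: "poly_eval 0 z = 0"
  by (simp add: poly_eval_altdef)

lemma poly_eval_add: "poly_eval (p + q) z = poly_eval p z + poly_eval q z"
proof -
  let ?S = "Poly_Mapping.keys p \<union> Poly_Mapping.keys q"
  have "poly_eval (p + q) z = (\<Sum>a\<in>?S. pcoeff (p + q) a * monomial_eval a z)"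
    by (rule poly_eval_superset) (use Poly_Mapping.keys_add[of p q] in auto)
  also have "\<dots> = poly_eval p z + poly_eval q z"
    by (subst (1 2) poly_eval_superset[where S = ?S])
      (auto simp: lookup_add distrib_right sum.distrib)
  finally show ?thesis .
qed

lemma poly_eval_sum: "poly_eval (\<Sum>x\<in>A. f x) z = (\<Sum>x\<in>A. poly_eval (f x) z)"
  by (induction A rule: infinite_finite_induct) (auto simp: poly_eval_add)

lemma poly_eval_single: "poly_eval (Poly_Mapping.single a c) z = c * monomial_eval a z"
  by (simp add: poly_eval_altdef)

lemma poly_eval_uminus: "poly_eval (- p) z = - poly_eval p z"
  using poly_eval_add[of p "- p" z] by (simp add: eq_neg_iff_add_eq_0 add.commute)

lemma poly_eval_diff: "poly_eval (p - q) z = poly_eval p z - poly_eval q z"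
  using poly_eval_add[of p "- q" z] by (simp add: poly_eval_uminus)

lemma cpoly_sum_single: "p = (\<Sum>a\<in>Poly_Mapping.keys p. Poly_Mapping.single a (pcoeff p a))" for p :: "'n::finite cpoly"
  by (rule poly_mapping_eqI) (simp add: lookup_sum lookup_single when_def in_keys_iff)

lemma monomial_eval_add: "monomial_eval (a + b) z = monomial_eval a z * monomial_eval b z"
  by (simp add: monomial_eval_def lookup_add power_add prod.distrib)

lemma poly_eval_mult: "poly_eval (p * q) z = poly_eval p z * poly_eval q z"
proof -
  have "p * q = (\<Sum>a\<in>Poly_Mapping.keys p. \<Sum>b\<in>Poly_Mapping.keys q.
      Poly_Mapping.single (a + b) (pcoeff p a * pcoeff q b))"
    by (subst cpoly_sum_single[of p], subst cpoly_sum_single[of q])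
      (simp add: sum_product mult_single)
  then have "poly_eval (p * q) z = (\<Sum>a\<in>Poly_Mapping.keys p. \<Sum>b\<in>Poly_Mapping.keys q.
      pcoeff p a * pcoeff q b * monomial_eval (a + b) z)"
    by (simp only: poly_eval_sum poly_eval_single)
  then show ?thesis
    by (simp add: monomial_eval_add poly_eval_altdef sum_product mult_ac)
qed

lemma continuous_on_poly_eval: "continuous_on S (poly_eval p)"
  by (intro holomorphic_on_vec_imp_continuous_on holomorphic_on_vec_poly_eval)

lemma poly_eval_measurable [measurable]: "poly_eval p \<in> borel_measurable borel"
  by (intro borel_measurable_continuous_onI continuous_on_poly_eval)

definition line_poly :: "'n::finite cpoly \<Rightarrow> complex ^ 'n \<Rightarrow> complex ^ 'n \<Rightarrow> complex poly"
  where "line_poly p a b =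
    (\<Sum>c\<in>Poly_Mapping.keys p. smult (pcoeff p c) (\<Prod>i\<in>UNIV. [:a $ i, b $ i:] ^ expo c i))"

lemma poly_line_poly: "poly (line_poly p a b) x = poly_eval p (a + x *s b)"
  by (simp add: line_poly_def poly_eval_def poly_sum poly_prod mult.commute)

lemma degree_line_poly: "degree (line_poly p a b) \<le> total_degree p"
  unfolding line_poly_def
proof (intro degree_sum_le)
  fix c assume c: "c \<in> Poly_Mapping.keys p"
  have "degree (smult (pcoeff p c) (\<Prod>i\<in>UNIV. [:a $ i, b $ i:] ^ expo c i))
      \<le> degree (\<Prod>i\<in>UNIV. [:a $ i, b $ i:] ^ expo c i)"
    by (rule degree_smult_le)
  also have "\<dots> \<le> (\<Sum>i\<in>UNIV. degree ([:a $ i, b $ i:] ^ expo c i))"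
    using degree_prod_sum_le[of UNIV "\<lambda>i. [:a $ i, b $ i:] ^ expo c i"] by (simp add: o_def)
  also have "\<dots> \<le> (\<Sum>i\<in>UNIV. expo c i)"
  proof (rule sum_mono)
    fix i
    have "degree ([:a $ i, b $ i:] ^ expo c i) \<le> degree [:a $ i, b $ i:] * expo c i"
      by (rule degree_power_le)
    also have "\<dots> \<le> 1 * expo c i"
      by (intro mult_right_mono) auto
    finally show "degree ([:a $ i, b $ i:] ^ expo c i) \<le> expo c i" by simp
  qed
  also have "\<dots> \<le> total_degree p"
    unfolding total_degree_def using c by (intro Max_ge) auto
  finally show "degree (smult (pcoeff p c) (\<Prod>i\<in>UNIV. [:a $ i, b $ i:] ^ expo c i)) \<le> total_degree p" .
qed simp

definition partial_deriv :: "'n::finite \<Rightarrow> 'n cpoly \<Rightarrow> 'n cpoly"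
  where "partial_deriv j f = (\<Sum>a\<in>Poly_Mapping.keys f.
    Poly_Mapping.single (a - Poly_Mapping.single j 1) (of_nat (expo a j) * pcoeff f a))"

definition dir_deriv :: "complex ^ 'n \<Rightarrow> 'n::finite cpoly \<Rightarrow> 'n cpoly"
  where "dir_deriv x f = (\<Sum>j\<in>UNIV. Poly_Mapping.single 0 (x $ j) * partial_deriv j f)"

lemma poly_eval_dir_deriv: "poly_eval (dir_deriv x f) z = (\<Sum>j\<in>UNIV. x $ j * poly_eval (partial_deriv j f) z)"
  by (simp add: dir_deriv_def poly_eval_sum poly_eval_mult poly_eval_single monomial_eval_def)

lemma monomial_eval_minus:
  "monomial_eval (a - Poly_Mapping.single j 1) z = (z $ j) ^ (expo a j - 1) * (\<Prod>i\<in>UNIV - {j}. (z $ i) ^ expo a i)"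
proof -
  have "monomial_eval (a - Poly_Mapping.single j 1) z
     = (z $ j) ^ (expo a j - 1) * (\<Prod>i\<in>UNIV - {j}. (z $ i) ^ expo (a - Poly_Mapping.single j 1) i)"
    unfolding monomial_eval_def by (subst prod.remove[of _ j]) (auto simp: lookup_minus)
  also have "(\<Prod>i\<in>UNIV - {j}. (z $ i) ^ expo (a - Poly_Mapping.single j 1) i) = (\<Prod>i\<in>UNIV - {j}. (z $ i) ^ expo a i)"
    by (intro prod.cong refl) (auto simp: lookup_minus lookup_single when_def)
  finally show ?thesis .
qed

lemma monomial_eval_remove: "monomial_eval a z = (z $ j) ^ expo a j * (\<Prod>i\<in>UNIV - {j}. (z $ i) ^ expo a i)"
  unfolding monomial_eval_def by (subst prod.remove[of _ j]) auto

lemma coord_times_monomial_minus: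
  "of_nat (expo a j) * (z $ j * monomial_eval (a - Poly_Mapping.single j 1) z) = of_nat (expo a j) * monomial_eval a z"
proof (cases "expo a j = 0")
  case False
  then have "z $ j * (z $ j) ^ (expo a j - 1) = (z $ j) ^ expo a j"
    by (metis power_eq_if)
  then show ?thesis
    by (simp only: monomial_eval_minus monomial_eval_remove[of a z j] mult.assoc[symmetric])
qed simp

lemma coeff_1_line_poly: "coeff (line_poly f a b) 1 = poly_eval (dir_deriv b f) a"
proof -
  have c1: "coeff p 1 = poly (pderiv p) 0" for p :: "complex poly"
    by (simp add: poly_0_coeff_0 coeff_pderiv)
  have *: "coeff (\<Prod>i\<in>UNIV. [:a $ i, b $ i:] ^ expo c i) 1
      = (\<Sum>j\<in>UNIV. b $ j * (of_nat (expo c j) * monomial_eval (c - Poly_Mapping.single j 1) a))" for c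
  proof -
    have "coeff (\<Prod>i\<in>UNIV. [:a $ i, b $ i:] ^ expo c i) 1
        = (\<Sum>j\<in>UNIV. (\<Prod>i\<in>UNIV - {j}. (a $ i) ^ expo c i) * (of_nat (expo c j) * (a $ j) ^ (expo c j - 1) * b $ j))"
      unfolding c1 by (simp add: pderiv_prod poly_sum poly_prod pderiv_power pderiv_pCons mult_ac)
    also have "\<dots> = (\<Sum>j\<in>UNIV. b $ j * (of_nat (expo c j) * monomial_eval (c - Poly_Mapping.single j 1) a))"
      by (intro sum.cong refl) (simp add: monomial_eval_minus[unfolded One_nat_def] mult_ac)
    finally show ?thesis .
  qed
  have "coeff (line_poly f a b) 1
      = (\<Sum>c\<in>Poly_Mapping.keys f. pcoeff f c * (\<Sum>j\<in>UNIV. b $ j * (of_nat (expo c j) * monomial_eval (c - Poly_Mapping.single j 1) a)))"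
    unfolding line_poly_def coeff_sum coeff_smult * ..
  also have "\<dots> = (\<Sum>c\<in>Poly_Mapping.keys f. \<Sum>j\<in>UNIV. b $ j * (of_nat (expo c j) * pcoeff f c * monomial_eval (c - Poly_Mapping.single j 1) a))"
    by (simp add: sum_distrib_left mult_ac)
  also have "\<dots> = (\<Sum>j\<in>UNIV. \<Sum>c\<in>Poly_Mapping.keys f. b $ j * (of_nat (expo c j) * pcoeff f c * monomial_eval (c - Poly_Mapping.single j 1) a))"
    by (rule sum.swap)
  also have "\<dots> = poly_eval (dir_deriv b f) a"
    by (simp add: poly_eval_dir_deriv partial_deriv_def poly_eval_sum poly_eval_single sum_distrib_left)
  finally show ?thesis .
qed

lemma coeff_0_line_poly: "coeff (line_poly f a b) 0 = poly_eval f a"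
  using poly_line_poly[of f a b 0] by (simp add: poly_0_coeff_0)

text \<open>For \<open>s > 0\<close> this solves \<open>(R + s) F = f\<close>, where \<open>R\<close> is the radial derivative
  \<open>\<Sum> z\<^sub>i \<partial>\<^sub>i\<close>, which multiplies a monomial by its degree. The exact solution avoids a loss of
  a lower order term in the Euler identity.\<close>

definition smoothed :: "nat \<Rightarrow> 'n::finite cpoly \<Rightarrow> 'n cpoly"
  where "smoothed s f = (\<Sum>a\<in>Poly_Mapping.keys f.
    Poly_Mapping.single a (pcoeff f a / of_nat (expo_deg a + s)))"

definition smoothed_deriv :: "nat \<Rightarrow> 'n::finite \<Rightarrow> 'n cpoly \<Rightarrow> 'n cpoly"
  where "smoothed_deriv s j f = (\<Sum>a\<in>Poly_Mapping.keys f.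
    Poly_Mapping.single (a - Poly_Mapping.single j 1) (of_nat (expo a j) * pcoeff f a / of_nat (expo_deg a + s)))"

lemma euler_smoothed:
  assumes "s > 0"
  shows "poly_eval f z = (\<Sum>i\<in>UNIV. z $ i * poly_eval (smoothed_deriv s i f) z) + of_nat s * poly_eval (smoothed s f) z"
proof -
  have "(\<Sum>i\<in>UNIV. z $ i * poly_eval (smoothed_deriv s i f) z)
      = (\<Sum>i\<in>UNIV. \<Sum>a\<in>Poly_Mapping.keys f. pcoeff f a / of_nat (expo_deg a + s) *
          (of_nat (expo a i) * (z $ i * monomial_eval (a - Poly_Mapping.single i 1) z)))"
    by (simp add: smoothed_deriv_def poly_eval_sum poly_eval_single sum_distrib_left mult_ac)
  also have "\<dots> = (\<Sum>i\<in>UNIV. \<Sum>a\<in>Poly_Mapping.keys f. pcoeff f a / of_nat (expo_deg a + s) *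
          (of_nat (expo a i) * monomial_eval a z))"
    by (simp only: coord_times_monomial_minus)
  also have "\<dots> = (\<Sum>a\<in>Poly_Mapping.keys f. pcoeff f a / of_nat (expo_deg a + s) *
          (of_nat (expo_deg a) * monomial_eval a z))"
    by (subst sum.swap) (simp add: expo_deg_def sum_distrib_left sum_distrib_right)
  finally have "(\<Sum>i\<in>UNIV. z $ i * poly_eval (smoothed_deriv s i f) z) + of_nat s * poly_eval (smoothed s f) z
      = (\<Sum>a\<in>Poly_Mapping.keys f. pcoeff f a / of_nat (expo_deg a + s) *
          (of_nat (expo_deg a + s) * monomial_eval a z))"
    by (simp add: smoothed_def poly_eval_sum poly_eval_single sum_distrib_left algebra_simps flip: sum.distrib)
  also have "\<dots> = poly_eval f z"
    unfolding poly_eval_altdef using assms by (intro sum.cong refl) (simp del: of_nat_add)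
  finally show ?thesis by simp
qed

lemma monomial_eval_scaleR: "monomial_eval a (r *\<^sub>R z) = of_real r ^ expo_deg a * monomial_eval a z"
proof -
  have "monomial_eval a (r *\<^sub>R z) = (\<Prod>i\<in>UNIV. of_real r ^ expo a i) * monomial_eval a z"
    by (simp add: monomial_eval_def power_mult_distrib scaleR_conv_of_real[symmetric] flip: prod.distrib)
      (simp add: scaleR_conv_of_real power_mult_distrib)
  then show ?thesis by (simp add: expo_deg_def power_sum)
qed

lemma expo_deg_minus: "expo a j > 0 \<Longrightarrow> expo_deg (a - Poly_Mapping.single j 1) = expo_deg a - 1"
  unfolding expo_deg_def
  by (subst (1 2) sum.remove[of _ j]) (auto simp: lookup_minus lookup_single when_def intro!: sum.cong)

lemma expo_le_deg: "expo a j \<le> expo_deg a"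
  unfolding expo_deg_def by (rule member_le_sum) auto

lemma has_integral_one_minus_power:
  "((\<lambda>s. complex_of_real (1 - s) ^ k) has_integral 1 / of_nat (k + 1)) {0..1}"
proof -
  have "((\<lambda>s::real. complex_of_real (1 - s) ^ k) has_integral
      - (of_real (1 - 1) ^ (k + 1) / of_nat (k + 1)) - - (of_real (1 - 0) ^ (k + 1) / of_nat (k + 1))) {0..1}"
  proof (rule fundamental_theorem_of_calculus)
    fix x :: real
    have "((\<lambda>s. - ((1 - s) ^ (k + 1) / of_nat (k + 1))) has_field_derivative (1 - of_real x) ^ k) (at (of_real x :: complex))"
      by (rule derivative_eq_intros refl | simp del: of_nat_Suc)+
    from has_vector_derivative_real_field[OF this]
    show "((\<lambda>s. - (complex_of_real (1 - s) ^ (k + 1) / of_nat (k + 1))) has_vector_derivative complex_of_real (1 - x) ^ k) (at x within {0..1})"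
      by (simp add: o_def has_vector_derivative_at_within)
  qed simp
  then show ?thesis by simp
qed

text \<open>Inverting the radial derivative amounts to integrating along the segment from the origin: a
  monomial of degree \<open>k\<close> contributes the integral of \<open>(1 - u)\<^sup>k\<^sup>+\<^sup>s\<^sup>-\<^sup>1\<close>.\<close>

lemma smoothed_has_integral:
  assumes "s > 0"
  shows "((\<lambda>u. of_real (1 - u) ^ (s - 1) * poly_eval f ((1 - u) *\<^sub>R z)) has_integral poly_eval (smoothed s f) z) {0..1}"
proof -
  have "((\<lambda>u. \<Sum>a\<in>Poly_Mapping.keys f. pcoeff f a * monomial_eval a z * of_real (1 - u) ^ (expo_deg a + s - 1))
      has_integral (\<Sum>a\<in>Poly_Mapping.keys f. pcoeff f a * monomial_eval a z * (1 / of_nat (expo_deg a + s - 1 + 1)))) {0..1}"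
    by (intro has_integral_sum has_integral_mult_right has_integral_one_minus_power) simp
  also have "(\<Sum>a\<in>Poly_Mapping.keys f. pcoeff f a * monomial_eval a z * (1 / of_nat (expo_deg a + s - 1 + 1)))
      = poly_eval (smoothed s f) z"
    using assms by (simp add: smoothed_def poly_eval_sum poly_eval_single)
  also have "(\<lambda>u. \<Sum>a\<in>Poly_Mapping.keys f. pcoeff f a * monomial_eval a z * of_real (1 - u) ^ (expo_deg a + s - 1))
      = (\<lambda>u. of_real (1 - u) ^ (s - 1) * poly_eval f ((1 - u) *\<^sub>R z))"
  proof
    fix u :: real
    have "complex_of_real (1 - u) ^ (expo_deg a + s - 1) = of_real (1 - u) ^ (s - 1) * of_real (1 - u) ^ expo_deg a" for a :: "'a \<Rightarrow>\<^sub>0 nat"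
      using assms by (simp flip: power_add) (simp add: add.commute)
    then show "(\<Sum>a\<in>Poly_Mapping.keys f. pcoeff f a * monomial_eval a z * of_real (1 - u) ^ (expo_deg a + s - 1))
      = of_real (1 - u) ^ (s - 1) * poly_eval f ((1 - u) *\<^sub>R z)"
      by (simp add: poly_eval_altdef monomial_eval_scaleR sum_distrib_left mult_ac)
  qed
  finally show ?thesis .
qed

lemma smoothed_deriv_has_integral:
  assumes "s > 0"
  shows "((\<lambda>u. of_real (1 - u) ^ s * poly_eval (dir_deriv x f) ((1 - u) *\<^sub>R z)) has_integral
     (\<Sum>j\<in>UNIV. x $ j * poly_eval (smoothed_deriv s j f) z)) {0..1}"
proof -
  have "((\<lambda>u. of_real (1 - u) ^ s * poly_eval (partial_deriv j f) ((1 - u) *\<^sub>R z)) has_integral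
     poly_eval (smoothed_deriv s j f) z) {0..1}" for j
  proof -
    let ?c = "\<lambda>a. of_nat (expo a j) * pcoeff f a * monomial_eval (a - Poly_Mapping.single j 1) z"
    have "((\<lambda>u. \<Sum>a\<in>Poly_Mapping.keys f. ?c a * of_real (1 - u) ^ (expo_deg a + s - 1))
        has_integral (\<Sum>a\<in>Poly_Mapping.keys f. ?c a * (1 / of_nat (expo_deg a + s - 1 + 1)))) {0..1}"
      by (intro has_integral_sum has_integral_mult_right has_integral_one_minus_power) simp
    also have "(\<Sum>a\<in>Poly_Mapping.keys f. ?c a * (1 / of_nat (expo_deg a + s - 1 + 1)))
        = poly_eval (smoothed_deriv s j f) z"
      using assms by (simp add: smoothed_deriv_def poly_eval_sum poly_eval_single mult_ac)
    also have "(\<lambda>u. \<Sum>a\<in>Poly_Mapping.keys f. ?c a * of_real (1 - u) ^ (expo_deg a + s - 1))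
        = (\<lambda>u. of_real (1 - u) ^ s * poly_eval (partial_deriv j f) ((1 - u) *\<^sub>R z))"
    proof
      fix u :: real
      have "?c a * of_real (1 - u) ^ (expo_deg a + s - 1)
        = of_real (1 - u) ^ s * (of_nat (expo a j) * pcoeff f a * monomial_eval (a - Poly_Mapping.single j 1) ((1 - u) *\<^sub>R z))" for a :: "'a \<Rightarrow>\<^sub>0 nat"
      proof (cases "expo a j = 0")
        case False
        then have "expo_deg a > 0" using expo_le_deg[of a j] by linarith
        then have "complex_of_real (1 - u) ^ (expo_deg a + s - 1) = of_real (1 - u) ^ s * of_real (1 - u) ^ (expo_deg a - 1)"
          by (simp flip: power_add) (simp add: add.commute)
        then show ?thesis using False by (simp add: monomial_eval_scaleR expo_deg_minus[unfolded One_nat_def] mult_ac)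
      qed simp
      then show "(\<Sum>a\<in>Poly_Mapping.keys f. ?c a * of_real (1 - u) ^ (expo_deg a + s - 1))
        = of_real (1 - u) ^ s * poly_eval (partial_deriv j f) ((1 - u) *\<^sub>R z)"
        by (simp only: partial_deriv_def poly_eval_sum poly_eval_single sum_distrib_left)
    qed
    finally show ?thesis .
  qed
  then have "((\<lambda>u. \<Sum>j\<in>UNIV. x $ j * (of_real (1 - u) ^ s * poly_eval (partial_deriv j f) ((1 - u) *\<^sub>R z))) has_integral
     (\<Sum>j\<in>UNIV. x $ j * poly_eval (smoothed_deriv s j f) z)) {0..1}"
    by (intro has_integral_sum has_integral_mult_right) auto
  then show ?thesis
    by (simp add: poly_eval_dir_deriv sum_distrib_left mult_ac)
qed

lemma norm_le_nn_integral_of_has_integral: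
  fixes h :: "real \<Rightarrow> complex"
  assumes "continuous_on {0..1} h" "(h has_integral I) {0..1}"
  shows "ennreal (norm I) \<le> (\<integral>\<^sup>+u. ennreal (norm (h u)) * indicator {0<..<1} u \<partial>lborel)"
proof -
  have int: "set_integrable lborel {0..1} h"
    unfolding set_integrable_def by (rule borel_integrable_compact) (use assms in auto)
  have "I = (LINT u:{0..1}|lborel. h u)"
    using set_borel_integral_eq_integral(2)[OF int] assms(2) by (simp add: integral_unique)
  then have "ennreal (norm I) \<le> (\<integral>\<^sup>+u. ennreal (norm (indicator {0..1} u *\<^sub>R h u)) \<partial>lborel)"
    using integral_norm_bound_ennreal[OF int[unfolded set_integrable_def]]
    by (simp add: set_lebesgue_integral_def)
  also have "\<dots> = (\<integral>\<^sup>+u. ennreal (norm (h u)) * indicator {0<..<1} u \<partial>lborel)"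
  proof (rule nn_integral_cong_AE)
    have "AE u in lborel. u \<noteq> (0::real)" "AE u in lborel. u \<noteq> (1::real)"
      by (rule AE_lborel_singleton)+
    then show "AE u in lborel. ennreal (norm (indicator {0..1} u *\<^sub>R h u)) = ennreal (norm (h u)) * indicator {0<..<1} u"
      by eventually_elim (auto simp: indicator_def)
  qed
  finally show ?thesis .
qed

section \<open>A weighted estimate for integrals along radial paths\<close>

lemma nn_integral_powr_le:
  assumes "a > -1" "b \<ge> 0"
  shows "(\<integral>\<^sup>+s. ennreal (s powr a) * indicator {0<..b} s \<partial>lborel) \<le> ennreal (b powr (a + 1) / (a + 1))"
proof -
  have "((\<lambda>s. if s \<in> {0..b} then s powr a else 0) has_integral b powr (a + 1) / (a + 1)) UNIV"
    unfolding has_integral_restrict_UNIV by (rule has_integral_powr_from_0) (use assms in auto)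
  then have "(\<integral>\<^sup>+s. ennreal (if s \<in> {0..b} then s powr a else 0) \<partial>lborel) = ennreal (b powr (a + 1) / (a + 1))"
    by (intro nn_integral_has_integral_lborel) auto
  moreover have "(\<integral>\<^sup>+s. ennreal (s powr a) * indicator {0<..b} s \<partial>lborel)
      \<le> (\<integral>\<^sup>+s. ennreal (if s \<in> {0..b} then s powr a else 0) \<partial>lborel)"
    by (intro nn_integral_mono) (auto simp: indicator_def)
  ultimately show ?thesis by simp
qed

text \<open>A Schur test. The inner integral is split by Cauchy-Schwarz with the weights
  \<open>s powr (- \<theta> / 2)\<close> and \<open>s powr (\<theta> / 2)\<close>, the first of which is square integrable
  since \<open>\<theta> < 1\<close>. After Tonelli and the substitution \<open>w = T b s z\<close>, a point \<open>w\<close> is reached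
  only for \<open>s \<le> 2 (1 - |w|\<^sup>2)\<close>; the integral of \<open>s powr (\<theta> - 1)\<close> over this range is the
  source of the weight \<open>(1 - |w|\<^sup>2) powr \<theta>\<close>, and it is finite since \<open>0 < \<theta>\<close>. The power
  \<open>(1 - s)\<^sup>\<kappa>\<close> absorbs the loss of \<open>Y\<close> and of the Jacobians where \<open>s\<close> is near \<open>1\<close>.\<close>

lemma weighted_radial_estimate:
  fixes h :: "complex ^ 'n \<Rightarrow> real" and T :: "'b \<Rightarrow> real \<Rightarrow> complex ^ 'n \<Rightarrow> complex ^ 'n"
  assumes \<theta>: "0 < \<theta>" "\<theta> < 1"
    and h [measurable]: "h \<in> borel_measurable borel" and h0: "\<And>w. h w \<ge> 0"
    and S [measurable]: "S \<in> sets borel"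
    and I: "finite I" "\<And>b. b \<in> I \<Longrightarrow> wt b \<ge> 0" and C: "C \<ge> 0"
    and T [measurable]: "\<And>b. (\<lambda>x. T b (fst x) (snd x)) \<in> borel_measurable (borel \<Otimes>\<^sub>M borel)"
    and Tint: "\<And>b s \<Phi>. b \<in> I \<Longrightarrow> 0 < s \<Longrightarrow> s < 1 \<Longrightarrow> \<Phi> \<in> borel_measurable borel \<Longrightarrow>
      (\<integral>\<^sup>+z. \<Phi> (T b s z) \<partial>lborel) \<le> ennreal ((2 / (1 - s)) ^ DIM(complex ^ 'n)) * (\<integral>\<^sup>+z. \<Phi> z \<partial>lborel)"
    and Tn: "\<And>b s z. b \<in> I \<Longrightarrow> 0 < s \<Longrightarrow> s < 1 \<Longrightarrow> z \<in> S \<Longrightarrow> (norm (T b s z))\<^sup>2 \<le> 1 - s / 2"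
    and Y0: "\<And>s z. Y s z \<ge> 0"
    and Y: "\<And>s z. z \<in> S \<Longrightarrow> 0 < s \<Longrightarrow> s < 1 \<Longrightarrow>
      (Y s z)\<^sup>2 \<le> C * (\<Sum>b\<in>I. wt b * h (T b s z)) / (s * (1 - s) ^ (2 * m))"
    and \<kappa>: "2 * m + DIM(complex ^ 'n) \<le> 2 * \<kappa>"
  shows "(\<integral>\<^sup>+z. indicator S z * (\<integral>\<^sup>+s. ennreal ((1 - s) ^ \<kappa> * Y s z) * indicator {0<..<1} s \<partial>lborel)\<^sup>2 \<partial>lborel)
    \<le> ennreal (C * sum wt I * 2 ^ DIM(complex ^ 'n) * 2 powr \<theta> / (\<theta> * (1 - \<theta>)))
      * (\<integral>\<^sup>+w. ennreal ((1 - (norm w)\<^sup>2) powr \<theta> * h w) * indicator (ball 0 1) w \<partial>lborel)"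
proof -
  let ?N = "DIM(complex ^ 'n)"
  define H where "H s z = (\<Sum>b\<in>I. wt b * h (T b s z))" for s z
  have H0: "H s z \<ge> 0" for s z
    unfolding H_def using h0 I by (intro sum_nonneg) auto
  have Hm [measurable]: "(\<lambda>x. H (fst x) (snd x)) \<in> borel_measurable (borel \<Otimes>\<^sub>M borel)"
    unfolding H_def by measurable
  have Hm1 [measurable]: "(\<lambda>s. H s z) \<in> borel_measurable borel" for z
    using measurable_compose[OF _ Hm, of "\<lambda>s. (s, z)" borel] by simp
  have [measurable]: "Measurable.pred borel (\<lambda>x :: complex ^ 'n. x \<in> ball 0 1)"
    unfolding mem_ball by measurable
  have [measurable]: "(\<lambda>x. H (snd x) (fst x)) \<in> borel_measurable (borel \<Otimes>\<^sub>M borel)"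
    using measurable_compose[OF measurable_pair_swap' Hm] by (simp add: case_prod_unfold)
  have [measurable]: "(\<lambda>x. indicator {0<..<1} (snd x) :: ennreal)
      \<in> borel_measurable ((lborel :: (complex ^ 'n) measure) \<Otimes>\<^sub>M (lborel :: real measure))"
    by (rule measurable_compose[OF measurable_snd borel_measurable_indicator]) simp
  have [measurable]: "(\<lambda>x. indicator {0<..<1} (fst x) :: ennreal)
      \<in> borel_measurable ((lborel :: real measure) \<Otimes>\<^sub>M (lborel :: (complex ^ 'n) measure))"
    by (rule measurable_compose[OF measurable_fst borel_measurable_indicator]) simp
  have Tm1 [measurable]: "(\<lambda>z. T b s z) \<in> borel_measurable borel" for b s
    using measurable_compose[OF _ T[of b], of "\<lambda>z. (s, z)" borel] by simp
  let ?q = "\<lambda>s z. ennreal (s powr (\<theta> - 1) * (1 - s) ^ (2 * \<kappa> - 2 * m) * (C * H s z)) * indicator {0<..<1} s"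
  have step1: "(\<integral>\<^sup>+s. ennreal ((1 - s) ^ \<kappa> * Y s z) * indicator {0<..<1} s \<partial>lborel)\<^sup>2
      \<le> ennreal (1 / (1 - \<theta>)) * (\<integral>\<^sup>+s. ?q s z \<partial>lborel)" if z: "z \<in> S" for z
  proof -
    define u where "u s = ennreal (s powr (- \<theta> / 2)) * indicator {0<..<1} s" for s :: real
    define v where "v s = ennreal (s powr (\<theta> / 2) * ((1 - s) ^ \<kappa> * sqrt (C * H s z / (s * (1 - s) ^ (2 * m))))) * indicator {0<..<1} s" for s :: real
    have [measurable]: "u \<in> borel_measurable lborel" "v \<in> borel_measurable lborel"
      unfolding u_def v_def by measurable
    have "(\<integral>\<^sup>+s. ennreal ((1 - s) ^ \<kappa> * Y s z) * indicator {0<..<1} s \<partial>lborel) \<le> (\<integral>\<^sup>+s. u s * v s \<partial>lborel)"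
    proof (rule nn_integral_mono)
      fix s :: real
      show "ennreal ((1 - s) ^ \<kappa> * Y s z) * indicator {0<..<1} s \<le> u s * v s"
      proof (cases "s \<in> {0<..<1}")
        case True
        then have s: "0 < s" "s < 1" by auto
        have "s powr (- \<theta> / 2) * s powr (\<theta> / 2) = 1"
          using s by (simp flip: powr_add)
        moreover have "Y s z \<le> sqrt (C * H s z / (s * (1 - s) ^ (2 * m)))"
          using Y[OF z s] by (intro real_le_rsqrt) (simp add: H_def)
        ultimately have "(1 - s) ^ \<kappa> * Y s z \<le> s powr (- \<theta> / 2) * (s powr (\<theta> / 2) * ((1 - s) ^ \<kappa> * sqrt (C * H s z / (s * (1 - s) ^ (2 * m)))))"
          using s by (simp add: mult.assoc[symmetric] mult_left_mono)
        then show ?thesis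
          using True by (simp add: u_def v_def ennreal_leI flip: ennreal_mult')
      qed simp
    qed
    then have "(\<integral>\<^sup>+s. ennreal ((1 - s) ^ \<kappa> * Y s z) * indicator {0<..<1} s \<partial>lborel)\<^sup>2 \<le> (\<integral>\<^sup>+s. u s * v s \<partial>lborel)\<^sup>2"
      by (intro power_mono) auto
    also have "\<dots> \<le> (\<integral>\<^sup>+s. (u s)\<^sup>2 \<partial>lborel) * (\<integral>\<^sup>+s. (v s)\<^sup>2 \<partial>lborel)"
      by (rule Cauchy_Schwarz_nn_integral) measurable
    also have "\<dots> \<le> ennreal (1 / (1 - \<theta>)) * (\<integral>\<^sup>+s. ?q s z \<partial>lborel)"
    proof (rule mult_mono)
      have "(\<integral>\<^sup>+s. (u s)\<^sup>2 \<partial>lborel) \<le> (\<integral>\<^sup>+s. ennreal (s powr (- \<theta>)) * indicator {0<..1} s \<partial>lborel)"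
      proof (rule nn_integral_mono)
        fix s :: real
        show "(u s)\<^sup>2 \<le> ennreal (s powr (- \<theta>)) * indicator {0<..1} s"
          by (auto simp: u_def indicator_def power2_eq_square simp flip: ennreal_mult powr_add)
      qed
      also have "\<dots> \<le> ennreal (1 / (1 - \<theta>))"
        using nn_integral_powr_le[of "- \<theta>" 1] \<theta> by simp
      finally show "(\<integral>\<^sup>+s. (u s)\<^sup>2 \<partial>lborel) \<le> ennreal (1 / (1 - \<theta>))" .
      show "(\<integral>\<^sup>+s. (v s)\<^sup>2 \<partial>lborel) \<le> (\<integral>\<^sup>+s. ?q s z \<partial>lborel)"
      proof (rule nn_integral_mono)
        fix s :: real
        show "(v s)\<^sup>2 \<le> ?q s z"
        proof (cases "s \<in> {0<..<1}")
          case True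
          then have s: "0 < s" "s < 1" by auto
          let ?X = "s powr (\<theta> / 2) * ((1 - s) ^ \<kappa> * sqrt (C * H s z / (s * (1 - s) ^ (2 * m))))"
          have "?X\<^sup>2 = (s powr (\<theta> / 2))\<^sup>2 * (1 - s) ^ (2 * \<kappa>) * (C * H s z / (s * (1 - s) ^ (2 * m)))"
            using s C H0[of s z] by (simp add: power_mult_distrib power_mult[symmetric] mult.commute[of _ 2])
          also have "(s powr (\<theta> / 2))\<^sup>2 = s powr (\<theta> - 1) * s"
          proof -
            have "(s powr (\<theta> / 2))\<^sup>2 = s powr \<theta>"
              using s by (simp add: power2_eq_square flip: powr_add)
            also have "\<dots> = s powr (\<theta> - 1) * s"
              using powr_add[of s "\<theta> - 1" 1] s by simp
            finally show ?thesis .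
          qed
          also have "(1 - s) ^ (2 * \<kappa>) = (1 - s) ^ (2 * \<kappa> - 2 * m) * (1 - s) ^ (2 * m)"
            using \<kappa> by (simp flip: power_add)
          finally have "?X\<^sup>2 = s powr (\<theta> - 1) * (1 - s) ^ (2 * \<kappa> - 2 * m) * (C * H s z)"
            using s by (simp add: field_simps)
          moreover have "?X \<ge> 0" using s C H0[of s z] by simp
          ultimately show ?thesis
            using True by (simp add: v_def ennreal_power)
        qed (simp add: v_def)
      qed
    qed auto
    finally show ?thesis .
  qed
  \<comment> \<open>The truncation records where displaced points can lie; it is what restricts \<open>s\<close> for given \<open>w\<close>.\<close>
  define \<Phi> where "\<Phi> s w = ennreal (h w) * indicator {w. (norm w)\<^sup>2 \<le> 1 - s / 2} w" for s :: real and w :: "complex ^ 'n"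
  have \<Phi>m [measurable]: "(\<lambda>x. \<Phi> (fst x) (snd x)) \<in> borel_measurable (borel \<Otimes>\<^sub>M borel)"
    unfolding \<Phi>_def indicator_def by measurable
  have \<Phi>m1 [measurable]: "\<Phi> s \<in> borel_measurable borel" for s
    using measurable_compose[OF _ \<Phi>m, of "\<lambda>z. (s, z)" borel] by simp
  define g where "g s = ennreal (s powr (\<theta> - 1)) * indicator {0<..<1} s" for s :: real
  have [measurable]: "g \<in> borel_measurable borel"
    unfolding g_def by measurable
  have [measurable]: "(\<lambda>x. \<Phi> (snd x) (fst x)) \<in> borel_measurable (borel \<Otimes>\<^sub>M borel)"
    using measurable_compose[OF measurable_pair_swap' \<Phi>m] by (simp add: case_prod_unfold)
  have step2: "(\<integral>\<^sup>+z. indicator S z * ?q s z \<partial>lborel)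
      \<le> ennreal (C * sum wt I * 2 ^ ?N) * ((\<integral>\<^sup>+w. \<Phi> s w \<partial>lborel) * g s)" for s :: real
  proof (cases "s \<in> {0<..<1}")
    case True
    then have s: "0 < s" "s < 1" by auto
    let ?c = "s powr (\<theta> - 1) * (1 - s) ^ (2 * \<kappa> - 2 * m) * C"
    have c0: "?c \<ge> 0" using s C by simp
    have "(\<integral>\<^sup>+z. indicator S z * ?q s z \<partial>lborel)
        \<le> (\<integral>\<^sup>+z. ennreal ?c * (\<Sum>b\<in>I. ennreal (wt b) * \<Phi> s (T b s z)) \<partial>lborel)"
    proof (rule nn_integral_mono)
      fix z :: "complex ^ 'n"
      show "indicator S z * ?q s z \<le> ennreal ?c * (\<Sum>b\<in>I. ennreal (wt b) * \<Phi> s (T b s z))"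
      proof (cases "z \<in> S")
        case zS: True
        have "(\<Sum>b\<in>I. ennreal (wt b) * \<Phi> s (T b s z)) = (\<Sum>b\<in>I. ennreal (wt b * h (T b s z)))"
          using Tn[OF _ s zS] I h0 by (intro sum.cong refl) (simp add: \<Phi>_def ennreal_mult)
        also have "\<dots> = ennreal (H s z)"
          unfolding H_def using I h0 by (intro sum_ennreal) auto
        finally show ?thesis
          using c0 H0[of s z] by (simp add: zS True mult.assoc ennreal_mult[symmetric] mult_nonneg_nonneg C s)
      qed simp
    qed
    also have "\<dots> = ennreal ?c * (\<Sum>b\<in>I. ennreal (wt b) * (\<integral>\<^sup>+z. \<Phi> s (T b s z) \<partial>lborel))"
      by (simp add: nn_integral_cmult nn_integral_sum)
    also have "\<dots> \<le> ennreal ?c * (\<Sum>b\<in>I. ennreal (wt b) * (ennreal ((2 / (1 - s)) ^ ?N) * (\<integral>\<^sup>+z. \<Phi> s z \<partial>lborel)))"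
      using s by (intro mult_left_mono sum_mono Tint) auto
    also have "\<dots> = ennreal ?c * (ennreal (sum wt I) * (ennreal ((2 / (1 - s)) ^ ?N) * (\<integral>\<^sup>+z. \<Phi> s z \<partial>lborel)))"
      using I by (simp add: sum_distrib_right[symmetric])
    also have "\<dots> = ennreal (?c * sum wt I * (2 / (1 - s)) ^ ?N) * (\<integral>\<^sup>+z. \<Phi> s z \<partial>lborel)"
    proof -
      have "0 \<le> sum wt I" using I by (auto intro: sum_nonneg)
      then have "ennreal (?c * sum wt I * (2 / (1 - s)) ^ ?N) = ennreal ?c * ennreal (sum wt I) * ennreal ((2 / (1 - s)) ^ ?N)"
        using c0 s by (subst ennreal_mult, simp, simp, subst ennreal_mult) auto
      then show ?thesis by (simp only: mult.assoc)
    qed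
    also have "\<dots> \<le> ennreal (C * sum wt I * 2 ^ ?N * s powr (\<theta> - 1)) * (\<integral>\<^sup>+z. \<Phi> s z \<partial>lborel)"
    proof (intro mult_right_mono ennreal_leI)
      have "(1 - s) ^ (2 * \<kappa> - 2 * m) * (2 / (1 - s)) ^ ?N \<le> (1 - s) ^ ?N * (2 / (1 - s)) ^ ?N"
        using s \<kappa> by (intro mult_right_mono power_decreasing) auto
      also have "\<dots> = ((1 - s) * (2 / (1 - s))) ^ ?N" by (rule power_mult_distrib[symmetric])
      also have "(1 - s) * (2 / (1 - s)) = 2" using s by (simp add: field_simps)
      finally have "(C * sum wt I * s powr (\<theta> - 1)) * ((1 - s) ^ (2 * \<kappa> - 2 * m) * (2 / (1 - s)) ^ ?N)
          \<le> (C * sum wt I * s powr (\<theta> - 1)) * 2 ^ ?N"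
        using C I by (intro mult_left_mono mult_nonneg_nonneg sum_nonneg) auto
      then show "?c * sum wt I * (2 / (1 - s)) ^ ?N \<le> C * sum wt I * 2 ^ ?N * s powr (\<theta> - 1)"
        by (simp only: mult_ac)
    qed auto
    also have "\<dots> = ennreal (C * sum wt I * 2 ^ ?N) * ((\<integral>\<^sup>+w. \<Phi> s w \<partial>lborel) * g s)"
    proof -
      have "0 \<le> C * sum wt I * 2 ^ ?N" using I C by (auto intro!: mult_nonneg_nonneg sum_nonneg)
      then have "ennreal (C * sum wt I * 2 ^ ?N * s powr (\<theta> - 1)) = ennreal (C * sum wt I * 2 ^ ?N) * ennreal (s powr (\<theta> - 1))"
        by (rule ennreal_mult) simp
      then show ?thesis using True by (simp add: g_def mult_ac)
    qed
    finally show ?thesis .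
  qed (simp add: g_def)
  have step3: "(\<integral>\<^sup>+s. \<Phi> s w * g s \<partial>lborel)
      \<le> ennreal (2 powr \<theta> / \<theta>) * (ennreal ((1 - (norm w)\<^sup>2) powr \<theta> * h w) * indicator (ball 0 1) w)" for w
  proof (cases "w \<in> ball 0 1")
    case True
    then have nw: "(norm w)\<^sup>2 < 1" by (simp add: power_less_one_iff)
    let ?b = "2 * (1 - (norm w)\<^sup>2)"
    have "(\<integral>\<^sup>+s. \<Phi> s w * g s \<partial>lborel)
        \<le> (\<integral>\<^sup>+s. ennreal (h w) * (ennreal (s powr (\<theta> - 1)) * indicator {0<..?b} s) \<partial>lborel)"
      by (intro nn_integral_mono) (auto simp: \<Phi>_def g_def indicator_def)
    also have "\<dots> = ennreal (h w) * (\<integral>\<^sup>+s. ennreal (s powr (\<theta> - 1)) * indicator {0<..?b} s \<partial>lborel)"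
      by (rule nn_integral_cmult) measurable
    also have "\<dots> \<le> ennreal (h w) * ennreal (?b powr \<theta> / \<theta>)"
      using nn_integral_powr_le[of "\<theta> - 1" ?b] \<theta> nw by (intro mult_left_mono) auto
    also have "?b powr \<theta> = 2 powr \<theta> * (1 - (norm w)\<^sup>2) powr \<theta>"
      by (rule powr_mult)
    finally show ?thesis
      using True \<theta> h0[of w] by (simp add: ennreal_mult[symmetric] mult_ac)
  next
    case False
    then have "1 \<le> (norm w)\<^sup>2" by simp
    then have "\<Phi> s w * g s = 0" for s
      by (auto simp: \<Phi>_def g_def indicator_def)
    then have "(\<integral>\<^sup>+s. \<Phi> s w * g s \<partial>lborel) = 0"
      by (simp only: nn_integral_0_iff_AE nn_integral_const) simp
    then show ?thesis by simp
  qed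
  have "(\<integral>\<^sup>+z. indicator S z * (\<integral>\<^sup>+s. ennreal ((1 - s) ^ \<kappa> * Y s z) * indicator {0<..<1} s \<partial>lborel)\<^sup>2 \<partial>lborel)
      \<le> (\<integral>\<^sup>+z. ennreal (1 / (1 - \<theta>)) * (\<integral>\<^sup>+s. indicator S z * ?q s z \<partial>lborel) \<partial>lborel)"
  proof (rule nn_integral_mono)
    fix z
    show "indicator S z * (\<integral>\<^sup>+s. ennreal ((1 - s) ^ \<kappa> * Y s z) * indicator {0<..<1} s \<partial>lborel)\<^sup>2
       \<le> ennreal (1 / (1 - \<theta>)) * (\<integral>\<^sup>+s. indicator S z * ?q s z \<partial>lborel)"
      using step1[of z] by (cases "z \<in> S") auto
  qed
  also have "\<dots> = ennreal (1 / (1 - \<theta>)) * (\<integral>\<^sup>+z. (\<integral>\<^sup>+s. indicator S z * ?q s z \<partial>lborel) \<partial>lborel)"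
    by (rule nn_integral_cmult) measurable
  also have "(\<integral>\<^sup>+z. (\<integral>\<^sup>+s. indicator S z * ?q s z \<partial>lborel) \<partial>lborel) = (\<integral>\<^sup>+s. (\<integral>\<^sup>+z. indicator S z * ?q s z \<partial>lborel) \<partial>lborel)"
    by (rule lborel_pair.Fubini') measurable
  also have "\<dots> \<le> (\<integral>\<^sup>+s. ennreal (C * sum wt I * 2 ^ ?N) * ((\<integral>\<^sup>+w. \<Phi> s w \<partial>lborel) * g s) \<partial>lborel)"
    by (intro nn_integral_mono step2)
  also have "\<dots> = ennreal (C * sum wt I * 2 ^ ?N) * (\<integral>\<^sup>+s. (\<integral>\<^sup>+w. \<Phi> s w \<partial>lborel) * g s \<partial>lborel)"
    by (rule nn_integral_cmult) measurable
  also have "(\<integral>\<^sup>+s. (\<integral>\<^sup>+w. \<Phi> s w \<partial>lborel) * g s \<partial>lborel)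
      = (\<integral>\<^sup>+s. (\<integral>\<^sup>+w. \<Phi> s w * g s \<partial>lborel) \<partial>lborel)"
    by (intro nn_integral_cong nn_integral_multc[symmetric]) measurable
  also have "\<dots> = (\<integral>\<^sup>+w. (\<integral>\<^sup>+s. \<Phi> s w * g s \<partial>lborel) \<partial>lborel)"
    by (rule lborel_pair.Fubini') measurable
  also have "\<dots> \<le> (\<integral>\<^sup>+w. ennreal (2 powr \<theta> / \<theta>) * (ennreal ((1 - (norm w)\<^sup>2) powr \<theta> * h w) * indicator (ball 0 1) w) \<partial>lborel)"
    by (intro nn_integral_mono step3)
  also have "\<dots> = ennreal (2 powr \<theta> / \<theta>) * (\<integral>\<^sup>+w. ennreal ((1 - (norm w)\<^sup>2) powr \<theta> * h w) * indicator (ball 0 1) w \<partial>lborel)"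
    by (rule nn_integral_cmult) measurable
  finally have "(\<integral>\<^sup>+z. indicator S z * (\<integral>\<^sup>+s. ennreal ((1 - s) ^ \<kappa> * Y s z) * indicator {0<..<1} s \<partial>lborel)\<^sup>2 \<partial>lborel)
    \<le> ennreal (1 / (1 - \<theta>)) * (ennreal (C * sum wt I * 2 ^ ?N) * (ennreal (2 powr \<theta> / \<theta>) *
        (\<integral>\<^sup>+w. ennreal ((1 - (norm w)\<^sup>2) powr \<theta> * h w) * indicator (ball 0 1) w \<partial>lborel)))"
    by (simp add: mult_left_mono)
  also have "\<dots> = ennreal (C * sum wt I * 2 ^ DIM(complex ^ 'n) * 2 powr \<theta> / (\<theta> * (1 - \<theta>)))
      * (\<integral>\<^sup>+w. ennreal ((1 - (norm w)\<^sup>2) powr \<theta> * h w) * indicator (ball 0 1) w \<partial>lborel)"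
  proof -
    have "0 \<le> C * sum wt I * 2 ^ ?N" using I C by (auto intro!: mult_nonneg_nonneg sum_nonneg)
    then have "ennreal (1 / (1 - \<theta>)) * ennreal (C * sum wt I * 2 ^ ?N) * ennreal (2 powr \<theta> / \<theta>)
        = ennreal (1 / (1 - \<theta>) * (C * sum wt I * 2 ^ ?N) * (2 powr \<theta> / \<theta>))"
      using \<theta> by (simp add: ennreal_mult[symmetric] del: times_divide_eq_left times_divide_eq_right)
    also have "1 / (1 - \<theta>) * (C * sum wt I * 2 ^ ?N) * (2 powr \<theta> / \<theta>) = C * sum wt I * 2 ^ ?N * 2 powr \<theta> / (\<theta> * (1 - \<theta>))"
      by (simp add: mult_ac)
    finally have eq: "ennreal (1 / (1 - \<theta>)) * ennreal (C * sum wt I * 2 ^ ?N) * ennreal (2 powr \<theta> / \<theta>)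
        = ennreal (C * sum wt I * 2 ^ ?N * 2 powr \<theta> / (\<theta> * (1 - \<theta>)))" .
    show ?thesis
      by (subst eq[symmetric]) (simp only: mult.assoc)
  qed
  finally show ?thesis .
qed

section \<open>Values and derivatives dominated by means over displaced points\<close>

lemma circle_mean_mono:
  assumes "\<And>x. cmod x \<le> 1 \<Longrightarrow> h x \<le> g x"
  shows "circle_mean m K h \<le> circle_mean m K g"
  unfolding circle_mean_def
proof (intro sum_mono divide_right_mono assms)
  fix j i assume "j \<in> {..m}"
  then show "cmod (of_real (radius m j) * unity_root K i) \<le> 1"
    using radius_bounds[of j m] by (simp add: norm_mult)
qed simp

lemma circle_mean_cmult: "circle_mean m K (\<lambda>x. c * h x) = c * circle_mean m K h"
  by (simp add: circle_mean_def flip: sum_distrib_left times_divide_eq_right)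

lemma circle_mean_const: "K > 0 \<Longrightarrow> circle_mean m K (\<lambda>x. c) = (real m + 1) * c"
  by (simp add: circle_mean_def algebra_simps)

lemma circle_mean_nonneg: "(\<And>x. h x \<ge> 0) \<Longrightarrow> circle_mean m K h \<ge> 0"
  unfolding circle_mean_def by (intro sum_nonneg divide_nonneg_nonneg) auto

text \<open>The displacement of \<open>(1 - s) z\<close> has size \<open>s\<close> along the complex line through \<open>z\<close> and size
  \<open>sqrt s\<close> in the direction \<open>x\<close>. If \<open>x\<close> is orthogonal to this line, the square of the norm
  moves by \<open>O(s)\<close> only; the factors \<open>1/4\<close> and \<open>1/8\<close> are small enough to remain in the ball.\<close>

definition displaced :: "real \<Rightarrow> complex \<Rightarrow> complex \<Rightarrow> complex ^ 'n \<Rightarrow> complex ^ 'n \<Rightarrow> complex ^ 'n"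
  where "displaced s \<xi> \<xi>' x z = (1 - s) *\<^sub>R ((1 + \<xi> * of_real (s / 4)) *s z) + (\<xi>' * of_real (sqrt s / 8)) *s x"

definition mean_const :: "nat \<Rightarrow> real"
  where "mean_const m = (64 * (real m + 1)) ^ (2 * m) * ((16 * (real m + 1)) ^ (2 * m) * 256)"

lemma mean_const_ge: "mean_const m \<ge> (64 * (real m + 1)) ^ (2 * m)"
proof -
  have "1 * 1 \<le> (16 * (real m + 1)) ^ (2 * m) * 256"
    by (intro mult_mono one_le_power) auto
  then show ?thesis
    unfolding mean_const_def by (simp add: mult_le_cancel_left1)
qed

text \<open>The point \<open>z\<close> lies on the complex line through \<open>(1 - s) z\<close>, at parameter \<open>4 / (1 - s)\<close>
  when the unit of the parameter is a step of length \<open>s / 4\<close> relative to \<open>(1 - s) z\<close>. So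
  the value of \<open>p\<close> at \<open>z\<close> is traded for values near \<open>(1 - s) z\<close> at the price of a power of
  \<open>1 / (1 - s)\<close>.\<close>

lemma poly_value_le_radial_mean:
  fixes p :: "'n::finite cpoly" and k :: "complex poly"
  assumes p: "total_degree p \<le> m" and k: "degree k < K" and s: "0 < s" "s < 1"
  shows "(cmod (poly_eval p z) * cmod (poly k 0))\<^sup>2
    \<le> (64 * (real m + 1)) ^ (2 * m) / (1 - s) ^ (2 * m) *
      circle_mean m K (\<lambda>\<xi>. (cmod (poly_eval p ((1 - s) *\<^sub>R ((1 + \<xi> * of_real (s / 4)) *s z)) * poly k \<xi>))\<^sup>2)"
proof -
  let ?w = "(1 - s) *\<^sub>R z"
  let ?b = "of_real (s / 4) *s ?w"
  let ?q = "line_poly p ?w ?b"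
  have q: "poly ?q \<xi> = poly_eval p ((1 - s) *\<^sub>R ((1 + \<xi> * of_real (s / 4)) *s z))" for \<xi>
  proof -
    have "?w + \<xi> *s ?b = (1 - s) *\<^sub>R ((1 + \<xi> * of_real (s / 4)) *s z)"
      by (simp add: vec_eq_iff scaleR_conv_of_real algebra_simps)
    then show ?thesis by (simp only: poly_line_poly)
  qed
  have "(1 - s) *\<^sub>R ((1 + of_real (4 / (1 - s)) * of_real (s / 4)) *s z) = z"
  proof -
    have "of_real (1 - s) * (1 + of_real (4 / (1 - s)) * of_real (s / 4)) = complex_of_real ((1 - s) * (1 + (4 / (1 - s)) * (s / 4)))"
      by (simp only: of_real_mult of_real_add of_real_1)
    also have "(1 - s) * (1 + (4 / (1 - s)) * (s / 4)) = 1" using s by (simp add: field_simps)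
    finally have e: "of_real (1 - s) * (1 + of_real (4 / (1 - s)) * of_real (s / 4)) = (1 :: complex)" by simp
    then have "of_real (1 - s) * ((1 + of_real (4 / (1 - s)) * of_real (s / 4)) * z $ i) = z $ i" for i
      by (metis mult.assoc mult_1)
    then show ?thesis
      by (simp only: vec_eq_iff vector_scaleR_component vector_smult_component scaleR_conv_of_real[where 'a = complex]) blast
  qed
  then have q0: "poly ?q (of_real (4 / (1 - s))) = poly_eval p z"
    unfolding q by simp
  have ny: "cmod (of_real (4 / (1 - s))) = 4 / (1 - s)"
    using s by (simp only: norm_of_real) simp
  have "(cmod (poly ?q (of_real (4 / (1 - s)))) * cmod (coeff k 0))\<^sup>2
    \<le> (16 * (real m + 1) * (4 / (1 - s))) ^ (2 * m) * 4 ^ 0 * circle_mean m K (\<lambda>x. (cmod (poly ?q x * poly k x))\<^sup>2)"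
  proof (rule poly_times_coeff_le_circle_mean)
    show "degree ?q \<le> m" by (rule order_trans[OF degree_line_poly p])
    show "cmod (of_real (4 / (1 - s))) \<le> 4 / (1 - s)" unfolding ny ..
    show "1 \<le> 4 / (1 - s)" using s by (simp add: field_simps)
  qed (use k in auto)
  moreover have "(16 * (real m + 1) * (4 / (1 - s))) ^ (2 * m) = (64 * (real m + 1)) ^ (2 * m) / (1 - s) ^ (2 * m)"
    by (simp flip: power_divide)
  ultimately show ?thesis
    by (simp only: q0 power_0 mult_1_right poly_0_coeff_0) (simp only: q)
qed

text \<open>The first coefficient along a line with step \<open>sqrt s / 8\<close> is the derivative times this
  step, so its square loses only a factor \<open>1 / s\<close>, not \<open>1 / s\<^sup>2\<close>. This gain is the reason
  why the final exponent is \<open>n\<close>.\<close>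

lemma poly_deriv_le_tangential_mean:
  fixes p f :: "'n::finite cpoly"
  assumes p: "total_degree p \<le> m" and f: "total_degree f < K" and K: "1 < K" and s: "0 < s" "s < 1"
  shows "(cmod (poly_eval p w * poly_eval (dir_deriv x f) w))\<^sup>2
    \<le> ((16 * (real m + 1)) ^ (2 * m) * 256) / s *
      circle_mean m K (\<lambda>\<xi>'. (cmod (poly_eval p (w + (\<xi>' * of_real (sqrt s / 8)) *s x) *
         poly_eval f (w + (\<xi>' * of_real (sqrt s / 8)) *s x)))\<^sup>2)"
proof -
  let ?c = "of_real (sqrt s / 8) *s x"
  let ?q = "line_poly p w ?c" and ?k = "line_poly f w ?c"
  have e: "w + \<xi> *s ?c = w + (\<xi> * of_real (sqrt s / 8)) *s x" for \<xi>
    by (simp add: vec_eq_iff)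
  have ce: "coeff ?k 1 = of_real (sqrt s / 8) * poly_eval (dir_deriv x f) w"
    by (simp add: coeff_1_line_poly[unfolded One_nat_def] poly_eval_dir_deriv sum_distrib_left mult_ac)
  have c: "(cmod (poly ?q 0) * cmod (coeff ?k 1))\<^sup>2 = s / 64 * (cmod (poly_eval p w * poly_eval (dir_deriv x f) w))\<^sup>2"
    unfolding ce using s by (simp add: poly_line_poly norm_mult power_mult_distrib power_divide)
  have "(cmod (poly ?q 0) * cmod (coeff ?k 1))\<^sup>2
    \<le> (16 * (real m + 1) * 1) ^ (2 * m) * 4 ^ 1 * circle_mean m K (\<lambda>x. (cmod (poly ?q x * poly ?k x))\<^sup>2)"
    using K order_trans[OF degree_line_poly p] le_less_trans[OF degree_line_poly f]
    by (intro poly_times_coeff_le_circle_mean) auto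
  then have "s / 64 * (cmod (poly_eval p w * poly_eval (dir_deriv x f) w))\<^sup>2
    \<le> (16 * (real m + 1) * 1) ^ (2 * m) * 4 ^ 1 * circle_mean m K (\<lambda>x. (cmod (poly ?q x * poly ?k x))\<^sup>2)"
    unfolding c .
  then show ?thesis
    unfolding poly_line_poly e using s by (simp add: field_simps)
qed

lemma deriv_le_circle_mean:
  fixes p f :: "'n::finite cpoly"
  assumes p: "total_degree p \<le> m" and f: "total_degree f < K" and df: "\<And>j. total_degree (partial_deriv j f) < K"
    and K: "1 < K" and s: "0 < s" "s < 1"
  shows "(cmod (poly_eval p z * poly_eval (dir_deriv x f) ((1 - s) *\<^sub>R z)))\<^sup>2
    \<le> mean_const m / (s * (1 - s) ^ (2 * m)) *
      circle_mean m K (\<lambda>\<xi>. circle_mean m K (\<lambda>\<xi>'. (cmod (poly_eval p (displaced s \<xi> \<xi>' x z) * poly_eval f (displaced s \<xi> \<xi>' x z)))\<^sup>2))"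
proof -
  let ?w = "(1 - s) *\<^sub>R z"
  let ?w1 = "\<lambda>\<xi>. (1 - s) *\<^sub>R ((1 + \<xi> * of_real (s / 4)) *s z)"
  let ?b = "of_real (s / 4) *s ?w"
  let ?k = "\<Sum>j\<in>UNIV. smult (x $ j) (line_poly (partial_deriv j f) ?w ?b)"
  let ?D = "(16 * (real m + 1)) ^ (2 * m) * 256"
  let ?C = "(64 * (real m + 1)) ^ (2 * m) / (1 - s) ^ (2 * m)"
  have "?w + \<xi> *s ?b = ?w1 \<xi>" for \<xi>
    by (simp add: vec_eq_iff scaleR_conv_of_real algebra_simps)
  then have k: "poly ?k \<xi> = poly_eval (dir_deriv x f) (?w1 \<xi>)" for \<xi>
    by (simp only: poly_sum poly_smult poly_line_poly poly_eval_dir_deriv)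
  have k0: "poly ?k 0 = poly_eval (dir_deriv x f) ?w"
    unfolding k by simp
  have "degree ?k \<le> K - 1"
  proof (rule degree_sum_le)
    fix j
    show "degree (smult (x $ j) (line_poly (partial_deriv j f) ?w ?b)) \<le> K - 1"
      using degree_smult_le[of "x $ j" "line_poly (partial_deriv j f) ?w ?b"]
        degree_line_poly[of "partial_deriv j f" ?w ?b] df[of j] by linarith
  qed simp
  then have dk: "degree ?k < K" using K by linarith
  have "(cmod (poly_eval p z * poly_eval (dir_deriv x f) ?w))\<^sup>2 = (cmod (poly_eval p z) * cmod (poly ?k 0))\<^sup>2"
    unfolding k0 norm_mult ..
  also have "\<dots> \<le> ?C * circle_mean m K (\<lambda>\<xi>. (cmod (poly_eval p (?w1 \<xi>) * poly ?k \<xi>))\<^sup>2)"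
    by (rule poly_value_le_radial_mean[OF p dk s])
  also have "\<dots> \<le> ?C * circle_mean m K (\<lambda>\<xi>. ?D / s * circle_mean m K (\<lambda>\<xi>'. (cmod (poly_eval p (displaced s \<xi> \<xi>' x z) * poly_eval f (displaced s \<xi> \<xi>' x z)))\<^sup>2))"
    unfolding k displaced_def using s
    by (intro mult_left_mono circle_mean_mono poly_deriv_le_tangential_mean[OF p f K s]) auto
  also have "\<dots> = mean_const m / (s * (1 - s) ^ (2 * m)) * circle_mean m K (\<lambda>\<xi>. circle_mean m K (\<lambda>\<xi>'. (cmod (poly_eval p (displaced s \<xi> \<xi>' x z) * poly_eval f (displaced s \<xi> \<xi>' x z)))\<^sup>2))"
    unfolding circle_mean_cmult by (simp add: mean_const_def mult_ac)
  finally show ?thesis .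
qed

text \<open>The radial mean carries the estimate. The mean over \<open>\<xi>'\<close> is that of a constant and gives the
  bound the same form as for derivatives.\<close>

lemma value_le_circle_mean:
  fixes p f :: "'n::finite cpoly"
  assumes p: "total_degree p \<le> m" and f: "total_degree f < K" and K: "1 < K" and s: "0 < s" "s < 1"
  shows "(cmod (poly_eval p z * poly_eval f ((1 - s) *\<^sub>R z)))\<^sup>2
    \<le> mean_const m / (s * (1 - s) ^ (2 * m)) *
      circle_mean m K (\<lambda>\<xi>. circle_mean m K (\<lambda>\<xi>'. (cmod (poly_eval p (displaced s \<xi> \<xi>' 0 z) * poly_eval f (displaced s \<xi> \<xi>' 0 z)))\<^sup>2))"
proof -
  let ?w = "(1 - s) *\<^sub>R z"
  let ?w1 = "\<lambda>\<xi>. (1 - s) *\<^sub>R ((1 + \<xi> * of_real (s / 4)) *s z)"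
  let ?b = "of_real (s / 4) *s ?w"
  let ?k = "line_poly f ?w ?b"
  let ?C = "(64 * (real m + 1)) ^ (2 * m) / (1 - s) ^ (2 * m)"
  let ?M = "\<lambda>\<xi>. (cmod (poly_eval p (?w1 \<xi>) * poly_eval f (?w1 \<xi>)))\<^sup>2"
  have "?w + \<xi> *s ?b = ?w1 \<xi>" for \<xi>
    by (simp add: vec_eq_iff scaleR_conv_of_real algebra_simps)
  then have k: "poly ?k \<xi> = poly_eval f (?w1 \<xi>)" for \<xi>
    by (simp only: poly_line_poly)
  have k0: "poly ?k 0 = poly_eval f ?w"
    unfolding k by simp
  have dk: "degree ?k < K" using degree_line_poly[of f ?w ?b] f by linarith
  have M: "circle_mean m K ?M \<ge> 0" by (rule circle_mean_nonneg) simp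
  have "(cmod (poly_eval p z * poly_eval f ?w))\<^sup>2 = (cmod (poly_eval p z) * cmod (poly ?k 0))\<^sup>2"
    unfolding k0 norm_mult ..
  also have "\<dots> \<le> ?C * circle_mean m K (\<lambda>\<xi>. (cmod (poly_eval p (?w1 \<xi>) * poly ?k \<xi>))\<^sup>2)"
    by (rule poly_value_le_radial_mean[OF p dk s])
  also have "\<dots> = ?C * (1 * circle_mean m K ?M)"
    unfolding k by simp
  also have "\<dots> \<le> mean_const m / (s * (1 - s) ^ (2 * m)) * ((real m + 1) * circle_mean m K ?M)"
  proof (intro mult_mono)
    have "?C \<le> mean_const m / (1 - s) ^ (2 * m)"
      using mean_const_ge s by (intro divide_right_mono) auto
    also have "\<dots> \<le> mean_const m / (s * (1 - s) ^ (2 * m))"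
    proof (intro divide_left_mono)
      have "s * (1 - s) ^ (2 * m) \<le> 1 * (1 - s) ^ (2 * m)" using s by (intro mult_right_mono) auto
      then show "s * (1 - s) ^ (2 * m) \<le> (1 - s) ^ (2 * m)" by simp
      show "mean_const m \<ge> 0" unfolding mean_const_def by simp
    qed (use s in auto)
    finally show "?C \<le> mean_const m / (s * (1 - s) ^ (2 * m))" .
    show "0 \<le> mean_const m / (s * (1 - s) ^ (2 * m))" using s unfolding mean_const_def by simp
  qed (use M in auto)
  also have "(real m + 1) * circle_mean m K ?M = circle_mean m K (\<lambda>\<xi>. circle_mean m K (\<lambda>\<xi>'. (cmod (poly_eval p (displaced s \<xi> \<xi>' 0 z) * poly_eval f (displaced s \<xi> \<xi>' 0 z)))\<^sup>2))"
    using K by (simp add: circle_mean_const displaced_def flip: circle_mean_cmult)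
  finally show ?thesis .
qed

text \<open>What the weighted radial estimate demands of the displaced points: they depend on \<open>z\<close> through
  an invertible affine map with controlled inverse, and they stay inside the ball by an amount
  proportional to \<open>s\<close>.\<close>

definition admissible :: "(complex ^ 'n \<Rightarrow> complex ^ 'n) \<Rightarrow> (complex ^ 'n) set \<Rightarrow> bool"
  where "admissible X S \<longleftrightarrow> S \<in> sets borel \<and> continuous_on UNIV X \<and>
    (\<forall>\<xi> \<xi>' s. cmod \<xi> \<le> 1 \<longrightarrow> cmod \<xi>' \<le> 1 \<longrightarrow> 0 < s \<longrightarrow> s < 1 \<longrightarrow>
      (\<exists>B c. linear B \<and> (\<forall>z. displaced s \<xi> \<xi>' (X z) z = B z + c) \<and> (\<forall>z. norm z \<le> 2 / (1 - s) * norm (B z))) \<and>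
      (\<forall>z\<in>S. (norm (displaced s \<xi> \<xi>' (X z) z))\<^sup>2 \<le> 1 - s / 2))"

definition weighted_mass :: "real \<Rightarrow> (complex ^ 'n \<Rightarrow> complex) \<Rightarrow> ennreal"
  where "weighted_mass \<theta> u = (\<integral>\<^sup>+w. ennreal ((1 - (norm w)\<^sup>2) powr \<theta> * (cmod (u w))\<^sup>2) * indicator (ball 0 1) w \<partial>lborel)"

lemma circle_mean_double:
  "circle_mean m K (\<lambda>\<xi>. circle_mean m K (\<lambda>\<xi>'. H \<xi> \<xi>')) =
    (\<Sum>(j, i, j', i')\<in>{..m} \<times> {..<K} \<times> {..m} \<times> {..<K}. 1 / (real K)\<^sup>2 *
       H (of_real (radius m j) * unity_root K i) (of_real (radius m j') * unity_root K i'))"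
  by (simp add: circle_mean_def sum.cartesian_product[symmetric] sum_divide_distrib power2_eq_square)

lemma displaced_continuous:
  assumes "continuous_on UNIV X"
  shows "continuous_on UNIV (\<lambda>x. displaced (fst x) \<xi> \<xi>' (X (snd x)) (snd x))"
proof -
  have "continuous_on UNIV (\<lambda>x. X (snd x))"
    by (rule continuous_on_compose2[OF assms continuous_on_snd]) (auto intro: continuous_on_id)
  then show ?thesis
    unfolding displaced_def vector_scalar_mult_def
    by (intro continuous_intros) auto
qed

lemma admissible_estimate:
  fixes p f :: "'n::finite cpoly"
  assumes adm: "admissible X S" and \<theta>: "0 < \<theta>" "\<theta> < 1" and K: "K > 0"
    and \<kappa>: "2 * m + DIM(complex ^ 'n) \<le> 2 * \<kappa>"
    and Y0: "\<And>s z. Y s z \<ge> 0"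
    and Y: "\<And>s z. 0 < s \<Longrightarrow> s < 1 \<Longrightarrow> (Y s z)\<^sup>2 \<le> mean_const m / (s * (1 - s) ^ (2 * m)) *
      circle_mean m K (\<lambda>\<xi>. circle_mean m K (\<lambda>\<xi>'. (cmod (poly_eval p (displaced s \<xi> \<xi>' (X z) z) * poly_eval f (displaced s \<xi> \<xi>' (X z) z)))\<^sup>2))"
  shows "(\<integral>\<^sup>+z. indicator S z * (\<integral>\<^sup>+s. ennreal ((1 - s) ^ \<kappa> * Y s z) * indicator {0<..<1} s \<partial>lborel)\<^sup>2 \<partial>lborel)
    \<le> ennreal (mean_const m * (real m + 1)\<^sup>2 * 2 ^ DIM(complex ^ 'n) * 2 powr \<theta> / (\<theta> * (1 - \<theta>)))
      * weighted_mass \<theta> (\<lambda>z. poly_eval p z * poly_eval f z)"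
proof -
  let ?I = "{..m} \<times> {..<K} \<times> {..m} \<times> {..<K}"
  let ?x = "\<lambda>b. of_real (radius m (fst b)) * unity_root K (fst (snd b))"
  let ?x' = "\<lambda>b. of_real (radius m (fst (snd (snd b)))) * unity_root K (snd (snd (snd b)))"
  let ?T = "\<lambda>b s z. displaced s (?x b) (?x' b) (X z) z"
  let ?h = "\<lambda>w. (cmod (poly_eval p w * poly_eval f w))\<^sup>2"
  let ?wt = "\<lambda>b::nat \<times> nat \<times> nat \<times> nat. 1 / (real K)\<^sup>2"
  have S: "S \<in> sets borel" and Xc: "continuous_on UNIV X" using adm by (auto simp: admissible_def)
  have xb: "cmod (?x b) \<le> 1" "cmod (?x' b) \<le> 1" if "b \<in> ?I" for b
    using that radius_bounds[of "fst b" m] radius_bounds[of "fst (snd (snd b))" m] by (auto simp: norm_mult)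
  have "real (card ?I) / (real K)\<^sup>2 = (real m + 1)\<^sup>2"
    using K by (simp add: power2_eq_square field_simps)
  then have W: "sum ?wt ?I = (real m + 1)\<^sup>2" by simp
  have "(\<integral>\<^sup>+z. indicator S z * (\<integral>\<^sup>+s. ennreal ((1 - s) ^ \<kappa> * Y s z) * indicator {0<..<1} s \<partial>lborel)\<^sup>2 \<partial>lborel)
    \<le> ennreal (mean_const m * sum ?wt ?I * 2 ^ DIM(complex ^ 'n) * 2 powr \<theta> / (\<theta> * (1 - \<theta>)))
      * (\<integral>\<^sup>+w. ennreal ((1 - (norm w)\<^sup>2) powr \<theta> * ?h w) * indicator (ball 0 1) w \<partial>lborel)"
  proof (rule weighted_radial_estimate[where T = ?T and m = m])
    show "(\<lambda>x. ?T b (fst x) (snd x)) \<in> borel_measurable (borel \<Otimes>\<^sub>M borel)" for b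
      unfolding borel_prod by (intro borel_measurable_continuous_onI displaced_continuous Xc)
    show "?h \<in> borel_measurable borel" by measurable
    show "mean_const m \<ge> 0" unfolding mean_const_def by simp
    show "(Y s z)\<^sup>2 \<le> mean_const m * (\<Sum>b\<in>?I. ?wt b * ?h (?T b s z)) / (s * (1 - s) ^ (2 * m))"
      if "0 < s" "s < 1" for s z
      using Y[OF that, of z] unfolding circle_mean_double by (simp add: case_prod_unfold)
    show "(norm (?T b s z))\<^sup>2 \<le> 1 - s / 2" if "b \<in> ?I" "0 < s" "s < 1" "z \<in> S" for b s z
      using adm xb[OF that(1)] that unfolding admissible_def by blast
    show "(\<integral>\<^sup>+z. \<Phi> (?T b s z) \<partial>lborel) \<le> ennreal ((2 / (1 - s)) ^ DIM(complex ^ 'n)) * (\<integral>\<^sup>+z. \<Phi> z \<partial>lborel)"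
      if b: "b \<in> ?I" and s: "0 < s" "s < 1" and \<Phi>: "\<Phi> \<in> borel_measurable borel" for b s \<Phi>
    proof -
      obtain B c where B: "linear B" "\<And>z. ?T b s z = B z + c" "\<And>z. norm z \<le> 2 / (1 - s) * norm (B z)"
        using adm xb[OF b] s unfolding admissible_def by blast
      show ?thesis
        unfolding B(2) by (rule nn_integral_linear_le[OF \<Phi> B(1,3)]) (use s in auto)
    qed
  qed (use \<theta> \<kappa> Y0 S in auto)
  then show ?thesis unfolding W weighted_mass_def .
qed

section \<open>Radial, complex tangential and constant displacements\<close>

lemma norm_smult_vec: "norm (c *s z) = cmod c * norm (z :: complex ^ 'n)"
  by (simp add: norm_vec_def norm_mult L2_set_right_distrib)

lemma inner_vec_complex: "inner z w = Re (\<Sum>k\<in>UNIV. z $ k * cnj (w $ k))" for z w :: "complex ^ 'n"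
  by (simp add: inner_vec_def inner_complex_def)

lemma radial_factor_bounds:
  assumes "cmod \<xi> \<le> 1" "0 < s" "s < 1"
  shows "3 / 4 \<le> cmod (1 + \<xi> * of_real (s / 4))" "cmod (1 + \<xi> * of_real (s / 4)) \<le> 1 + s / 4"
proof -
  have c: "cmod (\<xi> * of_real (s / 4)) \<le> s / 4"
    using assms mult_right_mono[of "cmod \<xi>" 1 "s / 4"] by (simp add: norm_mult norm_divide)
  show "cmod (1 + \<xi> * of_real (s / 4)) \<le> 1 + s / 4"
    using norm_triangle_ineq[of 1 "\<xi> * of_real (s / 4)"] c by simp
  show "3 / 4 \<le> cmod (1 + \<xi> * of_real (s / 4))"
    using norm_triangle_ineq2[of 1 "- (\<xi> * of_real (s / 4))"] c assms by simp
qed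

lemma radial_part_bounds:
  fixes z :: "complex ^ 'n"
  assumes "cmod \<xi> \<le> 1" "0 < s" "s < 1"
  defines "a \<equiv> (1 - s) *\<^sub>R ((1 + \<xi> * of_real (s / 4)) *s z)"
  shows "norm z \<le> 2 / (1 - s) * norm a" "norm a \<le> (1 - 3 / 4 * s) * norm z"
proof -
  let ?c = "cmod (1 + \<xi> * of_real (s / 4))"
  have a: "norm a = (1 - s) * ?c * norm z"
    using assms(3) unfolding a_def norm_scaleR norm_smult_vec by (simp only: mult.assoc abs_of_pos diff_gt_0_iff_gt)
  note rf = radial_factor_bounds[OF assms(1-3)]
  have "norm z = 1 * norm z" by simp
  also have "\<dots> \<le> (2 * ?c) * norm z" using rf(1) by (intro mult_right_mono) auto
  also have "\<dots> = 2 / (1 - s) * norm a" using assms(2,3) by (simp add: a)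
  finally show "norm z \<le> 2 / (1 - s) * norm a" .
  have "(1 - s) * ?c \<le> (1 - s) * (1 + s / 4)" using rf(2) assms by (intro mult_left_mono) auto
  also have "\<dots> \<le> 1 - 3 / 4 * s" by (simp add: algebra_simps)
  finally show "norm a \<le> (1 - 3 / 4 * s) * norm z" unfolding a by (rule mult_right_mono) simp
qed

text \<open>For fixed \<open>z \<noteq> 0\<close> these vectors span the complex tangent directions, those orthogonal to the
  complex line through \<open>z\<close>; and they are real linear in \<open>z\<close>, so that displacements remain linear
  substitutions.\<close>

definition tangent :: "'n \<Rightarrow> 'n \<Rightarrow> complex ^ 'n \<Rightarrow> complex ^ 'n"
  where "tangent i j z = (\<chi> k. (if k = j then cnj (z $ i) else 0) - (if k = i then cnj (z $ j) else 0))"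

lemma tangent_orthogonal: "inner (a *s z) (b *s tangent i j z) = 0"
proof -
  have "(\<Sum>k\<in>UNIV. (a *s z) $ k * cnj ((b *s tangent i j z) $ k))
      = (\<Sum>k\<in>UNIV. (if k = j then a * cnj b * (z $ j * z $ i) else 0) - (if k = i then a * cnj b * (z $ i * z $ j) else 0))"
    by (intro sum.cong refl) (auto simp: tangent_def algebra_simps)
  also have "\<dots> = 0"
    by (simp add: sum_subtractf mult.commute)
  finally show ?thesis unfolding inner_vec_complex by simp
qed

lemma norm_tangent_le: "norm (tangent i j z) \<le> 2 * norm z" for z :: "complex ^ 'b"
proof -
  have "tangent i j z = axis j (cnj (z $ i)) - axis i (cnj (z $ j))"
    by (simp add: tangent_def axis_def vec_eq_iff)
  moreover have "norm (axis k c :: complex ^ 'b) = cmod c" for k c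
    by (simp add: norm_eq_sqrt_inner inner_axis_axis)
  ultimately have "norm (tangent i j z) \<le> cmod (z $ i) + cmod (z $ j)"
    using norm_triangle_ineq4[of "axis j (cnj (z $ i))" "axis i (cnj (z $ j))"] by simp
  then show ?thesis
    using Finite_Cartesian_Product.norm_nth_le[of z i] Finite_Cartesian_Product.norm_nth_le[of z j] by linarith
qed

text \<open>Pythagoras makes both requirements work: the tangential part only increases the norm, hence
  injectivity is inherited from the radial part, and it adds at most \<open>s / 16\<close> to the square
  norm of the radial part, which is at most \<open>1 - 3 s / 4\<close>.\<close>

lemma admissible_tangent: "admissible (tangent i j :: complex ^ 'n \<Rightarrow> _) (ball 0 1)"
  unfolding admissible_def
proof (intro conjI allI impI)
  show "continuous_on UNIV (tangent i j :: complex ^ 'n \<Rightarrow> _)"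
  proof -
    have "continuous_on UNIV (\<lambda>z :: complex ^ 'n. (if k = j then cnj (z $ i) else 0) - (if k = i then cnj (z $ j) else 0))" for k
      by (cases "k = j"; cases "k = i") (auto intro!: continuous_intros)
    then show ?thesis
      unfolding tangent_def[abs_def] by (rule continuous_on_vec_lambda)
  qed
  fix \<xi> \<xi>' :: complex and s :: real
  assume \<xi>: "cmod \<xi> \<le> 1" "cmod \<xi>' \<le> 1" and s: "0 < s" "s < 1"
  define a where "a z = (1 - s) *\<^sub>R ((1 + \<xi> * of_real (s / 4)) *s z)" for z :: "complex ^ 'n"
  define b where "b z = (\<xi>' * of_real (sqrt s / 8)) *s tangent i j z" for z :: "complex ^ 'n"
  have d: "displaced s \<xi> \<xi>' (tangent i j z) z = a z + b z" for z
    by (simp add: displaced_def a_def b_def)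
  have "inner (a z) (b z) = 0" for z
    unfolding a_def b_def by (simp only: inner_scaleR_left tangent_orthogonal mult_zero_right)
  then have pyth: "(norm (a z + b z))\<^sup>2 = (norm (a z))\<^sup>2 + (norm (b z))\<^sup>2" for z
    by (intro norm_add_Pythagorean) (simp add: orthogonal_def)
  show "\<exists>B c. linear B \<and> (\<forall>z. displaced s \<xi> \<xi>' (tangent i j z) z = B z + c) \<and> (\<forall>z. norm z \<le> 2 / (1 - s) * norm (B z))"
  proof (intro exI[of _ "\<lambda>z. a z + b z"] exI[of _ 0] conjI allI)
    show "linear (\<lambda>z. a z + b z)"
      by (rule linearI) (simp_all add: a_def b_def tangent_def vec_eq_iff scaleR_conv_of_real[where 'a = complex] algebra_simps)
    fix z :: "complex ^ 'n"
    have "norm (a z) \<le> norm (a z + b z)"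
      by (rule power2_le_imp_le) (simp_all add: pyth)
    then have "2 / (1 - s) * norm (a z) \<le> 2 / (1 - s) * norm (a z + b z)"
      using s by (intro mult_left_mono) auto
    with radial_part_bounds(1)[OF \<xi>(1) s, of z] show "norm z \<le> 2 / (1 - s) * norm (a z + b z)"
      unfolding a_def by linarith
  qed (simp add: d)
  show "\<forall>z\<in>ball 0 1. (norm (displaced s \<xi> \<xi>' (tangent i j z) z))\<^sup>2 \<le> 1 - s / 2"
  proof
    fix z :: "complex ^ 'n" assume "z \<in> ball 0 1"
    then have z: "norm z \<le> 1" by simp
    have "norm (a z) \<le> (1 - 3 / 4 * s) * norm z"
      using radial_part_bounds(2)[OF \<xi>(1) s, of z] by (simp add: a_def)
    also have "\<dots> \<le> (1 - 3 / 4 * s) * 1" using z s by (intro mult_left_mono) auto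
    finally have "(norm (a z))\<^sup>2 \<le> (1 - 3 / 4 * s)\<^sup>2" by (intro power_mono) auto
    also have "\<dots> \<le> 1 - 3 / 4 * s" using s by (simp add: power2_eq_square mult_left_le_one_le)
    finally have A: "(norm (a z))\<^sup>2 \<le> 1 - 3 / 4 * s" .
    have "norm (b z) \<le> 1 * (sqrt s / 8) * (2 * 1)"
      unfolding b_def norm_smult_vec norm_mult
    proof (intro mult_mono)
      show "norm (tangent i j z) \<le> 2 * 1" using norm_tangent_le[of i j z] z by linarith
    qed (use \<xi> s in auto)
    then have "(norm (b z))\<^sup>2 \<le> (sqrt s / 4)\<^sup>2" by (intro power_mono) auto
    then have "(norm (b z))\<^sup>2 \<le> s / 16" using s by (simp add: power_divide)
    with A show "(norm (displaced s \<xi> \<xi>' (tangent i j z) z))\<^sup>2 \<le> 1 - s / 2"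
      unfolding d pyth using s by linarith
  qed
qed simp

text \<open>The two cases are no displacement at all, used for values of \<open>f\<close> on the whole ball, and an
  arbitrary direction on the ball of radius \<open>1/2\<close>, where the displaced points stay away from the
  sphere anyway.\<close>

lemma admissible_const:
  fixes c :: "complex ^ 'n"
  assumes c: "norm c \<le> 1" and r: "c = 0 \<and> r = 1 \<or> r = 1 / 2"
  shows "admissible (\<lambda>z. c) (ball 0 r)"
  unfolding admissible_def
proof (intro conjI allI impI)
  fix \<xi> \<xi>' :: complex and s :: real
  assume \<xi>: "cmod \<xi> \<le> 1" "cmod \<xi>' \<le> 1" and s: "0 < s" "s < 1"
  define a where "a z = (1 - s) *\<^sub>R ((1 + \<xi> * of_real (s / 4)) *s z)" for z :: "complex ^ 'n"
  define b where "b = (\<xi>' * of_real (sqrt s / 8)) *s c"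
  have d: "displaced s \<xi> \<xi>' c z = a z + b" for z
    by (simp add: displaced_def a_def b_def)
  show "\<exists>B d. linear B \<and> (\<forall>z. displaced s \<xi> \<xi>' c z = B z + d) \<and> (\<forall>z. norm z \<le> 2 / (1 - s) * norm (B z))"
  proof (intro exI[of _ a] exI[of _ b] conjI allI)
    show "linear a"
      by (rule linearI) (simp_all add: a_def vec_eq_iff scaleR_conv_of_real[where 'a = complex] algebra_simps)
    show "norm z \<le> 2 / (1 - s) * norm (a z)" for z
      using radial_part_bounds(1)[OF \<xi>(1) s, of z] by (simp add: a_def)
  qed (simp add: d)
  show "\<forall>z\<in>ball 0 r. (norm (displaced s \<xi> \<xi>' c z))\<^sup>2 \<le> 1 - s / 2"
  proof
    fix z :: "complex ^ 'n" assume z: "z \<in> ball 0 r"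
    have a: "norm (a z) \<le> (1 - 3 / 4 * s) * norm z"
      using radial_part_bounds(2)[OF \<xi>(1) s, of z] by (simp add: a_def)
    from r show "(norm (displaced s \<xi> \<xi>' c z))\<^sup>2 \<le> 1 - s / 2"
    proof
      assume cr: "c = 0 \<and> r = 1"
      have "norm (a z) \<le> (1 - 3 / 4 * s) * 1"
        using z cr s by (intro order_trans[OF a] mult_left_mono) auto
      then have "(norm (a z))\<^sup>2 \<le> (1 - 3 / 4 * s)\<^sup>2" by (intro power_mono) auto
      also have "\<dots> \<le> 1 - 3 / 4 * s" using s by (simp add: power2_eq_square mult_left_le_one_le)
      finally have "(norm (a z))\<^sup>2 \<le> 1 - 3 / 4 * s" .
      moreover have "b = 0" using cr by (simp add: b_def vec_eq_iff)
      ultimately show ?thesis unfolding d using s by simp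
    next
      assume r: "r = 1 / 2"
      have "norm b \<le> 1 * (1 / 8) * 1"
        unfolding b_def norm_smult_vec norm_mult using \<xi> s c by (intro mult_mono) auto
      moreover have "norm (a z) \<le> 1 * (1 / 2)"
        using z r s by (intro order_trans[OF a] mult_mono) auto
      ultimately have "norm (a z + b) \<le> 5 / 8" using norm_triangle_ineq[of "a z" b] by linarith
      then have "(norm (a z + b))\<^sup>2 \<le> (5 / 8)\<^sup>2" by (intro power_mono) auto
      then show ?thesis unfolding d using s by (simp add: power2_eq_square)
    qed
  qed
qed auto

lemma dir_deriv_joint_continuous:
  assumes "continuous_on UNIV X"
  shows "continuous_on UNIV (\<lambda>x. poly_eval p (fst x) * poly_eval (dir_deriv (X (fst x)) f) ((1 - snd x) *\<^sub>R fst x))"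
proof -
  have "continuous_on UNIV (\<lambda>x. X (fst x))"
    by (rule continuous_on_compose2[OF assms continuous_on_fst]) (auto intro: continuous_on_id)
  then show ?thesis
    unfolding poly_eval_dir_deriv
    by (intro continuous_intros continuous_on_compose2[OF continuous_on_poly_eval[of UNIV]]) auto
qed

lemma norm_sum_sq_le:
  fixes a :: "'a \<Rightarrow> real"
  assumes "finite A" "x \<ge> 0" "y \<ge> 0" "\<And>i. i \<in> A \<Longrightarrow> a i \<ge> 0"
  shows "(x + (\<Sum>i\<in>A. a i) + y)\<^sup>2 \<le> (real (card A) + 2) * (x\<^sup>2 + (\<Sum>i\<in>A. (a i)\<^sup>2) + y\<^sup>2)"
proof -
  let ?n = "real (card A)"
  have "(\<Sum>i\<in>A. a i)\<^sup>2 \<le> ?n * (\<Sum>i\<in>A. (a i)\<^sup>2)"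
    using Cauchy_Schwarz_ineq_sum[of "\<lambda>i. 1" a A] by simp
  moreover have "(x + S + y)\<^sup>2 \<le> (n + 2) * (x\<^sup>2 + Q + y\<^sup>2)" if "S\<^sup>2 \<le> n * Q" "n \<ge> 0" "Q \<ge> 0" for S Q n :: real
  proof (cases "n = 0")
    case True
    then have "S = 0" using that by simp
    then show ?thesis using True that sum_squares_bound[of x y] by (simp add: power2_sum)
  next
    case False
    then have n: "n > 0" using that by simp
    have "S\<^sup>2 / n \<le> Q" using that n by (simp add: field_simps)
    moreover have "(x + S + y)\<^sup>2 \<le> (n + 2) * (x\<^sup>2 + S\<^sup>2 / n + y\<^sup>2)"
    proof -
      have "(n + 2) * (x\<^sup>2 + S\<^sup>2 / n + y\<^sup>2) - (x + S + y)\<^sup>2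
         = (x - y)\<^sup>2 + (n * x - S)\<^sup>2 / n + (n * y - S)\<^sup>2 / n"
        using n by (simp add: field_simps power2_eq_square)
      moreover have "\<dots> \<ge> 0" using n by simp
      ultimately show ?thesis by linarith
    qed
    moreover have "(n + 2) * (x\<^sup>2 + S\<^sup>2 / n + y\<^sup>2) \<le> (n + 2) * (x\<^sup>2 + Q + y\<^sup>2)"
      using calculation(1) n by (intro mult_left_mono) auto
    ultimately show ?thesis by linarith
  qed
  ultimately show ?thesis by (simp add: sum_nonneg)
qed

section \<open>Pointwise decomposition of the defect\<close>

definition path_mass :: "nat \<Rightarrow> (real \<Rightarrow> real) \<Rightarrow> ennreal"
  where "path_mass \<kappa> h = (\<integral>\<^sup>+s. ennreal ((1 - s) ^ \<kappa> * h s) * indicator {0<..<1} s \<partial>lborel)"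

text \<open>Multiplying the radial integral that represents \<open>smoothed_deriv\<close> by the fixed number \<open>p(z)\<close>
  keeps \<open>p\<close> at \<open>z\<close> and \<open>f\<close> at \<open>(1 - s) z\<close>, the situation covered by the circle means.\<close>

lemma norm_deriv_le_path_mass:
  "ennreal (cmod (poly_eval p z * (\<Sum>k\<in>UNIV. x $ k * poly_eval (smoothed_deriv (\<kappa> + 1) k f) z)))
    \<le> path_mass \<kappa> (\<lambda>s. cmod (poly_eval p z * poly_eval (dir_deriv x f) ((1 - s) *\<^sub>R z)))"
proof -
  let ?h = "\<lambda>u. poly_eval p z * (of_real (1 - u) ^ (\<kappa> + 1) * poly_eval (dir_deriv x f) ((1 - u) *\<^sub>R z))"
  have "ennreal (cmod (poly_eval p z * (\<Sum>k\<in>UNIV. x $ k * poly_eval (smoothed_deriv (\<kappa> + 1) k f) z)))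
      \<le> (\<integral>\<^sup>+u. ennreal (norm (?h u)) * indicator {0<..<1} u \<partial>lborel)"
  proof (rule norm_le_nn_integral_of_has_integral)
    show "continuous_on {0..1} ?h"
      by (intro continuous_intros continuous_on_compose2[OF continuous_on_poly_eval[of UNIV]]) auto
    show "(?h has_integral poly_eval p z * (\<Sum>k\<in>UNIV. x $ k * poly_eval (smoothed_deriv (\<kappa> + 1) k f) z)) {0..1}"
      by (intro has_integral_mult_right smoothed_deriv_has_integral) simp
  qed
  also have "\<dots> \<le> path_mass \<kappa> (\<lambda>s. cmod (poly_eval p z * poly_eval (dir_deriv x f) ((1 - s) *\<^sub>R z)))"
    unfolding path_mass_def
  proof (rule nn_integral_mono)
    fix u :: real
    show "ennreal (norm (?h u)) * indicator {0<..<1} u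
      \<le> ennreal ((1 - u) ^ \<kappa> * cmod (poly_eval p z * poly_eval (dir_deriv x f) ((1 - u) *\<^sub>R z))) * indicator {0<..<1} u"
    proof (cases "u \<in> {0<..<1}")
      case True
      then have n: "cmod (of_real (1 - u)) = 1 - u" by (simp only: norm_of_real) simp
      have "(1 - u) ^ (\<kappa> + 1) \<le> (1 - u) ^ \<kappa>" using True by (intro power_decreasing) auto
      then have "(1 - u) ^ (\<kappa> + 1) * cmod (poly_eval p z * poly_eval (dir_deriv x f) ((1 - u) *\<^sub>R z))
         \<le> (1 - u) ^ \<kappa> * cmod (poly_eval p z * poly_eval (dir_deriv x f) ((1 - u) *\<^sub>R z))"
        by (rule mult_right_mono) simp
      moreover have "norm (?h u) = (1 - u) ^ (\<kappa> + 1) * cmod (poly_eval p z * poly_eval (dir_deriv x f) ((1 - u) *\<^sub>R z))"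
        unfolding norm_mult norm_power n by (simp only: mult_ac)
      ultimately show ?thesis using True by (simp add: ennreal_leI)
    qed simp
  qed
  finally show ?thesis .
qed

lemma norm_value_le_path_mass:
  "ennreal (cmod (poly_eval p z * poly_eval (smoothed (\<kappa> + 1) f) z))
    \<le> path_mass \<kappa> (\<lambda>s. cmod (poly_eval p z * poly_eval f ((1 - s) *\<^sub>R z)))"
proof -
  let ?h = "\<lambda>u. poly_eval p z * (of_real (1 - u) ^ (\<kappa> + 1 - 1) * poly_eval f ((1 - u) *\<^sub>R z))"
  have "ennreal (cmod (poly_eval p z * poly_eval (smoothed (\<kappa> + 1) f) z))
      \<le> (\<integral>\<^sup>+u. ennreal (norm (?h u)) * indicator {0<..<1} u \<partial>lborel)"
  proof (rule norm_le_nn_integral_of_has_integral)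
    show "continuous_on {0..1} ?h"
      by (intro continuous_intros continuous_on_compose2[OF continuous_on_poly_eval[of UNIV]]) auto
    show "(?h has_integral poly_eval p z * poly_eval (smoothed (\<kappa> + 1) f) z) {0..1}"
      by (intro has_integral_mult_right smoothed_has_integral) simp
  qed
  also have "\<dots> = path_mass \<kappa> (\<lambda>s. cmod (poly_eval p z * poly_eval f ((1 - s) *\<^sub>R z)))"
    unfolding path_mass_def
  proof (rule nn_integral_cong)
    fix u :: real
    show "ennreal (norm (?h u)) * indicator {0<..<1} u
      = ennreal ((1 - u) ^ \<kappa> * cmod (poly_eval p z * poly_eval f ((1 - u) *\<^sub>R z))) * indicator {0<..<1} u"
    proof (cases "u \<in> {0<..<1}")
      case True
      then have n: "cmod (of_real (1 - u)) = 1 - u" by (simp only: norm_of_real) simp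
      have "norm (?h u) = (1 - u) ^ \<kappa> * cmod (poly_eval p z * poly_eval f ((1 - u) *\<^sub>R z))"
        unfolding norm_mult norm_power n by (simp add: mult_ac)
      then show ?thesis by simp
    qed simp
  qed
  finally show ?thesis .
qed

lemma path_mass_measurable:
  assumes "continuous_on UNIV (\<lambda>x. h (fst x) (snd x))"
  shows "(\<lambda>z. path_mass \<kappa> (h z)) \<in> borel_measurable (borel :: (complex ^ 'n) measure)"
proof -
  have [measurable]: "(\<lambda>x. h (fst x) (snd x)) \<in> borel_measurable (borel \<Otimes>\<^sub>M borel)"
    unfolding borel_prod using assms by (rule borel_measurable_continuous_onI)
  define g where "g s = (indicator {0<..<1} s :: ennreal)" for s :: real
  have [measurable]: "g \<in> borel_measurable borel"
    unfolding g_def by simp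
  have "(\<lambda>z. \<integral>\<^sup>+s. ennreal ((1 - s) ^ \<kappa> * h z s) * g s \<partial>lborel) \<in> borel_measurable borel"
    by measurable
  then show ?thesis unfolding path_mass_def g_def .
qed

text \<open>Multiplied by \<open>|z|\<^sup>2 = \<Sum> z\<^sub>i cnj z\<^sub>i\<close>, the number \<open>g j\<close> differs from \<open>cnj z\<^sub>j \<Sum> z\<^sub>i g i\<close>
  by tangential combinations of the \<open>g i\<close>, and the assumption turns the latter sum into \<open>f\<close>.\<close>

lemma euler_defect_identity:
  fixes g :: "'n::finite \<Rightarrow> complex" and z :: "complex ^ 'n"
  assumes "f = (\<Sum>i\<in>UNIV. z $ i * g i) + c * F"
  shows "of_real ((norm z)\<^sup>2) * (cnj (z $ j) * f - g j)
    = - (of_real (1 - (norm z)\<^sup>2) * (cnj (z $ j) * f))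
      - (\<Sum>i\<in>UNIV. z $ i * (\<Sum>k\<in>UNIV. tangent i j z $ k * g k)) + cnj (z $ j) * (c * F)"
proof -
  have n: "of_real ((norm z)\<^sup>2) = (\<Sum>i\<in>UNIV. z $ i * cnj (z $ i))"
  proof -
    have "(norm z)\<^sup>2 = (\<Sum>i\<in>UNIV. (cmod (z $ i))\<^sup>2)"
      by (simp add: norm_vec_def L2_set_def sum_nonneg)
    then show ?thesis by (simp only: of_real_sum complex_norm_square)
  qed
  have t: "(\<Sum>k\<in>UNIV. tangent i j z $ k * g k) = cnj (z $ i) * g j - cnj (z $ j) * g i" for i
    by (simp add: tangent_def left_diff_distrib sum_subtractf if_distrib[of "\<lambda>x. x * _"] cong: if_cong)
  have T: "(\<Sum>i\<in>UNIV. z $ i * (\<Sum>k\<in>UNIV. tangent i j z $ k * g k))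
      = of_real ((norm z)\<^sup>2) * g j - cnj (z $ j) * (\<Sum>i\<in>UNIV. z $ i * g i)"
    unfolding t n by (simp add: right_diff_distrib sum_subtractf sum_distrib_left sum_distrib_right mult_ac)
  show ?thesis unfolding T assms by (simp add: algebra_simps)
qed

text \<open>The factor \<open>|z|\<^sup>2 \<ge> 1/4\<close> can be divided out of the identity.\<close>

lemma pointwise_defect_outer:
  fixes p f :: "'n::finite cpoly"
  assumes z: "1 / 2 \<le> norm z" "norm z < 1"
  shows "(cmod (poly_eval p z * (cnj (z $ j) * poly_eval f z - poly_eval (smoothed_deriv (\<kappa> + 1) j f) z)))\<^sup>2
    \<le> 16 * (real CARD('n) + 2) * (((1 - (norm z)\<^sup>2) * cmod (poly_eval p z * poly_eval f z))\<^sup>2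
       + (\<Sum>i\<in>UNIV. (cmod (poly_eval p z * (\<Sum>k\<in>UNIV. tangent i j z $ k * poly_eval (smoothed_deriv (\<kappa> + 1) k f) z)))\<^sup>2)
       + (real (\<kappa> + 1) * cmod (poly_eval p z * poly_eval (smoothed (\<kappa> + 1) f) z))\<^sup>2)"
proof -
  let ?p = "poly_eval p z" and ?f = "poly_eval f z" and ?g = "\<lambda>k. poly_eval (smoothed_deriv (\<kappa> + 1) k f) z"
  let ?F = "poly_eval (smoothed (\<kappa> + 1) f) z"
  let ?V = "\<lambda>i. \<Sum>k\<in>UNIV. tangent i j z $ k * ?g k"
  let ?r = "1 - (norm z)\<^sup>2"
  let ?E = "?p * (cnj (z $ j) * ?f - ?g j)"
  have r: "?r \<ge> 0" using z by (simp add: power_le_one)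
  have zi: "cmod (z $ i) \<le> 1" for i
    using Finite_Cartesian_Product.norm_nth_le[of z i] z by linarith
  have "1 / 4 \<le> (norm z)\<^sup>2" using power_mono[OF z(1), of 2] by (simp add: power2_eq_square)
  then have "1 / 4 * cmod ?E \<le> (norm z)\<^sup>2 * cmod ?E" by (intro mult_right_mono) auto
  also have "\<dots> = cmod (?p * (of_real ((norm z)\<^sup>2) * (cnj (z $ j) * ?f - ?g j)))"
    by (simp add: norm_mult norm_power mult_ac)
  also have "of_real ((norm z)\<^sup>2) * (cnj (z $ j) * ?f - ?g j)
      = - (of_real ?r * (cnj (z $ j) * ?f)) - (\<Sum>i\<in>UNIV. z $ i * ?V i) + cnj (z $ j) * (of_nat (\<kappa> + 1) * ?F)"
    by (rule euler_defect_identity) (rule euler_smoothed, simp)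
  also have "?p * (- (of_real ?r * (cnj (z $ j) * ?f)) - (\<Sum>i\<in>UNIV. z $ i * ?V i) + cnj (z $ j) * (of_nat (\<kappa> + 1) * ?F))
      = - (cnj (z $ j) * (of_real ?r * (?p * ?f))) - (\<Sum>i\<in>UNIV. z $ i * (?p * ?V i)) + cnj (z $ j) * (of_nat (\<kappa> + 1) * (?p * ?F))"
    by (simp only: ring_distribs sum_distrib_left mult_ac diff_conv_add_uminus mult_minus_right)
  also have "cmod \<dots> \<le> cmod (cnj (z $ j) * (of_real ?r * (?p * ?f))) + cmod (\<Sum>i\<in>UNIV. z $ i * (?p * ?V i)) + cmod (cnj (z $ j) * (of_nat (\<kappa> + 1) * (?p * ?F)))"
    by (rule order_trans[OF norm_triangle_ineq add_right_mono[OF order_trans[OF norm_triangle_ineq4]]]) simp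
  also have "\<dots> \<le> ?r * cmod (?p * ?f) + (\<Sum>i\<in>UNIV. cmod (?p * ?V i)) + real (\<kappa> + 1) * cmod (?p * ?F)"
  proof (intro add_mono)
    have "cmod (cnj (z $ j) * (of_real ?r * (?p * ?f))) = cmod (z $ j) * (?r * cmod (?p * ?f))"
      unfolding norm_mult complex_mod_cnj norm_of_real abs_of_nonneg[OF r] ..
    also have "\<dots> \<le> 1 * (?r * cmod (?p * ?f))" using zi r by (intro mult_right_mono) auto
    finally show "cmod (cnj (z $ j) * (of_real ?r * (?p * ?f))) \<le> ?r * cmod (?p * ?f)" by simp
    have "cmod (cnj (z $ j) * (of_nat (\<kappa> + 1) * (?p * ?F))) = cmod (z $ j) * (real (\<kappa> + 1) * cmod (?p * ?F))"
      unfolding norm_mult complex_mod_cnj norm_of_nat ..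
    also have "\<dots> \<le> 1 * (real (\<kappa> + 1) * cmod (?p * ?F))" using zi by (intro mult_right_mono) auto
    finally show "cmod (cnj (z $ j) * (of_nat (\<kappa> + 1) * (?p * ?F))) \<le> real (\<kappa> + 1) * cmod (?p * ?F)" by simp
    show "cmod (\<Sum>i\<in>UNIV. z $ i * (?p * ?V i)) \<le> (\<Sum>i\<in>UNIV. cmod (?p * ?V i))"
    proof (rule order_trans[OF norm_sum sum_mono])
      fix i
      show "cmod (z $ i * (?p * ?V i)) \<le> cmod (?p * ?V i)"
        unfolding norm_mult[of "z $ i"] using mult_right_mono[OF zi[of i], of "cmod (?p * ?V i)"] by simp
    qed
  qed
  finally have "cmod ?E \<le> 4 * (?r * cmod (?p * ?f) + (\<Sum>i\<in>UNIV. cmod (?p * ?V i)) + real (\<kappa> + 1) * cmod (?p * ?F))"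
    by simp
  then have "(cmod ?E)\<^sup>2 \<le> (4 * (?r * cmod (?p * ?f) + (\<Sum>i\<in>UNIV. cmod (?p * ?V i)) + real (\<kappa> + 1) * cmod (?p * ?F)))\<^sup>2"
    by (intro power_mono) auto
  also have "\<dots> = 16 * (?r * cmod (?p * ?f) + (\<Sum>i\<in>UNIV. cmod (?p * ?V i)) + real (\<kappa> + 1) * cmod (?p * ?F))\<^sup>2"
    by (simp only: power_mult_distrib) simp
  also have "\<dots> \<le> 16 * ((real (card (UNIV :: 'n set)) + 2) * ((?r * cmod (?p * ?f))\<^sup>2 + (\<Sum>i\<in>UNIV. (cmod (?p * ?V i))\<^sup>2) + (real (\<kappa> + 1) * cmod (?p * ?F))\<^sup>2))"
    using r by (intro mult_left_mono norm_sum_sq_le) auto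
  finally show ?thesis by (simp only: mult.assoc)
qed

text \<open>Near the origin nothing has to be gained: \<open>1 - |z|\<^sup>2\<close> is bounded below, so both terms of the
  defect can be estimated separately.\<close>

lemma pointwise_defect_inner:
  fixes p f :: "'n::finite cpoly"
  assumes z: "norm z < 1 / 2"
  shows "(cmod (poly_eval p z * (cnj (z $ j) * poly_eval f z - poly_eval (smoothed_deriv (\<kappa> + 1) j f) z)))\<^sup>2
    \<le> 4 * (((1 - (norm z)\<^sup>2) * cmod (poly_eval p z * poly_eval f z))\<^sup>2
       + (cmod (poly_eval p z * (\<Sum>k\<in>UNIV. axis j 1 $ k * poly_eval (smoothed_deriv (\<kappa> + 1) k f) z)))\<^sup>2)"
proof -
  let ?p = "poly_eval p z" and ?f = "poly_eval f z" and ?g = "poly_eval (smoothed_deriv (\<kappa> + 1) j f) z"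
  let ?r = "1 - (norm z)\<^sup>2"
  have gs: "(\<Sum>k\<in>UNIV. axis j 1 $ k * poly_eval (smoothed_deriv (\<kappa> + 1) k f) z) = ?g"
    by (simp add: axis_def if_distrib[of "\<lambda>x. x * _"] cong: if_cong)
  have "(norm z)\<^sup>2 \<le> (1 / 2)\<^sup>2" using z by (intro power_mono) auto
  then have r: "?r \<ge> 3 / 4" by (simp add: power2_eq_square)
  have zj: "cmod (z $ j) \<le> 1 / 2"
    using Finite_Cartesian_Product.norm_nth_le[of z j] z by linarith
  have "cmod (?p * (cnj (z $ j) * ?f - ?g)) = cmod (cnj (z $ j) * (?p * ?f) - ?p * ?g)"
    by (simp add: algebra_simps)
  also have "\<dots> \<le> cmod (z $ j) * cmod (?p * ?f) + cmod (?p * ?g)"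
    using norm_triangle_ineq4[of "cnj (z $ j) * (?p * ?f)" "?p * ?g"] by (simp add: norm_mult)
  also have "\<dots> \<le> ?r * cmod (?p * ?f) + cmod (?p * ?g)"
    using zj r by (intro add_right_mono mult_right_mono) auto
  finally have "(cmod (?p * (cnj (z $ j) * ?f - ?g)))\<^sup>2 \<le> (?r * cmod (?p * ?f) + cmod (?p * ?g))\<^sup>2"
    by (intro power_mono) auto
  also have "\<dots> \<le> 4 * ((?r * cmod (?p * ?f))\<^sup>2 + (cmod (?p * ?g))\<^sup>2)"
  proof -
    have "(a + b)\<^sup>2 \<le> 4 * (a\<^sup>2 + b\<^sup>2)" for a b :: real
    proof -
      have "4 * (a\<^sup>2 + b\<^sup>2) - (a + b)\<^sup>2 = (a - b)\<^sup>2 + 2 * (a\<^sup>2 + b\<^sup>2)"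
        by (simp add: power2_eq_square algebra_simps)
      moreover have "0 \<le> (a - b)\<^sup>2 + 2 * (a\<^sup>2 + b\<^sup>2)"
        by simp
      ultimately show ?thesis by linarith
    qed
    then show ?thesis .
  qed
  finally show ?thesis unfolding gs .
qed

section \<open>The weighted estimate of the defect\<close>

lemma nn_integral_combine:
  assumes [measurable]: "W \<in> borel_measurable M" "\<And>i. U i \<in> borel_measurable M" "V \<in> borel_measurable M" "V' \<in> borel_measurable M"
  shows "(\<integral>\<^sup>+z. c * (W z + (\<Sum>i\<in>I. U i z) + V z + V' z) \<partial>M)
    = c * ((\<integral>\<^sup>+z. W z \<partial>M) + (\<Sum>i\<in>I. \<integral>\<^sup>+z. U i z \<partial>M) + (\<integral>\<^sup>+z. V z \<partial>M) + (\<integral>\<^sup>+z. V' z \<partial>M))"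
  by (simp add: nn_integral_cmult nn_integral_add nn_integral_sum)

text \<open>The number \<open>K\<close> of sample points depends on the degree of \<open>f\<close>, but it enters only through
  normalized means, so \<open>C\<close> depends on neither \<open>f\<close> nor \<open>p\<close>. The term \<open>(1 - |z|\<^sup>2)\<^sup>2 |p f|\<^sup>2\<close>
  is absorbed because \<open>\<theta> \<le> 2\<close>.\<close>

theorem weighted_defect_estimate:
  fixes m \<kappa> :: nat
  assumes \<theta>: "0 < \<theta>" "\<theta> < 1" and \<kappa>: "2 * m + DIM(complex ^ 'n::finite) \<le> 2 * \<kappa>"
  obtains C where "C \<ge> 0"
    "\<And>p f :: 'n cpoly. \<And>j. total_degree p \<le> m \<Longrightarrow>
      (\<integral>\<^sup>+z. ennreal ((cmod (poly_eval p z * (cnj (z $ j) * poly_eval f z - poly_eval (smoothed_deriv (\<kappa> + 1) j f) z)))\<^sup>2)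
         * indicator (ball 0 1) z \<partial>lborel)
      \<le> ennreal C * weighted_mass \<theta> (\<lambda>z. poly_eval p z * poly_eval f z)"
proof -
  let ?N = "DIM(complex ^ 'n)"
  let ?n = "real CARD('n)"
  define D where "D = mean_const m * (real m + 1)\<^sup>2 * 2 ^ ?N * 2 powr \<theta> / (\<theta> * (1 - \<theta>))"
  define c where "c = 16 * (?n + 2) * (1 + (real (\<kappa> + 1))\<^sup>2)"
  have D0: "D \<ge> 0" using \<theta> by (simp add: D_def mean_const_def)
  have c0: "c \<ge> 0" by (simp add: c_def)
  have c1: "16 * (?n + 2) \<le> c" "16 * (?n + 2) * (real (\<kappa> + 1))\<^sup>2 \<le> c" "4 \<le> c"
  proof -
    show "16 * (?n + 2) \<le> c" unfolding c_def by (simp add: algebra_simps)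
    then show "4 \<le> c" by (rule order_trans[rotated]) simp
    show "16 * (?n + 2) * (real (\<kappa> + 1))\<^sup>2 \<le> c"
      unfolding c_def by (intro mult_left_mono) auto
  qed
  show thesis
  proof (rule that)
    show "0 \<le> c * (1 + (?n + 2) * D)" using c0 D0 by simp
    fix p f :: "'n cpoly" and j :: 'n
    assume p: "total_degree p \<le> m"
    define K where "K = 2 + total_degree f + (\<Sum>k\<in>UNIV. total_degree (partial_deriv k f))"
    have K: "1 < K" "total_degree f < K" by (auto simp: K_def)
    have Kd: "total_degree (partial_deriv k f) < K" for k
      using member_le_sum[of k UNIV "\<lambda>k. total_degree (partial_deriv k f)"] by (simp add: K_def)
    let ?M = "weighted_mass \<theta> (\<lambda>z. poly_eval p z * poly_eval f z)"
    let ?E = "\<lambda>z. (cmod (poly_eval p z * (cnj (z $ j) * poly_eval f z - poly_eval (smoothed_deriv (\<kappa> + 1) j f) z)))\<^sup>2"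
    define A where "A X z = path_mass \<kappa> (\<lambda>s. cmod (poly_eval p z * poly_eval (dir_deriv (X z) f) ((1 - s) *\<^sub>R z)))" for X and z :: "complex ^ 'n"
    define A0 where "A0 z = path_mass \<kappa> (\<lambda>s. cmod (poly_eval p z * poly_eval f ((1 - s) *\<^sub>R z)))" for z :: "complex ^ 'n"
    have A: "(\<integral>\<^sup>+z. indicator S z * (A X z)\<^sup>2 \<partial>lborel) \<le> ennreal D * ?M" if "admissible X S" for X S
      unfolding A_def path_mass_def D_def
      by (rule admissible_estimate[OF that \<theta> _ \<kappa>, where K = K]) ((rule deriv_le_circle_mean[OF p K(2) Kd K(1)] norm_ge_zero order.strict_trans[OF zero_less_one K(1)] | assumption)+)
    have A0: "(\<integral>\<^sup>+z. indicator (ball 0 1) z * (A0 z)\<^sup>2 \<partial>lborel) \<le> ennreal D * ?M"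
      unfolding A0_def path_mass_def D_def
      by (rule admissible_estimate[OF admissible_const[of 0 1] \<theta> _ \<kappa>, where K = K]) ((rule value_le_circle_mean[OF p K(2) K(1)] norm_ge_zero order.strict_trans[OF zero_less_one K(1)] | assumption | simp)+)
    have Am: "A X \<in> borel_measurable borel" if "continuous_on UNIV X" for X
      unfolding A_def by (intro path_mass_measurable continuous_on_norm dir_deriv_joint_continuous that)
    have A0m [measurable]: "A0 \<in> borel_measurable borel"
      unfolding A0_def
      by (intro path_mass_measurable continuous_intros continuous_on_compose2[OF continuous_on_poly_eval[of UNIV]]) auto
    have Atm [measurable]: "A (tangent i j) \<in> borel_measurable borel" for i
      using admissible_tangent[of i j] by (intro Am) (simp add: admissible_def)
    have Acm [measurable]: "A (\<lambda>z. axis j 1) \<in> borel_measurable borel"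
      by (intro Am) simp
    have [measurable]: "Measurable.pred borel (\<lambda>x :: complex ^ 'n. x \<in> ball 0 r)" for r
      unfolding mem_ball by measurable
    define W where "W z = ennreal ((1 - (norm z)\<^sup>2) powr \<theta> * (cmod (poly_eval p z * poly_eval f z))\<^sup>2) * indicator (ball 0 1) z" for z :: "complex ^ 'n"
    have Wm [measurable]: "W \<in> borel_measurable borel"
      unfolding W_def by measurable
    define B where "B = (ball 0 1 :: (complex ^ 'n) set)"
    have [measurable]: "(indicator B :: _ \<Rightarrow> ennreal) \<in> borel_measurable borel"
      "(indicator (ball 0 (1 / 2) :: (complex ^ 'n) set) :: _ \<Rightarrow> ennreal) \<in> borel_measurable borel"
      by (auto simp: B_def)
    have point: "ennreal (?E z) * indicator B z
      \<le> ennreal c * (W z + (\<Sum>i\<in>UNIV. indicator B z * (A (tangent i j) z)\<^sup>2) + indicator B z * (A0 z)\<^sup>2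
           + indicator (ball 0 (1 / 2)) z * (A (\<lambda>z. axis j 1) z)\<^sup>2)" for z
    proof (cases "z \<in> B")
      case True
      then have z: "norm z < 1" by (simp add: B_def)
      let ?r = "1 - (norm z)\<^sup>2"
      have r: "0 \<le> ?r" "?r \<le> 1" using z by (auto simp: power_le_one)
      have "?r\<^sup>2 \<le> ?r powr \<theta>"
      proof (cases "?r = 0")
        case False
        then have "0 < ?r" using r by simp
        moreover have "?r powr 2 \<le> ?r powr \<theta>" using r \<theta> by (intro powr_mono') auto
        ultimately show ?thesis by simp
      qed simp
      then have w: "ennreal ((?r * cmod (poly_eval p z * poly_eval f z))\<^sup>2) \<le> W z"
        using True by (simp add: W_def B_def power_mult_distrib ennreal_leI mult_right_mono)
      have V: "ennreal ((cmod (poly_eval p z * (\<Sum>k\<in>UNIV. X z $ k * poly_eval (smoothed_deriv (\<kappa> + 1) k f) z)))\<^sup>2) \<le> (A X z)\<^sup>2" for X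
        unfolding A_def ennreal_power[OF norm_ge_zero, symmetric] by (intro power_mono norm_deriv_le_path_mass) simp
      have F: "ennreal ((cmod (poly_eval p z * poly_eval (smoothed (\<kappa> + 1) f) z))\<^sup>2) \<le> (A0 z)\<^sup>2"
        unfolding A0_def ennreal_power[OF norm_ge_zero, symmetric] by (intro power_mono norm_value_le_path_mass) simp
      show ?thesis
      proof (cases "norm z < 1 / 2")
        case False
        then have z2: "1 / 2 \<le> norm z" by simp
        let ?a = "(?r * cmod (poly_eval p z * poly_eval f z))\<^sup>2"
        let ?b = "\<lambda>i. (cmod (poly_eval p z * (\<Sum>k\<in>UNIV. tangent i j z $ k * poly_eval (smoothed_deriv (\<kappa> + 1) k f) z)))\<^sup>2"
        let ?d = "(cmod (poly_eval p z * poly_eval (smoothed (\<kappa> + 1) f) z))\<^sup>2"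
        have "?E z \<le> 16 * (?n + 2) * (?a + (\<Sum>i\<in>UNIV. ?b i) + (real (\<kappa> + 1) * cmod (poly_eval p z * poly_eval (smoothed (\<kappa> + 1) f) z))\<^sup>2)"
          by (rule pointwise_defect_outer[OF z2 z])
        also have "\<dots> = 16 * (?n + 2) * ?a + 16 * (?n + 2) * (\<Sum>i\<in>UNIV. ?b i) + 16 * (?n + 2) * (real (\<kappa> + 1))\<^sup>2 * ?d"
          by (simp only: power_mult_distrib distrib_left mult.assoc)
        also have "\<dots> \<le> c * ?a + c * (\<Sum>i\<in>UNIV. ?b i) + c * ?d"
          using c1 by (intro add_mono mult_right_mono sum_nonneg) auto
        also have "\<dots> = c * (?a + (\<Sum>i\<in>UNIV. ?b i) + ?d)" by (simp add: distrib_left)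
        finally have "ennreal (?E z) \<le> ennreal (c * (?a + (\<Sum>i\<in>UNIV. ?b i) + ?d))" by (rule ennreal_leI)
        also have "\<dots> = ennreal c * (ennreal ?a + (\<Sum>i\<in>UNIV. ennreal (?b i)) + ennreal ?d)"
          using c0 by (simp add: ennreal_mult sum_nonneg sum_ennreal)
        also have "\<dots> \<le> ennreal c * (W z + (\<Sum>i\<in>UNIV. (A (tangent i j) z)\<^sup>2) + (A0 z)\<^sup>2)"
          by (intro mult_left_mono add_mono sum_mono w V F) simp
        finally show ?thesis using True by (simp add: order_trans[OF _ mult_left_mono[OF add_increasing2]])
      next
        case z2: True
        let ?a = "(?r * cmod (poly_eval p z * poly_eval f z))\<^sup>2"
        let ?b = "(cmod (poly_eval p z * (\<Sum>k\<in>UNIV. axis j 1 $ k * poly_eval (smoothed_deriv (\<kappa> + 1) k f) z)))\<^sup>2"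
        have "?E z \<le> 4 * (?a + ?b)"
          by (rule pointwise_defect_inner[OF z2])
        also have "\<dots> \<le> c * (?a + ?b)" using c1 by (intro mult_right_mono) auto
        finally have "ennreal (?E z) \<le> ennreal (c * (?a + ?b))" by (rule ennreal_leI)
        also have "\<dots> = ennreal c * (ennreal ?a + ennreal ?b)"
          using c0 by (simp add: ennreal_mult)
        also have "\<dots> \<le> ennreal c * (W z + (A (\<lambda>z. axis j 1) z)\<^sup>2)"
          by (intro mult_left_mono add_mono w V[of "\<lambda>z. axis j 1"]) simp
        also have "\<dots> \<le> ennreal c * (W z + (\<Sum>i\<in>UNIV. indicator B z * (A (tangent i j) z)\<^sup>2) + indicator B z * (A0 z)\<^sup>2
           + indicator (ball 0 (1 / 2)) z * (A (\<lambda>z. axis j 1) z)\<^sup>2)"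
          using z2 by (intro mult_left_mono add_mono) (auto simp: add.assoc intro: add_increasing2)
        finally show ?thesis using True by simp
      qed
    qed simp
    have "(\<integral>\<^sup>+z. ennreal (?E z) * indicator B z \<partial>lborel)
      \<le> (\<integral>\<^sup>+z. ennreal c * (W z + (\<Sum>i\<in>UNIV. indicator B z * (A (tangent i j) z)\<^sup>2) + indicator B z * (A0 z)\<^sup>2
           + indicator (ball 0 (1 / 2)) z * (A (\<lambda>z. axis j 1) z)\<^sup>2) \<partial>lborel)"
      by (intro nn_integral_mono point)
    also have "\<dots> = ennreal c * ((\<integral>\<^sup>+z. W z \<partial>lborel) + (\<Sum>i\<in>UNIV. \<integral>\<^sup>+z. indicator B z * (A (tangent i j) z)\<^sup>2 \<partial>lborel)
        + (\<integral>\<^sup>+z. indicator B z * (A0 z)\<^sup>2 \<partial>lborel) + (\<integral>\<^sup>+z. indicator (ball 0 (1 / 2)) z * (A (\<lambda>z. axis j 1) z)\<^sup>2 \<partial>lborel))"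
      by (rule nn_integral_combine) measurable
    also have "\<dots> \<le> ennreal c * (?M + (\<Sum>i\<in>(UNIV :: 'n set). ennreal D * ?M) + ennreal D * ?M + ennreal D * ?M)"
    proof (intro mult_left_mono add_mono sum_mono)
      show "(\<integral>\<^sup>+z. W z \<partial>lborel) \<le> ?M" unfolding W_def weighted_mass_def by simp
      show "(\<integral>\<^sup>+z. indicator B z * (A (tangent i j) z)\<^sup>2 \<partial>lborel) \<le> ennreal D * ?M" for i
        unfolding B_def by (rule A[OF admissible_tangent])
      show "(\<integral>\<^sup>+z. indicator B z * (A0 z)\<^sup>2 \<partial>lborel) \<le> ennreal D * ?M"
        unfolding B_def by (rule A0)
      show "(\<integral>\<^sup>+z. indicator (ball 0 (1 / 2)) z * (A (\<lambda>z. axis j 1) z)\<^sup>2 \<partial>lborel) \<le> ennreal D * ?M"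
        by (rule A[OF admissible_const]) (simp_all add: norm_eq_sqrt_inner inner_axis_axis)
    qed simp
    also have "\<dots> = ennreal (c * (1 + (?n + 2) * D)) * ?M"
    proof -
      have e: "ennreal (c * (1 + (?n + 2) * D)) = ennreal c * (1 + (of_nat CARD('n) + 2) * ennreal D)"
        using c0 D0 by (simp add: ennreal_mult ennreal_of_nat_eq_real_of_nat)
      have "?M + (\<Sum>i\<in>(UNIV :: 'n set). ennreal D * ?M) + ennreal D * ?M + ennreal D * ?M
          = (1 + (of_nat CARD('n) + 1 + 1) * ennreal D) * ?M"
        by (simp only: sum_constant distrib_right mult.assoc add.assoc mult_1_left)
      then show ?thesis unfolding e by (simp add: mult.assoc add.assoc)
    qed
    finally show "(\<integral>\<^sup>+z. ennreal (?E z) * indicator (ball 0 1) z \<partial>lborel) \<le> ennreal (c * (1 + (?n + 2) * D)) * ?M"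
      unfolding B_def .
  qed
qed

section \<open>Riesz representation and adjoints on complete subspaces\<close>

abbreviation csubspace :: "'a::complex_inner set \<Rightarrow> bool" where "csubspace \<equiv> complex_vector.subspace"

lemma scaleC_minus1: "scaleC (- 1) x = - (x :: 'a::complex_inner)"
  using scaleC_of_real[of "- 1" x] by simp

lemma cinner_zero_left [simp]: "cinner 0 y = (0 :: complex)" for y :: "'a::complex_inner"
  using cinner_add_left[of 0 0 y] by simp

lemma cinner_add_right: "cinner x (y + z) = cinner x y + cinner x (z :: 'a::complex_inner)"
  by (metis cinner_add_left cinner_commute complex_cnj_add)

lemma cinner_scaleC_right: "cinner x (scaleC c y) = cnj c * cinner x (y :: 'a::complex_inner)"
  by (metis cinner_scaleC_left cinner_commute complex_cnj_mult)

lemma cinner_zero_right [simp]: "cinner x 0 = (0 :: complex)" for x :: "'a::complex_inner"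
  using cinner_add_right[of x 0 0] by simp

lemma cinner_minus_left: "cinner (- x) y = - cinner x (y :: 'a::complex_inner)"
  using cinner_scaleC_left[of "- 1" x y] by (simp add: scaleC_minus1)

lemma cinner_minus_right: "cinner x (- y) = - cinner x (y :: 'a::complex_inner)"
  using cinner_scaleC_right[of x "- 1" y] by (simp add: scaleC_minus1)

lemma cinner_diff_left: "cinner (x - y) z = cinner x z - cinner y (z :: 'a::complex_inner)"
  using cinner_add_left[of x "- y" z] by (simp add: cinner_minus_left)

lemma cinner_diff_right: "cinner x (y - z) = cinner x y - cinner x (z :: 'a::complex_inner)"
  using cinner_add_right[of x y "- z"] by (simp add: cinner_minus_right)

lemma cinner_sum_left: "cinner (\<Sum>i\<in>I. f i) y = (\<Sum>i\<in>I. cinner (f i) (y :: 'a::complex_inner))"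
  by (induction I rule: infinite_finite_induct) (auto simp: cinner_add_left)

lemma cinner_sum_right: "cinner y (\<Sum>i\<in>I. f i) = (\<Sum>i\<in>I. cinner (y :: 'a::complex_inner) (f i))"
  by (induction I rule: infinite_finite_induct) (auto simp: cinner_add_right)

lemma cinner_self: "cinner x x = complex_of_real ((norm x)\<^sup>2)" for x :: "'a::complex_inner"
proof -
  have "Im (cinner x x) = 0"
    using arg_cong[OF cinner_commute[of x x], of Im] by simp
  moreover have "Re (cinner x x) = (norm x)\<^sup>2"
    by (simp add: power2_norm_eq_inner inner_eq_Re_cinner)
  ultimately show ?thesis by (simp add: complex_eq_iff)
qed

lemma norm_scaleC: "norm (scaleC c x) = cmod c * norm (x :: 'a::complex_inner)"
proof -
  have c: "c * cnj c = of_real ((cmod c)\<^sup>2)"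
    by (rule complex_norm_square[symmetric])
  have "complex_of_real ((norm (scaleC c x))\<^sup>2) = of_real ((cmod c * norm x)\<^sup>2)"
  proof -
    have "cinner (scaleC c x) (scaleC c x) = c * cnj c * cinner x x"
      by (simp add: cinner_scaleC_left cinner_scaleC_right)
    then show ?thesis unfolding c cinner_self by (simp add: power_mult_distrib)
  qed
  then have "(norm (scaleC c x))\<^sup>2 = (cmod c * norm x)\<^sup>2" by (simp only: of_real_eq_iff)
  then show ?thesis by (simp add: power2_eq_iff_nonneg)
qed

lemma cinner_Cauchy_Schwarz: "cmod (cinner x y) \<le> norm x * norm (y :: 'a::complex_inner)"
proof (cases "cinner x y = 0")
  case False
  define c where "c = cnj (cinner x y) / of_real (cmod (cinner x y))"
  have c: "cmod c = 1" using False by (simp add: c_def norm_divide)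
  have "c * cinner x y = of_real (cmod (cinner x y))"
    using False by (simp add: c_def power2_eq_square complex_norm_square[symmetric] mult.commute[of "cnj _"])
  then have "cmod (cinner x y) = inner (scaleC c x) y"
    by (simp add: inner_eq_Re_cinner cinner_scaleC_left)
  also have "\<dots> \<le> norm (scaleC c x) * norm y" by (rule norm_cauchy_schwarz)
  finally show ?thesis by (simp add: norm_scaleC c)
qed simp

lemma bounded_linear_cinner_left: "bounded_linear (\<lambda>x. cinner x (y :: 'a::complex_inner))"
  by (rule bounded_linear_intro[where K = "norm y"])
    (auto simp: cinner_add_left cinner_scaleC_left scaleC_of_real[symmetric] scaleR_conv_of_real cinner_Cauchy_Schwarz)

lemma bounded_linear_cinner_right: "bounded_linear (\<lambda>y. cinner (x :: 'a::complex_inner) y)"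
proof (rule bounded_linear_intro[where K = "norm x"])
  show "cmod (cinner x y) \<le> norm y * norm x" for y
    using cinner_Cauchy_Schwarz[of x y] by (simp add: mult.commute)
qed (auto simp: cinner_add_right cinner_scaleC_right scaleC_of_real[symmetric] scaleR_conv_of_real)

lemma csubspace_closed:
  assumes "csubspace M"
  shows "0 \<in> M" "x \<in> M \<Longrightarrow> y \<in> M \<Longrightarrow> x + y \<in> M" "x \<in> M \<Longrightarrow> scaleC c x \<in> M"
    "x \<in> M \<Longrightarrow> - x \<in> M" "x \<in> M \<Longrightarrow> y \<in> M \<Longrightarrow> x - y \<in> M" "x \<in> M \<Longrightarrow> r *\<^sub>R x \<in> M"
    "(\<And>i. i \<in> I \<Longrightarrow> f i \<in> M) \<Longrightarrow> (\<Sum>i\<in>I. f i) \<in> M"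
  using complex_vector.subspace_0[OF assms] complex_vector.subspace_add[OF assms] complex_vector.subspace_scale[OF assms]
    complex_vector.subspace_neg[OF assms] complex_vector.subspace_diff[OF assms]
  by (simp_all add: scaleC_of_real[symmetric] complex_vector.subspace_sum[OF assms])

text \<open>The representing vector is the minimizer of \<open>|f|\<^sup>2 - 2 Re (\<phi> f)\<close>; a minimizing sequence
  is Cauchy by the parallelogram law, so that completeness of the subspace provides its limit.\<close>

theorem riesz_on_complete_subspace:
  fixes M :: "'a::complex_inner set" and \<phi> :: "'a \<Rightarrow> complex"
  assumes M: "csubspace M" "complete M"
    and add: "\<And>f g. f \<in> M \<Longrightarrow> g \<in> M \<Longrightarrow> \<phi> (f + g) = \<phi> f + \<phi> g"
    and scale: "\<And>c f. f \<in> M \<Longrightarrow> \<phi> (scaleC c f) = c * \<phi> f"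
    and bd: "\<And>f. f \<in> M \<Longrightarrow> cmod (\<phi> f) \<le> B * norm f"
  obtains h where "h \<in> M" "\<And>f. f \<in> M \<Longrightarrow> \<phi> f = cinner f h"
proof -
  note sub = csubspace_closed[OF M(1)]
  define J where "J f = (norm f)\<^sup>2 - 2 * Re (\<phi> f)" for f
  have scaleR: "\<phi> (r *\<^sub>R f) = of_real r * \<phi> f" if "f \<in> M" for r f
    using scale[OF that, of "of_real r"] by (simp add: scaleC_of_real)
  have diff: "\<phi> (f - g) = \<phi> f - \<phi> g" if "f \<in> M" "g \<in> M" for f g
    using add[of "f - g" g] that sub by simp
  have lower: "J f \<ge> - B\<^sup>2" if "f \<in> M" for f
  proof -
    have "Re (\<phi> f) \<le> B * norm f" using bd[OF that] complex_Re_le_cmod order_trans by blast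
    moreover have "0 \<le> (norm f - B)\<^sup>2" by simp
    ultimately show ?thesis unfolding J_def power2_diff by (simp add: mult.commute)
  qed
  have para: "(norm (f - g))\<^sup>2 = 2 * J f + 2 * J g - 4 * J ((1/2) *\<^sub>R (f + g))" if "f \<in> M" "g \<in> M" for f g
  proof -
    have "(norm (f - g))\<^sup>2 + (norm (f + g))\<^sup>2 = 2 * (norm f)\<^sup>2 + 2 * (norm g)\<^sup>2"
      by (simp add: power2_norm_eq_inner inner_diff inner_add inner_commute)
    moreover have "(norm ((1/2) *\<^sub>R (f + g)))\<^sup>2 = (norm (f + g))\<^sup>2 / 4"
      unfolding norm_scaleR by (simp add: power_mult_distrib power_divide)
    moreover have "Re (\<phi> ((1/2) *\<^sub>R (f + g))) = (Re (\<phi> f) + Re (\<phi> g)) / 2"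
    proof -
      have "\<phi> ((1/2) *\<^sub>R (f + g)) = (\<phi> f + \<phi> g) / 2"
        using that sub scaleR[of "f + g" "1/2"] add by simp
      then show ?thesis by (simp only: Re_divide_numeral plus_complex.sel)
    qed
    ultimately show ?thesis
      unfolding J_def by (simp only:) (simp add: field_simps)
  qed
  define m where "m = Inf (J ` M)"
  have bdd: "bdd_below (J ` M)" using lower by (auto intro!: bdd_belowI[of _ "- B\<^sup>2"])
  have mle: "m \<le> J f" if "f \<in> M" for f
    unfolding m_def by (rule cINF_lower[OF bdd that])
  have "\<exists>f\<in>M. J f < m + inverse (real (Suc k))" for k
  proof -
    have "Inf (J ` M) < m + inverse (real (Suc k))" unfolding m_def by simp
    then show ?thesis using sub(1) cInf_less_iff[OF _ bdd] by fastforce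
  qed
  then obtain x where x: "\<And>k. x k \<in> M" "\<And>k. J (x k) < m + inverse (real (Suc k))"
    by metis
  have dist: "(norm (x i - x k))\<^sup>2 \<le> 2 * inverse (real (Suc i)) + 2 * inverse (real (Suc k))" for i k
    using para[OF x(1) x(1), of i k] x(2)[of i] x(2)[of k] mle[of "(1/2) *\<^sub>R (x i + x k)"] x(1) sub by auto
  have "Cauchy x"
    unfolding Cauchy_altdef2
  proof (intro allI impI)
    fix e :: real assume e: "e > 0"
    obtain N where N: "inverse (real (Suc N)) < e\<^sup>2 / 4"
      using reals_Archimedean[of "e\<^sup>2 / 4"] e by auto
    have "dist (x k) (x N) < e" if "k \<ge> N" for k
    proof -
      have "inverse (real (Suc k)) \<le> inverse (real (Suc N))" using that by simp
      then have "(norm (x k - x N))\<^sup>2 < e\<^sup>2" using dist[of k N] N by linarith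
      then show ?thesis using e by (simp add: dist_norm power2_less_imp_less)
    qed
    then show "\<exists>N. \<forall>n\<ge>N. dist (x n) (x N) < e" by blast
  qed
  then obtain h where h: "h \<in> M" "x \<longlonglongrightarrow> h"
    using M(2) x(1) unfolding complete_def by blast
  have \<phi>lim: "(\<lambda>k. \<phi> (x k)) \<longlonglongrightarrow> \<phi> h"
  proof (rule LIM_zero_cancel, rule Lim_null_comparison)
    show "\<forall>\<^sub>F k in sequentially. norm (\<phi> (x k) - \<phi> h) \<le> B * norm (x k - h)"
      using bd[of "x _ - h"] diff[OF x(1) h(1)] sub(5)[OF x(1) h(1)] by simp
    show "(\<lambda>k. B * norm (x k - h)) \<longlonglongrightarrow> 0"
      using tendsto_mult_right_zero[OF tendsto_norm_zero[OF LIM_zero[OF h(2)]], of B] by simp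
  qed
  have "J h \<le> m"
  proof (rule LIMSEQ_le)
    show "(\<lambda>k. J (x k)) \<longlonglongrightarrow> J h"
      unfolding J_def by (intro tendsto_intros h(2) \<phi>lim)
    show "(\<lambda>k. m + inverse (real (Suc k))) \<longlonglongrightarrow> m"
      using tendsto_add[OF tendsto_const LIMSEQ_inverse_real_of_nat, of m] by simp
  qed (use x(2) in \<open>auto intro: less_imp_le\<close>)
  then have hmin: "J h \<le> J f" if "f \<in> M" for f using mle[OF that] by linarith
  have re: "Re (\<phi> f) = Re (cinner f h)" if f: "f \<in> M" for f
  proof -
    let ?d = "inner f h - Re (\<phi> f)"
    have "J (h + t *\<^sub>R f) = J h + 2 * t * ?d + t\<^sup>2 * (norm f)\<^sup>2" for t
    proof -
      have "(norm (h + t *\<^sub>R f))\<^sup>2 = (norm h)\<^sup>2 + 2 * t * inner f h + t\<^sup>2 * (norm f)\<^sup>2"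
        unfolding power2_norm_eq_inner
        by (simp add: inner_add inner_commute[of h f] power2_eq_square algebra_simps)
      moreover have "\<phi> (h + t *\<^sub>R f) = \<phi> h + of_real t * \<phi> f"
        using f h(1) sub add scaleR by simp
      ultimately show ?thesis unfolding J_def by (simp add: algebra_simps)
    qed
    then have *: "0 \<le> 2 * t * ?d + t\<^sup>2 * (norm f)\<^sup>2" for t
      using hmin[of "h + t *\<^sub>R f"] f h(1) sub by simp
    have "?d = 0"
    proof (rule ccontr)
      assume d: "?d \<noteq> 0"
      define t where "t = - ?d / ((norm f)\<^sup>2 + 1)"
      have pos: "(norm f)\<^sup>2 + 1 > 0" by (simp add: add_nonneg_pos)
      have "2 * t * ?d + t\<^sup>2 * (norm f)\<^sup>2 \<le> 2 * t * ?d + t\<^sup>2 * ((norm f)\<^sup>2 + 1)"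
        by (simp add: algebra_simps)
      also have "\<dots> = - ?d\<^sup>2 / ((norm f)\<^sup>2 + 1)"
      proof -
        have "2 * (- d / P) * d + (- d / P)\<^sup>2 * P = - d\<^sup>2 / P" if "P > 0" for d P :: real
          using that by (simp add: field_simps power2_eq_square)
        then show ?thesis unfolding t_def using pos by blast
      qed
      also have "\<dots> < 0" using d pos by simp
      finally show False using *[of t] by simp
    qed
    then show ?thesis by (simp add: inner_eq_Re_cinner)
  qed
  have "\<phi> f = cinner f h" if f: "f \<in> M" for f
  proof (rule complex_eqI)
    show "Re (\<phi> f) = Re (cinner f h)" by (rule re[OF f])
    have "scaleC \<i> f \<in> M" using sub f by simp
    from re[OF this] show "Im (\<phi> f) = Im (cinner f h)"
      by (simp add: scale[OF f] cinner_scaleC_left)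
  qed
  with h(1) show thesis by (rule that)
qed

lemma adjoint_on_characterization:
  fixes M :: "'a::complex_inner set"
  assumes M: "csubspace M" "complete M"
    and add: "\<And>f g. f \<in> M \<Longrightarrow> g \<in> M \<Longrightarrow> T (f + g) = T f + T g"
    and scale: "\<And>c f. f \<in> M \<Longrightarrow> T (scaleC c f) = scaleC c (T f)"
    and bd: "\<And>f. f \<in> M \<Longrightarrow> norm (T f) \<le> B * norm f"
  shows "adjoint_on M T g \<in> M" "\<And>f. f \<in> M \<Longrightarrow> cinner (T f) g = cinner f (adjoint_on M T g)"
proof -
  have "\<exists>!h. h \<in> M \<and> (\<forall>f\<in>M. cinner (T f) g = cinner f h)"
  proof (rule ex_ex1I)
    obtain h where "h \<in> M" "\<And>f. f \<in> M \<Longrightarrow> cinner (T f) g = cinner f h"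
    proof (rule riesz_on_complete_subspace[OF M, of "\<lambda>f. cinner (T f) g" "B * norm g"])
      show "cmod (cinner (T f) g) \<le> B * norm g * norm f" if "f \<in> M" for f
      proof -
        have "cmod (cinner (T f) g) \<le> norm (T f) * norm g" by (rule cinner_Cauchy_Schwarz)
        also have "\<dots> \<le> B * norm f * norm g" using bd[OF that] by (rule mult_right_mono) simp
        finally show ?thesis by (simp add: mult_ac)
      qed
    qed (auto simp: add scale cinner_add_left cinner_scaleC_left)
    then show "\<exists>h. h \<in> M \<and> (\<forall>f\<in>M. cinner (T f) g = cinner f h)" by blast
  next
    fix h h' assume h: "h \<in> M \<and> (\<forall>f\<in>M. cinner (T f) g = cinner f h)" and h': "h' \<in> M \<and> (\<forall>f\<in>M. cinner (T f) g = cinner f h')"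
    then have "h - h' \<in> M" using csubspace_closed[OF M(1)] by blast
    then have "cinner (h - h') h = cinner (h - h') h'" using h h' by metis
    then have "cinner (h - h') (h - h') = 0" by (simp add: cinner_diff_right)
    then show "h = h'" by (simp add: cinner_self)
  qed
  from theI'[OF this] show "adjoint_on M T g \<in> M" "\<And>f. f \<in> M \<Longrightarrow> cinner (T f) g = cinner f (adjoint_on M T g)"
    unfolding adjoint_on_def by auto
qed

text \<open>Gaussian elimination of one equation and one unknown at a time.\<close>

lemma underdetermined_system:
  fixes \<phi> :: "'l \<Rightarrow> 'i \<Rightarrow> complex"
  assumes "finite L" "finite I" "card L < card I"
  shows "\<exists>c. (\<exists>i\<in>I. c i \<noteq> 0) \<and> (\<forall>l\<in>L. (\<Sum>i\<in>I. c i * \<phi> l i) = 0)"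
  using assms
proof (induction L arbitrary: I \<phi> rule: finite_induct)
  case empty
  then obtain i where "i \<in> I" by (metis card.empty card_gt_0_iff ex_in_conv)
  then show ?case by (intro exI[of _ "\<lambda>_. 1"]) auto
next
  case (insert l L)
  show ?case
  proof (cases "\<forall>i\<in>I. \<phi> l i = 0")
    case True
    have "card L < card I" using insert by simp
    from insert.IH[OF insert.prems(1) this] True show ?thesis by fastforce
  next
    case False
    then obtain k where k: "k \<in> I" "\<phi> l k \<noteq> 0" by blast
    let ?I = "I - {k}"
    have "card L < card ?I" using insert k by simp
    from insert.IH[OF _ this, of "\<lambda>a i. \<phi> a i - \<phi> a k * \<phi> l i / \<phi> l k"] insert.prems(1)
    obtain c i where c: "i \<in> ?I" "c i \<noteq> 0" "\<forall>a\<in>L. (\<Sum>i\<in>?I. c i * (\<phi> a i - \<phi> a k * \<phi> l i / \<phi> l k)) = 0"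
      by auto
    define s where "s = (\<Sum>i\<in>?I. c i * \<phi> l i) / \<phi> l k"
    define c' where "c' i = (if i = k then - s else c i)" for i
    have sum: "(\<Sum>i\<in>I. c' i * \<phi> a i) = - s * \<phi> a k + (\<Sum>i\<in>?I. c i * \<phi> a i)" for a
      using k insert.prems(1) by (subst sum.remove[of I k]) (auto simp: c'_def intro!: sum.cong)
    have "(\<Sum>i\<in>I. c' i * \<phi> a i) = 0" if "a \<in> insert l L" for a
    proof (cases "a = l")
      case True
      then show ?thesis unfolding sum using k by (simp add: s_def)
    next
      case False
      then have "(\<Sum>i\<in>?I. c i * (\<phi> a i - \<phi> a k * \<phi> l i / \<phi> l k)) = 0" using c(3) that by blast
      moreover have "(\<Sum>i\<in>?I. c i * (\<phi> a i - \<phi> a k * \<phi> l i / \<phi> l k))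
          = (\<Sum>i\<in>?I. c i * \<phi> a i) - \<phi> a k / \<phi> l k * (\<Sum>i\<in>?I. c i * \<phi> l i)"
        by (simp add: right_diff_distrib sum_subtractf sum_distrib_left mult_ac)
      ultimately show ?thesis unfolding sum by (simp add: s_def mult_ac)
    qed
    moreover have "i \<in> I" "c' i \<noteq> 0" using c by (auto simp: c'_def)
    ultimately show ?thesis by blast
  qed
qed

section \<open>A criterion for membership in a Schatten class\<close>

text \<open>An operator whose form is dominated by a quadratic quantity \<open>W\<close> that is small off few
  directions. In the application \<open>A\<close> is a commutator, \<open>W\<close> half of a boundary weighted square
  norm, and each \<open>e d l\<close> has a multiple of a monomial as its only nonzero entry.\<close>

locale weakly_bounded_operator =
  fixes M :: "'a::complex_inner set" and A :: "'a \<Rightarrow> 'a" and W :: "'a \<Rightarrow> real" and C \<theta> R :: real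
    and n :: nat and L :: "nat \<Rightarrow> 'l set" and e :: "nat \<Rightarrow> 'l \<Rightarrow> 'a"
  assumes M: "csubspace M" "complete M"
    and AM: "\<And>f. f \<in> M \<Longrightarrow> A f \<in> M"
    and A_add: "\<And>f g. f \<in> M \<Longrightarrow> g \<in> M \<Longrightarrow> A (f + g) = A f + A g"
    and A_scale: "\<And>c f. f \<in> M \<Longrightarrow> A (scaleC c f) = scaleC c (A f)"
    and C: "C > 0" and \<theta>: "\<theta> > 0" and R: "R > 0"
    and W0: "\<And>f. W f \<ge> 0" and W1: "\<And>f. f \<in> M \<Longrightarrow> W f \<le> (norm f)\<^sup>2"
    and form: "\<And>f g. f \<in> M \<Longrightarrow> g \<in> M \<Longrightarrow> cmod (cinner (A f) g) \<le> C * (sqrt (W f) * sqrt (W g))"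
    and L: "\<And>d. d \<ge> 1 \<Longrightarrow> finite (L d)" "\<And>d. d \<ge> 1 \<Longrightarrow> real (card (L d)) \<le> R * real d ^ n"
    and tail: "\<And>d f. d \<ge> 1 \<Longrightarrow> f \<in> M \<Longrightarrow>
      W f \<le> 2 * real d powr (- \<theta>) * (norm f)\<^sup>2 + (\<Sum>l\<in>L d. (cmod (cinner f (e d l)))\<^sup>2)"
begin

lemmas sub = csubspace_closed[OF M(1)]

lemma A_diff: "f \<in> M \<Longrightarrow> g \<in> M \<Longrightarrow> A (f - g) = A f - A g"
  using A_add[of "f - g" g] sub by (simp add: algebra_simps)

lemma A_zero: "A 0 = 0"
  using A_add[of 0 0] sub(1) by simp

lemma A_sum: "(\<And>i. i \<in> I \<Longrightarrow> f i \<in> M) \<Longrightarrow> A (\<Sum>i\<in>I. f i) = (\<Sum>i\<in>I. A (f i))"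
  by (induction I rule: infinite_finite_induct) (auto simp: A_zero A_add sub)

lemma cmod_cinner_self: "cmod (cinner x x) = (norm (x :: 'b::complex_inner))\<^sup>2"
  unfolding cinner_self norm_of_real by simp

lemma norm_A_le_W:
  assumes "f \<in> M" shows "norm (A f) \<le> C * sqrt (W f)"
proof -
  have "(norm (A f))\<^sup>2 = cmod (cinner (A f) (A f))"
    by (simp add: cmod_cinner_self)
  also have "\<dots> \<le> C * (sqrt (W f) * sqrt (W (A f)))"
    by (rule form[OF assms AM[OF assms]])
  also have "\<dots> \<le> C * (sqrt (W f) * norm (A f))"
    using C W0 W1[OF AM[OF assms]] by (intro mult_left_mono real_le_lsqrt) auto
  finally have "norm (A f) * norm (A f) \<le> (C * sqrt (W f)) * norm (A f)"
    by (simp add: power2_eq_square mult_ac)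
  then show ?thesis
    using C W0[of f] by (cases "norm (A f) = 0") (auto simp: mult_le_cancel_right)
qed

lemma norm_A_le: "f \<in> M \<Longrightarrow> norm (A f) \<le> C * norm f"
proof -
  assume f: "f \<in> M"
  have "C * sqrt (W f) \<le> C * norm f"
    using C W0 W1[OF f] by (intro mult_left_mono real_le_lsqrt) auto
  with norm_A_le_W[OF f] show ?thesis by linarith
qed

lemma adjoint_A: "adjoint_on M A g \<in> M" "f \<in> M \<Longrightarrow> cinner (A f) g = cinner f (adjoint_on M A g)"
proof -
  note * = adjoint_on_characterization[OF M A_add A_scale norm_A_le]
  show "adjoint_on M A g \<in> M" by (rule *(1))
  show "cinner (A f) g = cinner f (adjoint_on M A g)" if "f \<in> M" by (rule *(2)) (use that in auto)
qed

text \<open>Since the form is small only when both arguments are, the functionals are required to vanish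
  on \<open>f\<close> as well as on \<open>A f\<close>; this is where the factor \<open>2\<close> in the count of singular values
  comes from.\<close>

lemma norm_A_le_tail:
  assumes d: "d \<ge> 1" and f: "f \<in> M"
    and 1: "\<And>l. l \<in> L d \<Longrightarrow> cinner f (e d l) = 0"
    and 2: "\<And>l. l \<in> L d \<Longrightarrow> cinner (A f) (e d l) = 0"
  shows "norm (A f) \<le> 2 * C * real d powr (- \<theta>) * norm f"
proof -
  let ?t = "2 * real d powr (- \<theta>)"
  have t: "?t \<ge> 0" by simp
  have w: "sqrt (W g) \<le> sqrt ?t * norm g" if "g \<in> M" "\<And>l. l \<in> L d \<Longrightarrow> cinner g (e d l) = 0" for g
  proof -
    have "W g \<le> ?t * (norm g)\<^sup>2" using tail[OF d that(1)] that(2) by simp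
    then have "sqrt (W g) \<le> sqrt (?t * (norm g)\<^sup>2)" by (rule real_sqrt_le_mono)
    then show ?thesis by (simp add: real_sqrt_mult)
  qed
  have "norm (A f) * norm (A f) = cmod (cinner (A f) (A f))"
    by (simp add: cmod_cinner_self power2_eq_square)
  also have "\<dots> \<le> C * (sqrt (W f) * sqrt (W (A f)))"
    by (rule form[OF f AM[OF f]])
  also have "\<dots> \<le> C * ((sqrt ?t * norm f) * (sqrt ?t * norm (A f)))"
    using C W0 by (intro mult_left_mono mult_mono w f AM 1 2) auto
  also have "\<dots> = (C * (sqrt ?t * sqrt ?t) * norm f) * norm (A f)" by (simp only: mult_ac)
  also have "sqrt ?t * sqrt ?t = ?t" using t by simp
  finally have *: "norm (A f) * norm (A f) \<le> (C * ?t * norm f) * norm (A f)" .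
  have "norm (A f) \<le> C * ?t * norm f"
  proof (cases "A f = 0")
    case True
    then show ?thesis using C by simp
  next
    case False
    then show ?thesis using * by (simp add: mult_le_cancel_right)
  qed
  then show ?thesis by (simp only: mult_ac)
qed

abbreviation "V \<equiv> singular_space M A"

lemma V_sub: "f \<in> V s \<Longrightarrow> f \<in> M" by (simp add: singular_space_def)

lemma V_cinner:
  assumes "f \<in> V s" "g \<in> M"
  shows "cinner (A g) (A f) = of_real (s\<^sup>2) * cinner g f"
  using adjoint_A(2)[OF assms(2), of "A f"] assms(1) by (simp add: singular_space_def cinner_scaleC_right)

lemma V_orthogonal:
  assumes "f \<in> V s" "g \<in> V t" "s > 0" "t > 0" "s \<noteq> t"
  shows "cinner g f = 0"
proof -
  have "of_real (s\<^sup>2) * cinner g f = cinner (A g) (A f)"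
    using V_cinner[OF assms(1) V_sub[OF assms(2)]] by (rule sym)
  also have "\<dots> = cnj (cinner (A f) (A g))" by (rule cinner_commute)
  also have "\<dots> = cnj (of_real (t\<^sup>2) * cinner f g)"
    unfolding V_cinner[OF assms(2) V_sub[OF assms(1)]] ..
  also have "\<dots> = of_real (t\<^sup>2) * cinner g f" by (simp only: complex_cnj_mult complex_cnj_complex_of_real cinner_commute[of g f])
  finally have "(of_real (s\<^sup>2) - of_real (t\<^sup>2)) * cinner g f = 0" by (simp add: algebra_simps)
  moreover have "s\<^sup>2 \<noteq> t\<^sup>2" using assms by (simp add: power2_eq_iff)
  then have "complex_of_real (s\<^sup>2) - of_real (t\<^sup>2) \<noteq> 0" by (simp only: right_minus_eq of_real_eq_iff not_False_eq_True)
  ultimately show ?thesis by (metis mult_eq_0_iff)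
qed

lemma adjoint_add: "g \<in> M \<Longrightarrow> h \<in> M \<Longrightarrow> adjoint_on M A (g + h) = adjoint_on M A g + adjoint_on M A h"
  and adjoint_scale: "g \<in> M \<Longrightarrow> adjoint_on M A (scaleC c g) = scaleC c (adjoint_on M A g)"
proof -
  have ext: "x = y" if "x \<in> M" "y \<in> M" "\<And>f. f \<in> M \<Longrightarrow> cinner f x = cinner f y" for x y
  proof -
    have "cinner (x - y) (x - y) = 0"
      using that(3)[of "x - y"] that sub by (simp add: cinner_diff_right)
    then show ?thesis by (simp add: cinner_self)
  qed
  show "adjoint_on M A (g + h) = adjoint_on M A g + adjoint_on M A h" if "g \<in> M" "h \<in> M"
  proof (rule ext[OF adjoint_A(1) sub(2)[OF adjoint_A(1) adjoint_A(1)]])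
    show "cinner f (adjoint_on M A (g + h)) = cinner f (adjoint_on M A g + adjoint_on M A h)" if "f \<in> M" for f
      by (simp add: cinner_add_right flip: adjoint_A(2)[OF that])
  qed
  show "adjoint_on M A (scaleC c g) = scaleC c (adjoint_on M A g)" if "g \<in> M"
  proof (rule ext[OF adjoint_A(1) sub(3)[OF adjoint_A(1)]])
    show "cinner f (adjoint_on M A (scaleC c g)) = cinner f (scaleC c (adjoint_on M A g))" if "f \<in> M" for f
      by (simp add: cinner_scaleC_right flip: adjoint_A(2)[OF that])
  qed
qed

lemma V_subspace: "csubspace (V s)"
  unfolding complex_vector.subspace_def
proof (intro conjI ballI allI)
  show "0 \<in> V s"
    using sub(1) adjoint_scale[OF sub(1), of 0] by (simp add: singular_space_def A_zero)
  show "x + y \<in> V s" if "x \<in> V s" "y \<in> V s" for x y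
    using that by (auto simp: singular_space_def sub A_add adjoint_add AM scaleC_add_right)
  show "scaleC c x \<in> V s" if "x \<in> V s" for c x
    using that by (auto simp: singular_space_def sub A_scale adjoint_scale AM scaleC_scaleC mult.commute)
qed

lemma V_norm: "f \<in> V s \<Longrightarrow> s > 0 \<Longrightarrow> norm (A f) = s * norm f"
proof -
  assume f: "f \<in> V s" and s: "s > 0"
  have "complex_of_real ((norm (A f))\<^sup>2) = of_real ((s * norm f)\<^sup>2)"
    using V_cinner[OF f V_sub[OF f]] by (simp add: cinner_self power_mult_distrib)
  then have "(norm (A f))\<^sup>2 = (s * norm f)\<^sup>2" by (simp only: of_real_eq_iff)
  then show ?thesis using s by (simp add: power2_eq_iff_nonneg)
qed

lemma cdim_V_zero: "s > C \<Longrightarrow> cdim (V s) = 0"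
proof -
  assume s: "s > C"
  have "f = 0" if "f \<in> V s" for f
  proof (rule ccontr)
    assume "f \<noteq> 0"
    then have "C * norm f < s * norm f" using s by simp
    moreover have "norm (A f) = s * norm f" using V_norm[OF that] s C by simp
    ultimately show False using norm_A_le[OF V_sub[OF that]] by simp
  qed
  then have V0: "V s \<subseteq> {0}" by blast
  obtain B where B: "B \<subseteq> V s" "complex_vector.independent B" "card B = cdim (V s)"
    using complex_vector.basis_exists[of "V s"] by metis
  have "0 \<notin> B" using B(2) complex_vector.dependent_zero by blast
  then have "B = {}" using B(1) V0 by blast
  then show ?thesis using B(3) by simp
qed

lemma orthogonal_family_norm:
  assumes "finite T" "\<And>s t. s \<in> T \<Longrightarrow> t \<in> T \<Longrightarrow> s \<noteq> t \<Longrightarrow> cinner (v s) (v t :: 'b::complex_inner) = 0"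
  shows "(norm (\<Sum>s\<in>T. v s))\<^sup>2 = (\<Sum>s\<in>T. (norm (v s))\<^sup>2)"
proof -
  have "complex_of_real ((norm (\<Sum>s\<in>T. v s))\<^sup>2) = (\<Sum>s\<in>T. \<Sum>t\<in>T. cinner (v t) (v s))"
    unfolding cinner_self[symmetric] by (simp add: cinner_sum_left cinner_sum_right)
  also have "\<dots> = (\<Sum>s\<in>T. \<Sum>t\<in>T. if t = s then of_real ((norm (v s))\<^sup>2) else 0)"
    using assms(2) by (intro sum.cong refl) (auto simp: cinner_self)
  also have "\<dots> = of_real (\<Sum>s\<in>T. (norm (v s))\<^sup>2)"
    using assms(1) by simp
  finally show ?thesis by (simp only: of_real_eq_iff)
qed

text \<open>If the dimensions added up to more than the number of functionals, some nonzero \<open>w\<close> in the sum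
  of the singular spaces would satisfy all conditions \<open>\<langle>w, e d l\<rangle> = 0\<close> and
  \<open>\<langle>A w, e d l\<rangle> = 0\<close>, hence be shrunk by \<open>A\<close> at least as much as the threshold; but \<open>A\<close>
  stretches every summand by more, and the summands and their images are orthogonal.\<close>

lemma singular_count:
  assumes d: "d \<ge> 1" and T: "finite T" "\<And>s. s \<in> T \<Longrightarrow> s > 2 * C * real d powr (- \<theta>)"
  shows "(\<Sum>s\<in>T. cdim (V s)) \<le> 2 * card (L d)"
proof (rule ccontr)
  assume neg: "\<not> ?thesis"
  let ?a = "2 * C * real d powr (- \<theta>)"
  have a0: "?a \<ge> 0" using C by simp
  then have pos: "s > 0" if "s \<in> T" for s using T(2)[OF that] by linarith
  have "\<exists>B. finite B \<and> B \<subseteq> V s \<and> complex_vector.independent B \<and> card B = cdim (V s)" for s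
  proof -
    obtain B where B: "B \<subseteq> V s" "complex_vector.independent B" "card B = cdim (V s)"
      using complex_vector.basis_exists[of "V s"] by metis
    show ?thesis
    proof (cases "finite B")
      \<comment> \<open>The cardinality of an infinite basis counts as \<open>0\<close>, which the empty set realizes.\<close>
      case False
      then show ?thesis using B by (intro exI[of _ "{}"]) (auto simp: complex_vector.independent_empty)
    qed (use B in blast)
  qed
  then obtain B where B: "\<And>s. finite (B s)" "\<And>s. B s \<subseteq> V s" "\<And>s. complex_vector.independent (B s)" "\<And>s. card (B s) = cdim (V s)"
    by metis
  let ?I = "Sigma T B"
  let ?L = "L d <+> L d"
  have fin: "finite ?I" "finite ?L" using T(1) B(1) L(1)[OF d] by auto
  have "card ?L < card ?I"
    using neg B L(1)[OF d] T(1) by (simp add: card_Plus)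
  from underdetermined_system[OF fin(2,1) this, of "\<lambda>l (s, b). case l of Inl l \<Rightarrow> cinner b (e d l) | Inr l \<Rightarrow> cinner (A b) (e d l)"]
  obtain c where c: "\<exists>i\<in>?I. c i \<noteq> 0"
    "\<And>l. l \<in> ?L \<Longrightarrow> (\<Sum>i\<in>?I. c i * (case i of (s, b) \<Rightarrow> case l of Inl l \<Rightarrow> cinner b (e d l) | Inr l \<Rightarrow> cinner (A b) (e d l))) = 0"
    by blast
  define v where "v s = (\<Sum>b\<in>B s. scaleC (c (s, b)) b)" for s
  have vV: "v s \<in> V s" for s
    unfolding v_def using B(2)
    by (intro complex_vector.subspace_sum[OF V_subspace] complex_vector.subspace_scale[OF V_subspace]) auto
  have vM: "v s \<in> M" for s using V_sub[OF vV] .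
  have BM: "b \<in> M" if "b \<in> B s" for b s using B(2) V_sub that by blast
  define w where "w = (\<Sum>s\<in>T. v s)"
  have wM: "w \<in> M" unfolding w_def by (intro sub vM)
  have Av: "A (v s) = (\<Sum>b\<in>B s. scaleC (c (s, b)) (A b))" for s
    unfolding v_def by (subst A_sum) (auto simp: A_scale BM sub(3)[OF BM])
  have Aw: "A w = (\<Sum>s\<in>T. A (v s))" unfolding w_def by (intro A_sum vM)
  have w0: "cinner w (e d l) = 0" if "l \<in> L d" for l
  proof -
    have "cinner w (e d l) = (\<Sum>s\<in>T. \<Sum>b\<in>B s. c (s, b) * cinner b (e d l))"
      by (simp add: w_def v_def cinner_sum_left cinner_scaleC_left)
    also have "\<dots> = 0" using c(2)[OF InlI[OF that]] T(1) B(1) by (simp add: sum.Sigma case_prod_unfold)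
    finally show ?thesis .
  qed
  have Aw0: "cinner (A w) (e d l) = 0" if "l \<in> L d" for l
  proof -
    have "cinner (A w) (e d l) = (\<Sum>s\<in>T. \<Sum>b\<in>B s. c (s, b) * cinner (A b) (e d l))"
      by (simp add: Aw Av cinner_sum_left cinner_scaleC_left)
    also have "\<dots> = 0" using c(2)[OF InrI[OF that]] T(1) B(1) by (simp add: sum.Sigma case_prod_unfold)
    finally show ?thesis .
  qed
  have upper: "norm (A w) \<le> ?a * norm w"
    by (rule norm_A_le_tail[OF d wM w0 Aw0])
  have nw: "(norm w)\<^sup>2 = (\<Sum>s\<in>T. (norm (v s))\<^sup>2)"
    unfolding w_def using V_orthogonal[OF vV vV] pos by (intro orthogonal_family_norm T(1)) auto
  have nAw: "(norm (A w))\<^sup>2 = (\<Sum>s\<in>T. s\<^sup>2 * (norm (v s))\<^sup>2)"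
  proof -
    have "(norm (A w))\<^sup>2 = (\<Sum>s\<in>T. (norm (A (v s)))\<^sup>2)"
      unfolding Aw using V_orthogonal[OF vV vV] pos V_cinner[OF vV vM] by (intro orthogonal_family_norm T(1)) auto
    also have "\<dots> = (\<Sum>s\<in>T. s\<^sup>2 * (norm (v s))\<^sup>2)"
      using V_norm[OF vV] pos by (intro sum.cong refl) (auto simp: power_mult_distrib)
    finally show ?thesis .
  qed
  obtain s b where sb: "s \<in> T" "b \<in> B s" "c (s, b) \<noteq> 0" using c(1) by auto
  have "v s \<noteq> 0"
  proof
    assume "v s = 0"
    then have "complex_vector.dependent (B s)"
      unfolding complex_vector.dependent_finite[OF B(1)] v_def using sb by (intro exI[of _ "\<lambda>b. c (s, b)"]) blast
    then show False using B(3) by blast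
  qed
  have "?a\<^sup>2 * (norm w)\<^sup>2 = (\<Sum>s\<in>T. ?a\<^sup>2 * (norm (v s))\<^sup>2)"
    by (simp add: nw sum_distrib_left)
  also have "\<dots> < (\<Sum>s\<in>T. s\<^sup>2 * (norm (v s))\<^sup>2)"
  proof (rule sum_strict_mono_ex1[OF T(1)])
    show "\<forall>s\<in>T. ?a\<^sup>2 * (norm (v s))\<^sup>2 \<le> s\<^sup>2 * (norm (v s))\<^sup>2"
    proof
      fix s assume "s \<in> T"
      then have "?a\<^sup>2 \<le> s\<^sup>2" using T(2) a0 by (intro power_mono) (auto intro: less_imp_le)
      then show "?a\<^sup>2 * (norm (v s))\<^sup>2 \<le> s\<^sup>2 * (norm (v s))\<^sup>2" by (rule mult_right_mono) simp
    qed
    have "?a\<^sup>2 < s\<^sup>2" using T(2)[OF sb(1)] a0 by (intro power_strict_mono) auto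
    then have "?a\<^sup>2 * (norm (v s))\<^sup>2 < s\<^sup>2 * (norm (v s))\<^sup>2"
      using \<open>v s \<noteq> 0\<close> by (intro mult_strict_right_mono) auto
    then show "\<exists>s\<in>T. ?a\<^sup>2 * (norm (v s))\<^sup>2 < s\<^sup>2 * (norm (v s))\<^sup>2" using sb(1) by blast
  qed
  also have "\<dots> = (norm (A w))\<^sup>2" by (simp add: nAw)
  also have "\<dots> \<le> (?a * norm w)\<^sup>2" by (intro power_mono upper) simp
  finally show False by (simp add: power_mult_distrib)
qed

text \<open>Singular values between \<open>a (l + 1)\<close> and \<open>a l\<close>, where \<open>a l\<close> decays like \<open>2 powr (- \<theta> l)\<close>,
  number at most a multiple of \<open>2 powr (n l)\<close>; their contribution is a geometric series with
  ratio \<open>2 powr (n - q \<theta>) < 1\<close>.\<close>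

lemma singular_summable:
  assumes q: "real n < q * \<theta>"
  shows "(\<lambda>s. real (cdim (V s)) * s powr q) summable_on {0<..}"
proof -
  define a where "a l = 2 * C * (2 ^ l) powr (- \<theta>)" for l :: nat
  define K where "K = 2 * R * 2 ^ n * (2 * C) powr q"
  define x where "x = 2 powr (real n - q * \<theta>)"
  have x: "0 < x" "x < 1" using q by (auto simp: x_def powr_less_one)
  have q0: "q > 0" using q \<theta> by (metis le_less_trans not_less of_nat_0_le_iff zero_less_mult_pos2)
  have K0: "K \<ge> 0" using R by (simp add: K_def)
  have a_pos: "a l > 0" for l using C by (simp add: a_def)
  have a_lim: "a \<longlonglongrightarrow> 0"
  proof -
    have "(2 ^ l) powr (- \<theta>) = (2 powr (- \<theta>)) ^ l" for l :: nat
      by (simp add: powr_realpow[symmetric] powr_powr mult.commute)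
    moreover have "(\<lambda>l. (2 powr (- \<theta>)) ^ l) \<longlonglongrightarrow> 0"
      using \<theta> by (intro LIMSEQ_power_zero) (simp add: powr_less_one)
    ultimately show ?thesis unfolding a_def by (auto intro!: tendsto_mult_right_zero)
  qed
  have a0: "a 0 = 2 * C" by (simp add: a_def)
  have "sum (\<lambda>s. real (cdim (V s)) * s powr q) T \<le> K / (1 - x)" if T: "finite T" "T \<subseteq> {0<..}" for T
  proof -
    define T' where "T' = {s\<in>T. s \<le> C}"
    have T': "finite T'" "\<And>s. s \<in> T' \<Longrightarrow> 0 < s" "\<And>s. s \<in> T' \<Longrightarrow> s \<le> C" using T by (auto simp: T'_def)
    define lev where "lev s = (LEAST l. a (Suc l) < s)" for s
    have lev: "a (Suc (lev s)) < s" "s \<le> a (lev s)" if "s \<in> T'" for s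
    proof -
      have "\<forall>\<^sub>F l in sequentially. a l < s"
        using a_lim T'(2)[OF that] by (rule order_tendstoD)
      then obtain N where "\<And>l. l \<ge> N \<Longrightarrow> a l < s" by (auto simp: eventually_sequentially)
      then have ex: "a (Suc N) < s" by simp
      show "a (Suc (lev s)) < s" unfolding lev_def by (rule LeastI[of "\<lambda>l. a (Suc l) < s", OF ex])
      show "s \<le> a (lev s)"
      proof (cases "lev s")
        case 0
        then show ?thesis using T'(3)[OF that] C a0 by simp
      next
        case (Suc l)
        then have "\<not> a (Suc l) < s" using not_less_Least[of l "\<lambda>l. a (Suc l) < s"] unfolding lev_def by simp
        then show ?thesis using Suc by simp
      qed
    qed
    define N where "N = Suc (Max (insert 0 (lev ` T')))"
    have N: "lev ` T' \<subseteq> {..<N}"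
      using T'(1) by (auto simp: N_def less_Suc_eq_le intro!: Max_ge)
    have "sum (\<lambda>s. real (cdim (V s)) * s powr q) T = sum (\<lambda>s. real (cdim (V s)) * s powr q) T'"
    proof (rule sum.mono_neutral_right)
      show "\<forall>i\<in>T - T'. real (cdim (V i)) * i powr q = 0"
        unfolding T'_def using cdim_V_zero by (simp add: not_le)
    qed (use T(1) in \<open>auto simp: T'_def\<close>)
    also have "\<dots> = (\<Sum>l<N. \<Sum>s\<in>{s\<in>T'. lev s = l}. real (cdim (V s)) * s powr q)"
      by (rule sum.group[symmetric]) (use T'(1) N in auto)
    also have "\<dots> \<le> (\<Sum>l<N. K * x ^ l)"
    proof (rule sum_mono)
      fix l
      have "(\<Sum>s\<in>{s\<in>T'. lev s = l}. real (cdim (V s)) * s powr q) \<le> (\<Sum>s\<in>{s\<in>T'. lev s = l}. real (cdim (V s)) * a l powr q)"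
        using T'(2) lev(2) q0 by (intro sum_mono mult_left_mono powr_mono2) (auto intro: less_imp_le)
      also have "\<dots> = real (\<Sum>s\<in>{s\<in>T'. lev s = l}. cdim (V s)) * a l powr q"
        by (simp add: sum_distrib_right)
      also have "\<dots> \<le> real (2 * card (L (2 ^ Suc l))) * a l powr q"
      proof (intro mult_right_mono of_nat_mono singular_count)
        show "s > 2 * C * real (2 ^ Suc l) powr (- \<theta>)" if "s \<in> {s\<in>T'. lev s = l}" for s
          using lev(1)[of s] that by (auto simp: a_def)
      qed (use T'(1) in auto)
      also have "\<dots> \<le> (2 * (R * real (2 ^ Suc l) ^ n)) * a l powr q"
        using L(2)[of "2 ^ Suc l"] by (intro mult_right_mono) auto
      also have "\<dots> = K * x ^ l"
      proof -
        have "a l powr q = (2 * C) powr q * (2 powr (- \<theta> * q)) ^ l"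
          using C by (simp add: a_def powr_mult powr_powr powr_realpow[symmetric] mult_ac)
        moreover have "real (2 ^ Suc l) ^ n = 2 ^ n * (2 ^ n) ^ l"
          by (simp add: power_mult_distrib power_mult[symmetric] mult.commute)
        moreover have "(2 ^ n) ^ l * (2 powr (- \<theta> * q)) ^ l = x ^ l"
        proof -
          have "(2::real) ^ n * 2 powr (- \<theta> * q) = x"
            unfolding x_def by (simp add: powr_realpow[symmetric] powr_add[symmetric] mult.commute)
          then show ?thesis by (simp flip: power_mult_distrib)
        qed
        ultimately show ?thesis unfolding K_def by (simp add: mult_ac)
      qed
      finally show "(\<Sum>s\<in>{s\<in>T'. lev s = l}. real (cdim (V s)) * s powr q) \<le> K * x ^ l" .
    qed
    also have "\<dots> = K * (\<Sum>l<N. x ^ l)" by (simp add: sum_distrib_left)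
    also have "\<dots> \<le> K * (1 / (1 - x))"
    proof (intro mult_left_mono K0)
      have "(\<Sum>l<N. x ^ l) \<le> suminf (\<lambda>l. x ^ l)"
        using x by (intro sum_le_suminf summable_geometric) auto
      then show "(\<Sum>l<N. x ^ l) \<le> 1 / (1 - x)" using x by (simp add: suminf_geometric)
    qed
    finally show ?thesis by simp
  qed
  then show ?thesis
    by (intro nonneg_bdd_above_summable_on bdd_aboveI2[where M = "K / (1 - x)"]) auto
qed

text \<open>The values of the functionals are sorted into squares of side \<open>\<epsilon>\<close>. Finitely many squares occur
  because the functionals are bounded on the unit ball, and one point is chosen for each
  occurring combination.\<close>

lemma finite_net:
  assumes "d \<ge> 1" "\<epsilon> > 0"
  obtains F where "finite F" "F \<subseteq> M \<inter> cball 0 1"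
    "\<And>x. x \<in> M \<inter> cball 0 1 \<Longrightarrow> \<exists>y\<in>F. \<forall>l\<in>L d. (cmod (cinner (x - y) (e d l)))\<^sup>2 \<le> 2 * \<epsilon>\<^sup>2"
proof -
  let ?X = "M \<inter> cball 0 1"
  define g where "g x = (\<lambda>l\<in>L d. (\<lfloor>Re (cinner x (e d l)) / \<epsilon>\<rfloor>, \<lfloor>Im (cinner x (e d l)) / \<epsilon>\<rfloor>))" for x
  define b where "b l = norm (e d l) / \<epsilon>" for l
  have bound: "\<bar>Re (cinner x (e d l))\<bar> / \<epsilon> \<le> b l" "\<bar>Im (cinner x (e d l))\<bar> / \<epsilon> \<le> b l" if "x \<in> ?X" for x l
  proof -
    have "cmod (cinner x (e d l)) \<le> norm x * norm (e d l)" by (rule cinner_Cauchy_Schwarz)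
    also have "\<dots> \<le> 1 * norm (e d l)" using that by (intro mult_right_mono) auto
    finally have "cmod (cinner x (e d l)) \<le> norm (e d l)" by simp
    then have "\<bar>Re (cinner x (e d l))\<bar> \<le> norm (e d l)" "\<bar>Im (cinner x (e d l))\<bar> \<le> norm (e d l)"
      using abs_Re_le_cmod abs_Im_le_cmod order_trans by blast+
    then show "\<bar>Re (cinner x (e d l))\<bar> / \<epsilon> \<le> b l" "\<bar>Im (cinner x (e d l))\<bar> / \<epsilon> \<le> b l"
      unfolding b_def using assms by (auto intro: divide_right_mono)
  qed
  have bound': "- b l \<le> Re (cinner x (e d l)) / \<epsilon>" "Re (cinner x (e d l)) / \<epsilon> \<le> b l"
    "- b l \<le> Im (cinner x (e d l)) / \<epsilon>" "Im (cinner x (e d l)) / \<epsilon> \<le> b l" if "x \<in> M" "norm x \<le> 1" for x l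
  proof -
    have "\<bar>Re (cinner x (e d l)) / \<epsilon>\<bar> \<le> b l" "\<bar>Im (cinner x (e d l)) / \<epsilon>\<bar> \<le> b l"
      using bound[of x l] that assms(2) by simp_all
    then show "- b l \<le> Re (cinner x (e d l)) / \<epsilon>" "Re (cinner x (e d l)) / \<epsilon> \<le> b l"
      "- b l \<le> Im (cinner x (e d l)) / \<epsilon>" "Im (cinner x (e d l)) / \<epsilon> \<le> b l"
      by (simp_all only: abs_le_iff) linarith+
  qed
  have "g ` ?X \<subseteq> (\<Pi>\<^sub>E l\<in>L d. {\<lfloor>- b l\<rfloor>..\<lfloor>b l\<rfloor>} \<times> {\<lfloor>- b l\<rfloor>..\<lfloor>b l\<rfloor>})"
    unfolding g_def using assms(2)
    by (auto intro!: floor_mono bound' simp: PiE_iff)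
  moreover have "finite (\<Pi>\<^sub>E l\<in>L d. {\<lfloor>- b l\<rfloor>..\<lfloor>b l\<rfloor>} \<times> {\<lfloor>- b l\<rfloor>..\<lfloor>b l\<rfloor>})"
    using L(1)[OF assms(1)] by (intro finite_PiE) auto
  ultimately have fin: "finite (g ` ?X)" by (rule finite_subset)
  show thesis
  proof (rule that)
    show "finite (inv_into ?X g ` (g ` ?X))" using fin by simp
    show "inv_into ?X g ` (g ` ?X) \<subseteq> ?X" by (intro image_subsetI inv_into_into)
    fix x assume x: "x \<in> ?X"
    define y where "y = inv_into ?X g (g x)"
    have gy: "g y = g x" unfolding y_def using x by (intro f_inv_into_f) auto
    have "(cmod (cinner (x - y) (e d l)))\<^sup>2 \<le> 2 * \<epsilon>\<^sup>2" if l: "l \<in> L d" for l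
    proof -
      have near: "\<bar>u - v\<bar> \<le> \<epsilon>" if "\<lfloor>u / \<epsilon>\<rfloor> = \<lfloor>v / \<epsilon>\<rfloor>" for u v
      proof -
        have "\<bar>u / \<epsilon> - v / \<epsilon>\<bar> \<le> 1" using that by linarith
        then show ?thesis using assms(2) by (simp add: diff_divide_distrib[symmetric] field_simps)
      qed
      have "g x l = g y l" using gy by simp
      then have "\<bar>Re (cinner (x - y) (e d l))\<bar> \<le> \<epsilon>" "\<bar>Im (cinner (x - y) (e d l))\<bar> \<le> \<epsilon>"
        using l by (auto simp: g_def cinner_diff_left intro!: near)
      then have "(Re (cinner (x - y) (e d l)))\<^sup>2 \<le> \<epsilon>\<^sup>2" "(Im (cinner (x - y) (e d l)))\<^sup>2 \<le> \<epsilon>\<^sup>2"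
        by (metis abs_ge_zero power2_abs power_mono)+
      then show ?thesis by (simp add: cmod_power2)
    qed
    then show "\<exists>y\<in>inv_into ?X g ` (g ` ?X). \<forall>l\<in>L d. (cmod (cinner (x - y) (e d l)))\<^sup>2 \<le> 2 * \<epsilon>\<^sup>2"
      using x y_def by blast
  qed
qed

text \<open>Total boundedness: on the unit ball of \<open>M\<close> the quantity \<open>W\<close> controls \<open>A\<close>, and up to an
  arbitrarily small multiple of the norm it is controlled by finitely many functionals.\<close>

lemma compact_image: "compact (closure (A ` (M \<inter> cball 0 1)))"
  unfolding compact_eq_totally_bounded
proof (intro conjI allI impI)
  let ?X = "M \<inter> cball 0 1"
  have "closed M" using M(2) by (rule complete_imp_closed)
  then have "closure (A ` ?X) \<subseteq> M" by (intro closure_minimal) (use AM in auto)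
  then have "closure (A ` ?X) = M \<inter> closure (A ` ?X)" by blast
  then show "complete (closure (A ` ?X))"
    using complete_Int_closed[OF M(2) closed_closure[of "A ` ?X"]] by simp
  fix r :: real assume r: "r > 0"
  define \<delta> where "\<delta> = (r / (4 * C))\<^sup>2"
  have \<delta>: "\<delta> > 0" using r C by (simp add: \<delta>_def)
  have lim: "((\<lambda>d. 8 * real d powr (- \<theta>)) \<longlongrightarrow> 0) sequentially"
    using \<theta> by (auto intro!: tendsto_mult_right_zero tendsto_neg_powr filterlim_real_sequentially)
  have "\<forall>\<^sub>F d in sequentially. 8 * real d powr (- \<theta>) < \<delta> / 2 \<and> d \<ge> 1"
    using \<delta> by (intro eventually_conj order_tendstoD(2)[OF lim] eventually_ge_at_top) auto
  then obtain d where d: "d \<ge> 1" "8 * real d powr (- \<theta>) < \<delta> / 2"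
    by (auto simp: eventually_sequentially)
  define \<epsilon> where "\<epsilon> = sqrt (\<delta> / (4 * (real (card (L d)) + 1)))"
  have \<epsilon>: "\<epsilon> > 0" "2 * \<epsilon>\<^sup>2 = \<delta> / (2 * (real (card (L d)) + 1))"
    using \<delta> by (auto simp: \<epsilon>_def field_simps)
  obtain F where F: "finite F" "F \<subseteq> ?X"
    "\<And>x. x \<in> ?X \<Longrightarrow> \<exists>y\<in>F. \<forall>l\<in>L d. (cmod (cinner (x - y) (e d l)))\<^sup>2 \<le> 2 * \<epsilon>\<^sup>2"
    using finite_net[OF d(1) \<epsilon>(1)] by blast
  have cover: "\<exists>y\<in>F. dist (A x) (A y) \<le> r / 4" if x: "x \<in> ?X" for x
  proof -
    obtain y where y: "y \<in> F" "\<And>l. l \<in> L d \<Longrightarrow> (cmod (cinner (x - y) (e d l)))\<^sup>2 \<le> 2 * \<epsilon>\<^sup>2"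
      using F(3)[OF x] by blast
    have xy: "x \<in> M" "y \<in> M" "norm x \<le> 1" "norm y \<le> 1" using x y(1) F(2) by auto
    have "norm (x - y) \<le> 2" using norm_triangle_ineq4[of x y] xy by linarith
    then have "(norm (x - y))\<^sup>2 \<le> 2\<^sup>2" by (intro power_mono) auto
    then have "2 * real d powr (- \<theta>) * (norm (x - y))\<^sup>2 \<le> 2 * real d powr (- \<theta>) * 2\<^sup>2" by (intro mult_left_mono) auto
    then have 1: "2 * real d powr (- \<theta>) * (norm (x - y))\<^sup>2 \<le> \<delta> / 2" using d(2) by simp
    have "(\<Sum>l\<in>L d. (cmod (cinner (x - y) (e d l)))\<^sup>2) \<le> (\<Sum>l\<in>L d. 2 * \<epsilon>\<^sup>2)" by (intro sum_mono y)
    also have "\<dots> = real (card (L d)) * (\<delta> / (2 * (real (card (L d)) + 1)))" by (simp add: \<epsilon>(2))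
    also have "\<dots> \<le> \<delta> / 2" using \<delta> by (simp add: field_simps)
    finally have "W (x - y) \<le> \<delta>" using tail[OF d(1), of "x - y"] sub(5)[OF xy(1,2)] 1 by linarith
    then have "sqrt (W (x - y)) \<le> r / (4 * C)"
      using r C W0 by (intro real_le_lsqrt) (auto simp: \<delta>_def)
    then have "C * sqrt (W (x - y)) \<le> C * (r / (4 * C))" using C by (intro mult_left_mono) auto
    then have "norm (A (x - y)) \<le> r / 4" using norm_A_le_W[OF sub(5)[OF xy(1,2)]] C by simp
    then show ?thesis using y(1) by (auto simp: dist_norm A_diff[OF xy(1,2)])
  qed
  show "\<exists>k. finite k \<and> closure (A ` ?X) \<subseteq> (\<Union>x\<in>k. ball x r)"
  proof (intro exI[of _ "A ` F"] conjI subsetI)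
    fix z assume "z \<in> closure (A ` ?X)"
    then obtain x where x: "x \<in> ?X" "dist (A x) z < r / 4"
      using r unfolding closure_approachable by (metis imageE zero_less_divide_iff zero_less_numeral)
    obtain y where "y \<in> F" "dist (A x) (A y) \<le> r / 4" using cover[OF x(1)] by blast
    then have "dist (A y) z < r" using x(2) dist_triangle[of "A y" z "A x"] r by (simp add: dist_commute)
    then show "z \<in> (\<Union>x\<in>A ` F. ball x r)" using \<open>y \<in> F\<close> by auto
  qed (use F in auto)
qed

theorem in_schatten_class:
  assumes "real n < q * \<theta>"
  shows "A \<in> schatten_class q M"
  unfolding schatten_class_def compact_operator_on_def
  using AM A_add A_scale compact_image singular_summable[OF assms] by auto

end

section \<open>Evaluation bounds for polynomials in the Bergman norm\<close>

lemma nn_integral_ball_measure: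
  fixes f :: "complex ^ 'n \<Rightarrow> ennreal"
  assumes [measurable]: "f \<in> borel_measurable borel"
  shows "(\<integral>\<^sup>+z. f z \<partial>ball_measure) * emeasure lborel (ball (0 :: complex ^ 'n) 1)
    = (\<integral>\<^sup>+z. f z * indicator (ball 0 1) z \<partial>lborel)"
proof -
  have e: "(\<integral>\<^sup>+z. f z \<partial>ball_measure) = (\<integral>\<^sup>+z. f z * indicator (ball 0 1) z \<partial>lborel) / emeasure lborel (ball (0 :: complex ^ 'n) 1)"
    unfolding ball_measure_def by (rule nn_integral_uniform_measure) auto
  have "a / v * v = a" if "v \<noteq> 0" "v \<noteq> top" for a v :: ennreal
  proof -
    have "a / v * v = v * (a / v)" by (rule mult.commute)
    also have "\<dots> = a * v / v" by (simp add: ennreal_times_divide mult.commute)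
    also have "\<dots> = a" using that by (rule mult_divide_eq_ennreal)
    finally show ?thesis .
  qed
  from this[OF emeasure_unit_ball_pos]
  show ?thesis unfolding e .
qed

lemma Rep_bergman_measurable [measurable]: "Rep_bergman f \<in> borel_measurable borel"
  by (rule bergman_set_measurable[OF Rep_bergman])

lemma norm_bergman_integral: "(norm f)\<^sup>2 = (\<integral>z. (cmod (Rep_bergman f z))\<^sup>2 \<partial>ball_measure)"
proof -
  have "cinner f f = (\<integral>z. complex_of_real ((cmod (Rep_bergman f z))\<^sup>2) \<partial>ball_measure)"
    unfolding cinner_bergman.rep_eq by (simp only: complex_norm_square)
  also have "\<dots> = complex_of_real (\<integral>z. (cmod (Rep_bergman f z))\<^sup>2 \<partial>ball_measure)"
    by (rule integral_complex_of_real)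
  finally show ?thesis unfolding cinner_self of_real_eq_iff .
qed

lemma norm_bergman_nn_integral:
  "ennreal ((norm f)\<^sup>2) = (\<integral>\<^sup>+z. ennreal ((cmod (Rep_bergman f z))\<^sup>2) \<partial>ball_measure)"
  unfolding norm_bergman_integral
  by (rule nn_integral_eq_integral[symmetric, OF bergman_setD(2)[OF Rep_bergman]]) simp

lemma Rep_bergman_diff: "Rep_bergman (f - g) z = Rep_bergman f z - Rep_bergman g z"
  unfolding minus_bergman_def plus_bergman.rep_eq uminus_bergman.rep_eq by simp

lemma Rep_bergman_eqI: "(\<And>z. Rep_bergman f z = Rep_bergman g z) \<Longrightarrow> f = g"
  using Rep_bergman_inject[of f g] by blast

lemma Rep_bergman_outside: "z \<notin> ball 0 1 \<Longrightarrow> Rep_bergman f z = 0"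
  by (rule bergman_setD(3)[OF Rep_bergman])

lemma bergman_of_poly_diff: "bergman_of_poly (p - q) = bergman_of_poly p - bergman_of_poly q"
  by (rule Rep_bergman_eqI) (simp add: Rep_bergman_diff bergman_of_poly.rep_eq poly_eval_diff)

lemma bergman_of_poly_add: "bergman_of_poly (p + q) = bergman_of_poly p + bergman_of_poly q"
  by (rule Rep_bergman_eqI) (simp add: plus_bergman.rep_eq bergman_of_poly.rep_eq poly_eval_add)

lemma norm_bergman_of_poly_lborel:
  fixes f :: "'n::finite cpoly"
  shows "ennreal ((norm (bergman_of_poly f))\<^sup>2) * emeasure lborel (ball (0 :: complex ^ 'n) 1)
    = (\<integral>\<^sup>+z. ennreal ((cmod (poly_eval f z))\<^sup>2) * indicator (ball 0 1) z \<partial>lborel)"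
proof -
  have "ennreal ((norm (bergman_of_poly f))\<^sup>2) * emeasure lborel (ball (0 :: complex ^ 'n) 1)
    = (\<integral>\<^sup>+z. ennreal ((cmod (Rep_bergman (bergman_of_poly f) z))\<^sup>2) * indicator (ball 0 1) z \<partial>lborel)"
    unfolding norm_bergman_nn_integral by (rule nn_integral_ball_measure) measurable
  also have "\<dots> = (\<integral>\<^sup>+z. ennreal ((cmod (poly_eval f z))\<^sup>2) * indicator (ball 0 1) z \<partial>lborel)"
    by (intro nn_integral_cong) (auto simp: bergman_of_poly.rep_eq indicator_def)
  finally show ?thesis .
qed

lemma linear_unity_root: "linear (\<lambda>v :: complex ^ 'n. unity_root K i *s v)"
  by (rule linearI) (simp_all add: vec_eq_iff scaleR_conv_of_real[where 'a = complex] algebra_simps)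

lemma norm_smult_unit: "cmod c = 1 \<Longrightarrow> norm (c *s v) = norm (v :: complex ^ 'n)"
  by (simp add: norm_vec_def norm_mult)

lemma line_coeff_sq_le_unity_mean:
  assumes "l \<le> 1"
  obtains K where "K > 0" "\<And>z v. (cmod (coeff (line_poly f z v) l))\<^sup>2 \<le> (\<Sum>i<K. (cmod (poly_eval f (z + unity_root K i *s v)))\<^sup>2) / real K"
proof (rule that)
  let ?K = "total_degree f + 2"
  show "?K > 0" by simp
  fix z v
  have "degree (line_poly f z v) < ?K" using degree_line_poly[of f z v] by simp
  then show "(cmod (coeff (line_poly f z v) l))\<^sup>2 \<le> (\<Sum>i<?K. (cmod (poly_eval f (z + unity_root ?K i *s v)))\<^sup>2) / real ?K"
    using coeff_le_circle_mean[of "line_poly f z v" ?K l 1] assms by (simp add: poly_line_poly)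
qed

text \<open>The mean value property on the ball of radius \<open>\<delta>\<close> around \<open>z\<close>, with the rotations \<open>v \<mapsto> c v\<close>
  by roots of unity in place of all rotations by unimodular numbers; each of them preserves
  Lebesgue measure.\<close>

lemma point_evaluation_bound:
  fixes f :: "'n::finite cpoly"
  assumes \<delta>: "\<delta> > 0" and z: "norm z + \<delta> \<le> 1"
  shows "cmod (poly_eval f z) * \<delta> ^ CARD('n) \<le> norm (bergman_of_poly f)"
proof -
  let ?v = "emeasure lborel (ball (0 :: complex ^ 'n) 1)"
  let ?h = "\<lambda>u. ennreal ((cmod (poly_eval f u))\<^sup>2)"
  obtain K where K: "K > 0"
    "\<And>z v. (cmod (coeff (line_poly f z v) 0))\<^sup>2 \<le> (\<Sum>i<K. (cmod (poly_eval f (z + unity_root K i *s v)))\<^sup>2) / real K"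
    using line_coeff_sq_le_unity_mean[of 0] by auto
  define I where "I = (indicator (ball 0 \<delta>) :: complex ^ 'n \<Rightarrow> ennreal)"
  have [measurable]: "I \<in> borel_measurable borel"
    unfolding I_def by (rule borel_measurable_indicator) simp
  have [measurable]: "(\<lambda>v. z + unity_root K i *s v) \<in> borel_measurable borel" for i
    by (intro borel_measurable_continuous_onI continuous_on_add continuous_on_const
        linear_continuous_on linear_linear[THEN iffD2] linear_unity_root)
  have "?h z * emeasure lborel (ball (0 :: complex ^ 'n) \<delta>) = (\<integral>\<^sup>+v. ?h z * I v \<partial>lborel)"
    unfolding I_def by (rule nn_integral_cmult_indicator[symmetric]) simp
  also have "\<dots> \<le> (\<integral>\<^sup>+v. (\<Sum>i<K. ennreal (1 / real K) * (?h (z + unity_root K i *s v) * I v)) \<partial>lborel)"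
  proof (rule nn_integral_mono)
    fix v :: "complex ^ 'n"
    have "?h z \<le> ennreal ((\<Sum>i<K. (cmod (poly_eval f (z + unity_root K i *s v)))\<^sup>2) / real K)"
      using K(2)[of z v] by (intro ennreal_leI) (simp add: coeff_0_line_poly)
    also have "\<dots> = ennreal (\<Sum>i<K. 1 / real K * (cmod (poly_eval f (z + unity_root K i *s v)))\<^sup>2)"
      by (simp add: sum_divide_distrib)
    also have "\<dots> = (\<Sum>i<K. ennreal (1 / real K) * ?h (z + unity_root K i *s v))"
      by (subst sum_ennreal[symmetric]) (auto simp: ennreal_mult[symmetric])
    finally have "?h z * I v \<le> (\<Sum>i<K. ennreal (1 / real K) * ?h (z + unity_root K i *s v)) * I v"
      by (rule mult_right_mono) simp
    then show "?h z * I v \<le> (\<Sum>i<K. ennreal (1 / real K) * (?h (z + unity_root K i *s v) * I v))"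
      by (simp add: sum_distrib_right mult.assoc)
  qed
  also have "\<dots> = (\<Sum>i<K. ennreal (1 / real K) * (\<integral>\<^sup>+v. ?h (z + unity_root K i *s v) * I v \<partial>lborel))"
    by (simp add: nn_integral_sum nn_integral_cmult)
  also have "\<dots> \<le> (\<Sum>i<K. ennreal (1 / real K) * (\<integral>\<^sup>+u. ?h u * indicator (ball 0 1) u \<partial>lborel))"
  proof (intro sum_mono mult_left_mono)
    fix i
    define \<Phi> where "\<Phi> u = ?h u * indicator (ball 0 1) u" for u
    have [measurable]: "\<Phi> \<in> borel_measurable borel"
      unfolding \<Phi>_def by (intro borel_measurable_times_ennreal borel_measurable_indicator) auto
    have "(\<integral>\<^sup>+v. ?h (z + unity_root K i *s v) * I v \<partial>lborel) \<le> (\<integral>\<^sup>+v. \<Phi> (unity_root K i *s v + z) \<partial>lborel)"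
    proof (rule nn_integral_mono)
      fix v :: "complex ^ 'n"
      have "z + unity_root K i *s v \<in> ball 0 1" if "norm v < \<delta>"
        using norm_triangle_ineq[of z "unity_root K i *s v"] norm_smult_unit[of "unity_root K i" v] that z by simp
      then show "?h (z + unity_root K i *s v) * I v \<le> \<Phi> (unity_root K i *s v + z)"
        by (auto simp: \<Phi>_def I_def indicator_def add.commute)
    qed
    also have "\<dots> \<le> ennreal (1 ^ DIM(complex ^ 'n)) * (\<integral>\<^sup>+u. \<Phi> u \<partial>lborel)"
      by (rule nn_integral_linear_le) (auto simp: linear_unity_root norm_smult_unit)
    finally show "(\<integral>\<^sup>+v. ?h (z + unity_root K i *s v) * I v \<partial>lborel) \<le> (\<integral>\<^sup>+u. ?h u * indicator (ball 0 1) u \<partial>lborel)"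
      by (simp add: \<Phi>_def)
  qed simp
  also have "\<dots> = (\<integral>\<^sup>+u. ?h u * indicator (ball 0 1) u \<partial>lborel)"
  proof -
    have "(\<Sum>i<K. ennreal (1 / real K)) = 1"
      using K(1) by (subst sum_ennreal) auto
    then show ?thesis by (simp only: sum_distrib_right[symmetric] mult_1_left)
  qed
  also have "\<dots> = ennreal ((norm (bergman_of_poly f))\<^sup>2) * ?v"
    by (rule norm_bergman_of_poly_lborel[symmetric])
  also have "emeasure lborel (ball (0 :: complex ^ 'n) \<delta>) = ennreal (\<delta> ^ (2 * CARD('n))) * ?v"
    using \<delta> unit_ball_vol_nonneg[of "real DIM(complex ^ 'n)"]
    by (simp add: emeasure_ball mult.commute flip: ennreal_mult)
  finally have "(?h z * ennreal (\<delta> ^ (2 * CARD('n)))) * ?v \<le> ennreal ((norm (bergman_of_poly f))\<^sup>2) * ?v"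
    by (simp only: mult.assoc)
  then have "?h z * ennreal (\<delta> ^ (2 * CARD('n))) \<le> ennreal ((norm (bergman_of_poly f))\<^sup>2)"
    using emeasure_unit_ball_pos[where 'a = "complex ^ 'n"]
      ennreal_mult_le_mult_iff[of ?v] by (simp only: mult.commute[of _ ?v]) simp
  then have "(cmod (poly_eval f z))\<^sup>2 * \<delta> ^ (2 * CARD('n)) \<le> (norm (bergman_of_poly f))\<^sup>2"
    using \<delta> by (simp add: ennreal_mult[symmetric])
  then have "(cmod (poly_eval f z) * \<delta> ^ CARD('n))\<^sup>2 \<le> (norm (bergman_of_poly f))\<^sup>2"
    by (simp add: power_mult_distrib power_mult[symmetric] mult.commute)
  then show ?thesis by (rule power2_le_imp_le) simp
qed

lemma dir_deriv_scale: "poly_eval (dir_deriv (c *s x) f) z = c * poly_eval (dir_deriv x f) z"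
  by (simp add: poly_eval_dir_deriv sum_distrib_left mult.assoc)

lemma dir_deriv_diff: "poly_eval (dir_deriv x (p - q)) z = poly_eval (dir_deriv x p) z - poly_eval (dir_deriv x q) z"
proof -
  have *: "line_poly (p - q) z x = line_poly p z x - line_poly q z x"
    by (rule poly_eq_poly_eq_iff[THEN iffD1], rule ext) (simp add: poly_line_poly poly_eval_diff)
  show ?thesis
    using arg_cong[OF *, of "\<lambda>p. coeff p 1"] by (simp only: coeff_diff coeff_1_line_poly)
qed

text \<open>Cauchy's estimate on a circle of radius \<open>\<delta>\<close>, on which the bound for values applies.\<close>

lemma derivative_evaluation_bound:
  fixes f :: "'n::finite cpoly"
  assumes \<delta>: "\<delta> > 0" and z: "norm z + 2 * \<delta> \<le> 1"
  shows "cmod (poly_eval (dir_deriv v f) z) * \<delta> ^ (CARD('n) + 1) \<le> norm v * norm (bergman_of_poly f)"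
proof (cases "v = 0")
  case True
  then show ?thesis by (simp add: poly_eval_dir_deriv)
next
  case False
  define w where "w = of_real (\<delta> / norm v) *s v"
  have nw: "norm w \<le> \<delta>"
    unfolding w_def norm_smult_vec using False \<delta> by (simp add: norm_divide)
  obtain K where K: "K > 0"
    "\<And>z v. (cmod (coeff (line_poly f z v) 1))\<^sup>2 \<le> (\<Sum>i<K. (cmod (poly_eval f (z + unity_root K i *s v)))\<^sup>2) / real K"
    using line_coeff_sq_le_unity_mean[of 1] by auto
  have "(cmod (poly_eval (dir_deriv w f) z))\<^sup>2 \<le> (\<Sum>i<K. (cmod (poly_eval f (z + unity_root K i *s w)))\<^sup>2) / real K"
    using K(2)[of z w] by (simp only: coeff_1_line_poly)
  also have "\<dots> \<le> (\<Sum>i<K. (norm (bergman_of_poly f) / \<delta> ^ CARD('n))\<^sup>2) / real K"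
  proof (intro divide_right_mono sum_mono power_mono)
    fix i
    have "norm (z + unity_root K i *s w) + \<delta> \<le> 1"
      using norm_triangle_ineq[of z "unity_root K i *s w"] norm_smult_unit[of "unity_root K i" w] nw z by simp
    from point_evaluation_bound[OF \<delta> this, of f]
    show "cmod (poly_eval f (z + unity_root K i *s w)) \<le> norm (bergman_of_poly f) / \<delta> ^ CARD('n)"
      using \<delta> by (simp add: field_simps)
  qed auto
  also have "\<dots> = (norm (bergman_of_poly f) / \<delta> ^ CARD('n))\<^sup>2" using K(1) by simp
  finally have "cmod (poly_eval (dir_deriv w f) z) \<le> norm (bergman_of_poly f) / \<delta> ^ CARD('n)"
    by (rule power2_le_imp_le) (use \<delta> in simp)
  moreover have "cmod (poly_eval (dir_deriv w f) z) = \<delta> / norm v * cmod (poly_eval (dir_deriv v f) z)"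
    using \<delta> by (simp add: w_def dir_deriv_scale norm_mult norm_divide)
  ultimately show ?thesis using \<delta> False by (simp add: field_simps)
qed

lemma poly_eval_has_derivative:
  fixes f :: "'n::finite cpoly"
  shows "(poly_eval f has_derivative (\<lambda>v. poly_eval (dir_deriv v f) z)) (at z)"
proof -
  obtain D where D: "(poly_eval f has_derivative D) (at z)"
    using holomorphic_on_vec_poly_eval[of f UNIV] unfolding holomorphic_on_vec_def by blast
  have "D v = poly_eval (dir_deriv v f) z" for v
  proof -
    have "((\<lambda>t::real. z + t *\<^sub>R v) has_derivative (\<lambda>t. t *\<^sub>R v)) (at 0)"
      by (auto intro!: derivative_eq_intros)
    from has_derivative_compose[OF this, of "poly_eval f" D] D
    have 1: "((\<lambda>t::real. poly_eval f (z + t *\<^sub>R v)) has_derivative (\<lambda>t. D (t *\<^sub>R v))) (at 0)"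
      by simp
    have "((\<lambda>t. poly (line_poly f z v) t) has_field_derivative poly (pderiv (line_poly f z v)) (of_real 0)) (at (of_real 0))"
      by (rule poly_DERIV)
    from has_vector_derivative_real_field[OF this]
    have "((\<lambda>t::real. poly (line_poly f z v) (of_real t)) has_vector_derivative poly (pderiv (line_poly f z v)) 0) (at 0)"
      by (simp add: o_def)
    moreover have "poly (pderiv (line_poly f z v)) 0 = poly_eval (dir_deriv v f) z"
      using coeff_1_line_poly[of f z v] by (simp add: poly_0_coeff_0 coeff_pderiv)
    moreover have "of_real t *s v = t *\<^sub>R v" for t
      by (simp add: vec_eq_iff scaleR_conv_of_real[where 'a = complex])
    then have "poly (line_poly f z v) (of_real t) = poly_eval f (z + t *\<^sub>R v)" for t
      by (simp add: poly_line_poly)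
    ultimately have 2: "((\<lambda>t::real. poly_eval f (z + t *\<^sub>R v)) has_derivative (\<lambda>t. t *\<^sub>R poly_eval (dir_deriv v f) z)) (at 0)"
      by (simp add: has_vector_derivative_def)
    have "D (1 *\<^sub>R v) = 1 *\<^sub>R poly_eval (dir_deriv v f) z"
      using has_derivative_unique[OF 1 2] by (rule fun_cong)
    then show ?thesis by simp
  qed
  then have "D = (\<lambda>v. poly_eval (dir_deriv v f) z)" by blast
  then show ?thesis using D by simp
qed

section \<open>Completeness of the generated submodule\<close>

text \<open>Stated for sequences that satisfy the bound eventually, as it is applied both to a Cauchy
  sequence and to its differences from a fixed member.\<close>

lemma fatou_square:
  fixes h :: "'a \<Rightarrow> complex"
  assumes [measurable]: "\<And>k. hk k \<in> borel_measurable M"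
    and lim: "\<And>z. (\<lambda>k. hk k z) \<longlonglongrightarrow> h z"
    and le: "\<And>k. k \<ge> N \<Longrightarrow> (\<integral>\<^sup>+z. ennreal ((cmod (hk k z))\<^sup>2) \<partial>M) \<le> c"
  shows "(\<integral>\<^sup>+z. ennreal ((cmod (h z))\<^sup>2) \<partial>M) \<le> c"
proof -
  have "liminf (\<lambda>k. ennreal ((cmod (hk k z))\<^sup>2)) = ennreal ((cmod (h z))\<^sup>2)" for z
    by (intro lim_imp_Liminf tendsto_ennrealI tendsto_intros lim) simp
  then have "(\<integral>\<^sup>+z. ennreal ((cmod (h z))\<^sup>2) \<partial>M) = (\<integral>\<^sup>+z. liminf (\<lambda>k. ennreal ((cmod (hk k z))\<^sup>2)) \<partial>M)"
    by simp
  also have "\<dots> \<le> liminf (\<lambda>k. \<integral>\<^sup>+z. ennreal ((cmod (hk k z))\<^sup>2) \<partial>M)"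
    by (rule nn_integral_liminf) measurable
  also have "\<dots> \<le> liminf (\<lambda>k. c)"
    by (rule Liminf_mono) (use le in \<open>auto simp: eventually_sequentially\<close>)
  also have "\<dots> = c" by (simp add: Liminf_const)
  finally show ?thesis .
qed

lemma Cauchy_of_dominated:
  fixes x :: "nat \<Rightarrow> 'a::real_normed_vector" and y :: "nat \<Rightarrow> complex"
  assumes "Cauchy x" "c > 0" "\<And>k l. cmod (y k - y l) * c \<le> norm (x k - x l) * K"
  shows "Cauchy y"
proof (rule metric_CauchyI)
  fix e :: real assume e: "e > 0"
  have "e * c / (\<bar>K\<bar> + 1) > 0" using e assms(2) by simp
  then obtain N where N: "\<And>m n. m \<ge> N \<Longrightarrow> n \<ge> N \<Longrightarrow> dist (x m) (x n) < e * c / (\<bar>K\<bar> + 1)"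
    using metric_CauchyD[OF assms(1)] by blast
  show "\<exists>N. \<forall>m\<ge>N. \<forall>n\<ge>N. dist (y m) (y n) < e"
  proof (intro exI[of _ N] allI impI)
    fix m n assume mn: "m \<ge> N" "n \<ge> N"
    have "cmod (y m - y n) * c \<le> norm (x m - x n) * (\<bar>K\<bar> + 1)"
      by (rule order_trans[OF assms(3)]) (intro mult_left_mono, auto)
    also have "\<dots> < e * c / (\<bar>K\<bar> + 1) * (\<bar>K\<bar> + 1)"
      using N[OF mn] by (intro mult_strict_right_mono) (auto simp: dist_norm)
    also have "\<dots> = e * c"
    proof -
      have "\<bar>K\<bar> + 1 \<noteq> 0" using abs_ge_zero[of K] by linarith
      then show ?thesis by simp
    qed
    finally show "dist (y m) (y n) < e" using assms(2) by (simp add: dist_norm)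
  qed
qed

text \<open>Point and derivative evaluations are continuous for the norm, locally uniformly in the ball.
  So the pointwise limit has a complex linear derivative, and Fatou's lemma gives its square
  integrability as well as convergence in norm.\<close>

lemma poly_sequence_converges:
  fixes f :: "nat \<Rightarrow> 'n::finite cpoly"
  assumes C: "Cauchy (\<lambda>k. bergman_of_poly (f k))"
  shows "\<exists>U. (\<lambda>k. bergman_of_poly (f k)) \<longlonglongrightarrow> U"
proof -
  let ?u = "\<lambda>k. bergman_of_poly (f k)"
  define g where "g z = lim (\<lambda>k. poly_eval (f k) z)" for z
  define G where "G z h = lim (\<lambda>k. poly_eval (dir_deriv h (f k)) z)" for z h
  define \<delta> where "\<delta> z = (1 - norm z) / 3" for z :: "complex ^ 'n"
  have \<delta>: "\<delta> z > 0" "norm z + 2 * \<delta> z \<le> 1" "norm z < 1 - 2 * \<delta> z" if "z \<in> ball 0 1" for z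
    using that by (auto simp: \<delta>_def field_simps)
  have lim_g: "(\<lambda>k. poly_eval (f k) z) \<longlonglongrightarrow> g z" if z: "z \<in> ball 0 1" for z
  proof -
    have "Cauchy (\<lambda>k. poly_eval (f k) z)"
    proof (rule Cauchy_of_dominated[OF C, of "\<delta> z ^ CARD('n)" _ 1])
      show "cmod (poly_eval (f k) z - poly_eval (f l) z) * \<delta> z ^ CARD('n) \<le> norm (?u k - ?u l) * 1" for k l
        using point_evaluation_bound[OF \<delta>(1)[OF z], of z "f k - f l"] \<delta>[OF z]
        by (simp add: poly_eval_diff bergman_of_poly_diff)
    qed (use \<delta>[OF z] in simp)
    then show ?thesis unfolding g_def by (simp add: Cauchy_convergent convergent_LIMSEQ_iff[symmetric])
  qed
  have dbound: "cmod (poly_eval (dir_deriv h (f k)) x - poly_eval (dir_deriv h (f l)) x) * d ^ (CARD('n) + 1) \<le> norm (?u k - ?u l) * norm h"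
    if "d > 0" "norm x + 2 * d \<le> 1" for d x h k l
    using derivative_evaluation_bound[OF that, of h "f k - f l"]
    by (simp add: dir_deriv_diff bergman_of_poly_diff mult.commute)
  have lim_G: "(\<lambda>k. poly_eval (dir_deriv h (f k)) z) \<longlonglongrightarrow> G z h" if z: "z \<in> ball 0 1" for z h
  proof -
    have "Cauchy (\<lambda>k. poly_eval (dir_deriv h (f k)) z)"
      by (rule Cauchy_of_dominated[OF C _ dbound[OF \<delta>(1,2)[OF z]]]) (use \<delta>[OF z] in simp)
    then show ?thesis unfolding G_def by (simp add: Cauchy_convergent convergent_LIMSEQ_iff[symmetric])
  qed
  have der: "(g has_derivative G z) (at z)" if z: "z \<in> ball 0 1" for z
  proof -
    let ?d = "\<delta> z"
    let ?S = "ball 0 (1 - 2 * ?d)"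
    have S: "z \<in> ?S" "?S \<subseteq> ball 0 1" using \<delta>[OF z] by auto
    have "\<exists>g'. \<forall>x\<in>?S. (\<lambda>k. poly_eval (f k) x) \<longlonglongrightarrow> g' x \<and> (g' has_derivative G x) (at x within ?S)"
    proof (rule has_derivative_sequence[where ?x0.0 = z and f' = "\<lambda>k x h. poly_eval (dir_deriv h (f k)) x"])
      show "(poly_eval (f k) has_derivative (\<lambda>h. poly_eval (dir_deriv h (f k)) x)) (at x within ?S)" for k x
        by (rule has_derivative_at_withinI[OF poly_eval_has_derivative])
      fix e :: real assume e: "e > 0"
      let ?D = "?d ^ (CARD('n) + 1)"
      have D: "?D > 0" using \<delta>(1)[OF z] by simp
      then have "e * ?D > 0" using e by simp
      then obtain N where N: "\<And>m n. m \<ge> N \<Longrightarrow> n \<ge> N \<Longrightarrow> dist (?u m) (?u n) < e * ?D"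
        using metric_CauchyD[OF C] by blast
      have "cmod (poly_eval (dir_deriv h (f k)) x - G x h) \<le> e * norm h" if k: "k \<ge> N" and x: "x \<in> ?S" for k x h
      proof (rule Lim_bounded)
        show "(\<lambda>l. cmod (poly_eval (dir_deriv h (f k)) x - poly_eval (dir_deriv h (f l)) x)) \<longlonglongrightarrow> cmod (poly_eval (dir_deriv h (f k)) x - G x h)"
          by (intro tendsto_norm tendsto_diff tendsto_const lim_G subsetD[OF S(2) x])
        show "\<forall>l\<ge>N. cmod (poly_eval (dir_deriv h (f k)) x - poly_eval (dir_deriv h (f l)) x) \<le> e * norm h"
        proof (intro allI impI)
          fix l assume l: "l \<ge> N"
          have "norm x + 2 * ?d \<le> 1" using x by simp
          from dbound[OF \<delta>(1)[OF z] this, of h k l]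
          have "cmod (poly_eval (dir_deriv h (f k)) x - poly_eval (dir_deriv h (f l)) x) * ?D \<le> norm (?u k - ?u l) * norm h" .
          also have "\<dots> \<le> (e * ?D) * norm h"
            using N[OF k l] by (intro mult_right_mono) (auto simp: dist_norm)
          finally have "cmod (poly_eval (dir_deriv h (f k)) x - poly_eval (dir_deriv h (f l)) x) * ?D \<le> (e * norm h) * ?D"
            by (simp add: mult_ac)
          then show "cmod (poly_eval (dir_deriv h (f k)) x - poly_eval (dir_deriv h (f l)) x) \<le> e * norm h"
            using D by (rule mult_right_le_imp_le)
        qed
      qed
      then show "\<forall>\<^sub>F k in sequentially. \<forall>x\<in>?S. \<forall>h. cmod (poly_eval (dir_deriv h (f k)) x - G x h) \<le> e * norm h"
        unfolding eventually_sequentially by blast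
    qed (use S lim_g[OF z] in auto)
    then obtain g' where g': "\<And>x. x \<in> ?S \<Longrightarrow> (\<lambda>k. poly_eval (f k) x) \<longlonglongrightarrow> g' x"
      "\<And>x. x \<in> ?S \<Longrightarrow> (g' has_derivative G x) (at x within ?S)" by blast
    have eq: "g' x = g x" if "x \<in> ?S" for x
      using LIMSEQ_unique[OF g'(1)[OF that] lim_g] that S(2) by blast
    have "(g' has_derivative G z) (at z)"
      using g'(2)[OF S(1)] at_within_open[OF S(1)] by simp
    then show ?thesis
      by (rule has_derivative_transform_within_open[OF _ open_ball S(1) eq])
  qed
  have clin: "G z (c *s h) = c * G z h" if z: "z \<in> ball 0 1" for z c h
  proof (rule LIMSEQ_unique[OF lim_G[OF z]])
    show "(\<lambda>k. poly_eval (dir_deriv (c *s h) (f k)) z) \<longlonglongrightarrow> c * G z h"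
      unfolding dir_deriv_scale by (intro tendsto_intros lim_G z)
  qed
  define F where "F z = (if z \<in> ball 0 1 then g z else 0)" for z
  have holg: "holomorphic_on_vec g (ball 0 1)"
    unfolding holomorphic_on_vec_def using der clin by blast
  have hol: "holomorphic_on_vec F (ball 0 1)"
    by (rule holomorphic_on_vec_cong[OF holg]) (auto simp: F_def)
  have limF: "(\<lambda>k. Rep_bergman (?u k) z) \<longlonglongrightarrow> F z" for z
    using lim_g[of z] by (cases "z \<in> ball 0 1") (auto simp: F_def bergman_of_poly.rep_eq)
  have Fm [measurable]: "F \<in> borel_measurable borel"
    by (rule borel_measurable_LIMSEQ_metric[OF Rep_bergman_measurable limF])
  obtain B where B: "\<And>k. norm (?u k) \<le> B"
    using Cauchy_Bseq[OF C] unfolding Bseq_def by auto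
  have "(\<integral>\<^sup>+z. ennreal ((cmod (F z))\<^sup>2) \<partial>ball_measure) \<le> ennreal (B\<^sup>2)"
  proof (rule fatou_square[OF _ limF, where N = 0])
    show "(\<integral>\<^sup>+z. ennreal ((cmod (Rep_bergman (?u k) z))\<^sup>2) \<partial>ball_measure) \<le> ennreal (B\<^sup>2)" for k
      unfolding norm_bergman_nn_integral[symmetric] using B by (intro ennreal_leI power_mono) auto
  qed measurable
  then have "integrable ball_measure (\<lambda>z. (cmod (F z))\<^sup>2)"
    by (intro integrableI_bounded) (auto simp: le_less_trans)
  then have Fb: "F \<in> bergman_set"
    using hol by (auto simp: bergman_set_def F_def)
  define U where "U = Abs_bergman F"
  have RU: "Rep_bergman U = F" unfolding U_def by (rule Abs_bergman_inverse[OF Fb])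
  have "?u \<longlonglongrightarrow> U"
  proof (rule metric_LIMSEQ_I)
    fix e :: real assume e: "e > 0"
    then have "e / 2 > 0" by simp
    then obtain N where N: "\<And>m n. m \<ge> N \<Longrightarrow> n \<ge> N \<Longrightarrow> dist (?u m) (?u n) < e / 2"
      using metric_CauchyD[OF C] by blast
    have "dist (?u k) U < e" if k: "k \<ge> N" for k
    proof -
      have "ennreal ((norm (?u k - U))\<^sup>2) \<le> ennreal ((e / 2)\<^sup>2)"
        unfolding norm_bergman_nn_integral
      proof (rule fatou_square)
        show "(\<lambda>l. Rep_bergman (?u k - ?u l) z) \<longlonglongrightarrow> Rep_bergman (?u k - U) z" for z
          unfolding Rep_bergman_diff RU by (intro tendsto_intros limF)
        show "(\<integral>\<^sup>+z. ennreal ((cmod (Rep_bergman (?u k - ?u l) z))\<^sup>2) \<partial>ball_measure) \<le> ennreal ((e / 2)\<^sup>2)" if "l \<ge> N" for l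
          unfolding norm_bergman_nn_integral[symmetric]
          using N[OF k that] by (intro ennreal_leI power_mono) (auto simp: dist_norm)
      qed measurable
      then have "(norm (?u k - U))\<^sup>2 \<le> (e / 2)\<^sup>2" by simp
      then have "norm (?u k - U) \<le> e / 2" by (rule power2_le_imp_le) (use e in simp)
      then show ?thesis using e by (simp add: dist_norm)
    qed
    then show "\<exists>N. \<forall>k\<ge>N. dist (?u k) U < e" by blast
  qed
  then show ?thesis by blast
qed

definition poly_vec :: "'n::finite cpoly ^ 'r \<Rightarrow> 'n cpoly \<Rightarrow> 'n bergman ^ 'r"
  where "poly_vec p f = (\<chi> k. bergman_of_poly (p $ k * f))"

lemma generated_submodule_altdef: "generated_submodule p = closure (range (poly_vec p))"
  by (simp add: generated_submodule_def poly_vec_def[abs_def])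

lemma poly_vec_in: "poly_vec p f \<in> generated_submodule p"
  unfolding generated_submodule_altdef by (rule subsetD[OF closure_subset rangeI])

lemma submodule_approx:
  assumes "x \<in> generated_submodule p"
  obtains f where "(\<lambda>k. poly_vec p (f k)) \<longlonglongrightarrow> x"
proof -
  obtain y where y: "\<And>k. y k \<in> range (poly_vec p)" "y \<longlonglongrightarrow> x"
    using assms unfolding generated_submodule_altdef closure_sequential by blast
  then have "\<forall>k. \<exists>f. y k = poly_vec p f" by blast
  then obtain f where "\<And>k. y k = poly_vec p (f k)" by metis
  then have "y = (\<lambda>k. poly_vec p (f k))" by blast
  then show thesis using y(2) that by blast
qed

lemma submodule_limit:
  assumes "\<And>k. y k \<in> generated_submodule p" "y \<longlonglongrightarrow> x"
  shows "x \<in> generated_submodule p"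
  using closed_sequentially[OF _ assms] unfolding generated_submodule_altdef by simp

text \<open>A Cauchy sequence in the closure is followed at vanishing distance by one of polynomial
  vectors, which converges in each component.\<close>

lemma complete_generated_submodule:
  fixes p :: "'n::finite cpoly ^ 'r::finite"
  shows "complete (generated_submodule p)"
  unfolding complete_def
proof (intro allI impI)
  fix x assume x: "(\<forall>k. x k \<in> generated_submodule p) \<and> Cauchy x"
  have "\<exists>f. dist (poly_vec p f) (x k) < inverse (real (Suc k))" for k
  proof -
    have "x k \<in> closure (range (poly_vec p))" using x by (simp add: generated_submodule_altdef)
    then have "\<exists>y\<in>range (poly_vec p). dist y (x k) < inverse (real (Suc k))"
      unfolding closure_approachable by simp
    then show ?thesis by blast
  qed
  then obtain f where f: "\<And>k. dist (poly_vec p (f k)) (x k) < inverse (real (Suc k))" by metis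
  let ?y = "\<lambda>k. poly_vec p (f k)"
  have d0: "(\<lambda>k. ?y k - x k) \<longlonglongrightarrow> 0"
  proof (rule tendsto_norm_zero_cancel, rule tendsto_sandwich[OF _ _ tendsto_const LIMSEQ_inverse_real_of_nat])
    show "\<forall>\<^sub>F k in sequentially. norm (?y k - x k) \<le> inverse (real (Suc k))"
      using f by (auto simp: dist_norm less_imp_le)
  qed simp
  have Cy: "Cauchy ?y"
  proof (rule metric_CauchyI)
    fix e :: real assume "e > 0"
    then have e: "e / 2 > 0" by simp
    obtain N where N: "\<And>m n. m \<ge> N \<Longrightarrow> n \<ge> N \<Longrightarrow> dist (x m) (x n) < e / 2"
      using metric_CauchyD[OF conjunct2[OF x] e] by blast
    obtain N' where N': "\<And>m n. m \<ge> N' \<Longrightarrow> n \<ge> N' \<Longrightarrow> dist (?y m - x m) (?y n - x n) < e / 2"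
      using metric_CauchyD[OF LIMSEQ_imp_Cauchy[OF d0] e] by blast
    have "dist (?y m) (?y n) < e" if "m \<ge> max N N'" "n \<ge> max N N'" for m n
    proof -
      have "?y m - ?y n = (x m - x n) + ((?y m - x m) - (?y n - x n))" by simp
      then have "dist (?y m) (?y n) \<le> dist (x m) (x n) + dist (?y m - x m) (?y n - x n)"
        unfolding dist_norm by (metis norm_triangle_ineq)
      then show ?thesis using N[of m n] N'[of m n] that by simp
    qed
    then show "\<exists>N. \<forall>m\<ge>N. \<forall>n\<ge>N. dist (?y m) (?y n) < e" by blast
  qed
  have "\<exists>U. (\<lambda>k. bergman_of_poly (p $ j * f k)) \<longlonglongrightarrow> U" for j
    using Cauchy_vec_nth[OF Cy, of j] by (intro poly_sequence_converges) (simp add: poly_vec_def)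
  then obtain U where U: "\<And>j. (\<lambda>k. bergman_of_poly (p $ j * f k)) \<longlonglongrightarrow> U j" by metis
  have "?y \<longlonglongrightarrow> (\<chi> j. U j)"
    by (rule vec_tendstoI) (simp add: poly_vec_def U)
  from tendsto_diff[OF this d0] have "x \<longlonglongrightarrow> (\<chi> j. U j)" by simp
  moreover from this have "(\<chi> j. U j) \<in> generated_submodule p"
    by (rule submodule_limit[rotated]) (use x in blast)
  ultimately show "\<exists>l\<in>generated_submodule p. x \<longlonglongrightarrow> l" by blast
qed

lemma bounded_linear_scaleC: "bounded_linear (scaleC c :: 'a::complex_inner \<Rightarrow> 'a)"
  by (rule bounded_linear_intro[where K = "cmod c"])
    (auto simp: scaleC_add_right norm_scaleC scaleC_of_real[symmetric] scaleC_scaleC mult.commute)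

lemma poly_vec_add: "poly_vec p (f + g) = poly_vec p f + poly_vec p g"
  by (simp add: poly_vec_def vec_eq_iff distrib_left bergman_of_poly_add)

lemma poly_vec_scaleC: "poly_vec p (Poly_Mapping.single 0 c * f) = scaleC c (poly_vec p f)"
  unfolding poly_vec_def scaleC_vec_def vec_eq_iff
  by (auto intro!: Rep_bergman_eqI simp: bergman_of_poly.rep_eq scaleC_bergman.rep_eq poly_eval_mult poly_eval_single monomial_eval_def)

lemma csubspace_generated_submodule: "csubspace (generated_submodule p)"
  unfolding complex_vector.subspace_def
proof (intro conjI ballI allI)
  have "poly_vec p 0 = 0"
    using poly_vec_scaleC[of p 0 0] by simp
  then show "0 \<in> generated_submodule p" using poly_vec_in[of p 0] by simp
  fix x assume "x \<in> generated_submodule p"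
  then obtain f where f: "(\<lambda>k. poly_vec p (f k)) \<longlonglongrightarrow> x" by (rule submodule_approx)
  {
    fix y assume "y \<in> generated_submodule p"
    then obtain g where g: "(\<lambda>k. poly_vec p (g k)) \<longlonglongrightarrow> y" by (rule submodule_approx)
    show "x + y \<in> generated_submodule p"
      by (rule submodule_limit[OF _ tendsto_add[OF f g]]) (simp add: poly_vec_in flip: poly_vec_add)
  }
  fix c
  show "scaleC c x \<in> generated_submodule p"
    by (rule submodule_limit[OF _ bounded_linear.tendsto[OF bounded_linear_scaleC f]]) (simp add: poly_vec_in flip: poly_vec_scaleC)
qed

lemma coord_mult_vec_add: "coord_mult_vec i (f + g) = coord_mult_vec i f + coord_mult_vec i g"
  unfolding coord_mult_vec_def vec_eq_iff
  by (auto intro!: Rep_bergman_eqI simp: coord_mult.rep_eq plus_bergman.rep_eq algebra_simps)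

lemma coord_mult_vec_scaleC: "coord_mult_vec i (scaleC c f) = scaleC c (coord_mult_vec i f)"
  unfolding coord_mult_vec_def vec_eq_iff scaleC_vec_def
  by (auto intro!: Rep_bergman_eqI simp: coord_mult.rep_eq scaleC_bergman.rep_eq algebra_simps)

lemma norm_coord_mult_le: "norm (coord_mult i f) \<le> norm f"
proof -
  have "ennreal ((norm (coord_mult i f))\<^sup>2) \<le> ennreal ((norm f)\<^sup>2)"
    unfolding norm_bergman_nn_integral
  proof (intro nn_integral_mono ennreal_leI power_mono)
    fix z
    show "cmod (Rep_bergman (coord_mult i f) z) \<le> cmod (Rep_bergman f z)"
    proof (cases "z \<in> ball 0 1")
      case True
      then have "cmod (z $ i) \<le> 1" using Finite_Cartesian_Product.norm_nth_le[of z i] by simp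
      then show ?thesis by (simp add: coord_mult.rep_eq norm_mult mult_left_le_one_le)
    qed (simp add: coord_mult.rep_eq Rep_bergman_outside)
  qed simp
  then have "(norm (coord_mult i f))\<^sup>2 \<le> (norm f)\<^sup>2" by simp
  then show ?thesis by (rule power2_le_imp_le) simp
qed

lemma norm_coord_mult_vec_le: "norm (coord_mult_vec i f) \<le> norm f"
  unfolding norm_vec_def coord_mult_vec_def by (intro L2_set_mono) (auto simp: norm_coord_mult_le)

lemma bounded_linear_coord_mult_vec: "bounded_linear (coord_mult_vec i)"
  by (rule bounded_linear_intro[where K = 1])
    (auto simp: coord_mult_vec_add coord_mult_vec_scaleC norm_coord_mult_vec_le scaleC_of_real[symmetric])

lemma coord_mult_vec_poly_vec:
  "coord_mult_vec i (poly_vec p f) = poly_vec p (Poly_Mapping.single (Poly_Mapping.single i 1) 1 * f)"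
proof -
  have "monomial_eval (Poly_Mapping.single i 1) z = z $ i" for z :: "complex ^ 'a"
    unfolding monomial_eval_def by (subst prod.remove[of _ i]) (auto simp: lookup_single when_def)
  then show ?thesis
    unfolding coord_mult_vec_def poly_vec_def vec_eq_iff
    by (auto intro!: Rep_bergman_eqI simp: coord_mult.rep_eq bergman_of_poly.rep_eq poly_eval_mult poly_eval_single)
qed

lemma coord_mult_vec_in:
  assumes "x \<in> generated_submodule p"
  shows "coord_mult_vec i x \<in> generated_submodule p"
proof -
  obtain f where f: "(\<lambda>k. poly_vec p (f k)) \<longlonglongrightarrow> x" using assms by (rule submodule_approx)
  show ?thesis
    by (rule submodule_limit[OF _ bounded_linear.tendsto[OF bounded_linear_coord_mult_vec f]])
      (simp add: coord_mult_vec_poly_vec poly_vec_in)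
qed

section \<open>Boundary weights and orthogonality of monomials\<close>

text \<open>Zero beyond the ball, so that for \<open>\<theta> \<ge> 0\<close> the weight is bounded by \<open>1\<close> on the whole space.\<close>

definition weight :: "real \<Rightarrow> complex ^ 'n \<Rightarrow> real"
  where "weight \<theta> z = (if norm z < 1 then (1 - (norm z)\<^sup>2) powr \<theta> else 0)"

lemma weight_bounds: "0 \<le> weight \<theta> z" "\<theta> \<ge> 0 \<Longrightarrow> weight \<theta> z \<le> 1"
proof -
  show "0 \<le> weight \<theta> z" by (simp add: weight_def)
  show "weight \<theta> z \<le> 1" if "\<theta> \<ge> 0"
  proof (cases "norm z < 1")
    case True
    then have "0 \<le> 1 - (norm z)\<^sup>2" by (simp add: power_le_one)
    then show ?thesis using that by (auto simp: weight_def intro!: powr_le1)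
  qed (simp add: weight_def)
qed

lemma abs_weight_le: "\<theta> \<ge> 0 \<Longrightarrow> \<bar>weight \<theta> z\<bar> \<le> 1"
  using weight_bounds[of \<theta> z] by simp

lemma weight_measurable [measurable]: "weight \<theta> \<in> borel_measurable borel"
  unfolding weight_def by measurable

definition weighted_cinner :: "real \<Rightarrow> 'n::finite bergman \<Rightarrow> 'n bergman \<Rightarrow> complex"
  where "weighted_cinner \<theta> u v = (\<integral>z. of_real (weight \<theta> z) * (Rep_bergman u z * cnj (Rep_bergman v z)) \<partial>ball_measure)"

definition weighted_sq :: "real \<Rightarrow> 'n::finite bergman \<Rightarrow> real"
  where "weighted_sq \<theta> u = (\<integral>z. weight \<theta> z * (cmod (Rep_bergman u z))\<^sup>2 \<partial>ball_measure)"

lemma cnj_borel [measurable]: "cnj \<in> borel_measurable borel"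
  by (intro borel_measurable_continuous_onI continuous_on_cnj continuous_on_id)

lemma weighted_integrable:
  assumes "\<theta> \<ge> 0"
  shows "integrable ball_measure (\<lambda>z. of_real (weight \<theta> z) * (Rep_bergman u z * cnj (Rep_bergman v z)))"
proof (rule Bochner_Integration.integrable_bound)
  show "integrable ball_measure (\<lambda>z. Rep_bergman u z * cnj (Rep_bergman v z))"
    by (rule integrable_mult_cnj[OF Rep_bergman Rep_bergman])
  show "AE z in ball_measure. norm (of_real (weight \<theta> z) * (Rep_bergman u z * cnj (Rep_bergman v z))) \<le> norm (Rep_bergman u z * cnj (Rep_bergman v z))"
    using assms by (intro AE_I2) (auto simp: norm_mult abs_weight_le intro!: mult_left_le_one_le)
qed measurable

lemma weighted_sq_integrable:
  assumes "\<theta> \<ge> 0"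
  shows "integrable ball_measure (\<lambda>z. weight \<theta> z * (cmod (Rep_bergman u z))\<^sup>2)"
proof (rule Bochner_Integration.integrable_bound)
  show "integrable ball_measure (\<lambda>z. (cmod (Rep_bergman u z))\<^sup>2)"
    by (rule bergman_setD(2)[OF Rep_bergman])
  show "AE z in ball_measure. norm (weight \<theta> z * (cmod (Rep_bergman u z))\<^sup>2) \<le> norm ((cmod (Rep_bergman u z))\<^sup>2)"
    using assms by (intro AE_I2) (auto simp: abs_mult abs_weight_le intro!: mult_left_le_one_le)
qed measurable

lemma weighted_cinner_add:
  assumes "\<theta> \<ge> 0"
  shows "weighted_cinner \<theta> (u + v) w = weighted_cinner \<theta> u w + weighted_cinner \<theta> v w"
proof -
  let ?h = "\<lambda>u z. of_real (weight \<theta> z) * (Rep_bergman u z * cnj (Rep_bergman w z))"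
  have "weighted_cinner \<theta> (u + v) w = (\<integral>z. ?h u z + ?h v z \<partial>ball_measure)"
    unfolding weighted_cinner_def plus_bergman.rep_eq
    by (intro Bochner_Integration.integral_cong refl) (simp add: algebra_simps)
  also have "\<dots> = (\<integral>z. ?h u z \<partial>ball_measure) + (\<integral>z. ?h v z \<partial>ball_measure)"
    by (intro Bochner_Integration.integral_add weighted_integrable assms)
  finally show ?thesis unfolding weighted_cinner_def .
qed

lemma weighted_cinner_scaleC: "weighted_cinner \<theta> (scaleC c u) w = c * weighted_cinner \<theta> u w"
proof -
  have "weighted_cinner \<theta> (scaleC c u) w = (\<integral>z. c * (of_real (weight \<theta> z) * (Rep_bergman u z * cnj (Rep_bergman w z))) \<partial>ball_measure)"
    unfolding weighted_cinner_def scaleC_bergman.rep_eq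
    by (intro Bochner_Integration.integral_cong refl) (simp only: mult_ac)
  then show ?thesis by (simp add: weighted_cinner_def)
qed

lemma weighted_cinner_commute: "weighted_cinner \<theta> u v = cnj (weighted_cinner \<theta> v u)"
  unfolding weighted_cinner_def Bochner_Integration.integral_cnj[symmetric]
  by (intro Bochner_Integration.integral_cong refl) (simp add: mult_ac)

lemma weighted_cinner_sum:
  assumes "\<theta> \<ge> 0"
  shows "weighted_cinner \<theta> (\<Sum>i\<in>I. f i) w = (\<Sum>i\<in>I. weighted_cinner \<theta> (f i) w)"
proof -
  have "weighted_cinner \<theta> 0 w = 0" using weighted_cinner_scaleC[of \<theta> 0 0 w] by simp
  then show ?thesis
    by (induction I rule: infinite_finite_induct) (auto simp: weighted_cinner_add assms)
qed

lemma weighted_cinner_self: "weighted_cinner \<theta> u u = of_real (weighted_sq \<theta> u)"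
proof -
  have "weighted_cinner \<theta> u u = (\<integral>z. complex_of_real (weight \<theta> z * (cmod (Rep_bergman u z))\<^sup>2) \<partial>ball_measure)"
    unfolding weighted_cinner_def by (simp only: of_real_mult complex_norm_square)
  then show ?thesis unfolding weighted_sq_def by (simp only: integral_complex_of_real)
qed

lemma weight_0: "z \<in> ball 0 1 \<Longrightarrow> weight 0 z = 1"
proof -
  assume "z \<in> ball 0 1"
  then have "norm z < 1" "(norm z)\<^sup>2 < 1" by (auto simp: power_less_one_iff)
  then show ?thesis by (simp add: weight_def)
qed

lemma weighted_cinner_0: "weighted_cinner 0 u v = cinner u v"
  unfolding weighted_cinner_def cinner_bergman.rep_eq
proof (intro Bochner_Integration.integral_cong refl)
  fix z show "of_real (weight 0 z) * (Rep_bergman u z * cnj (Rep_bergman v z)) = Rep_bergman u z * cnj (Rep_bergman v z)"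
    by (cases "z \<in> ball 0 1") (simp_all add: weight_0 Rep_bergman_outside del: mem_ball)
qed

lemma weighted_sq_0: "weighted_sq 0 u = (norm u)\<^sup>2"
proof -
  have "complex_of_real (weighted_sq 0 u) = of_real ((norm u)\<^sup>2)"
    by (simp only: weighted_cinner_self[symmetric] weighted_cinner_0 cinner_self)
  then show ?thesis by (simp only: of_real_eq_iff)
qed

lemma weighted_sq_nonneg: "weighted_sq \<theta> u \<ge> 0"
  unfolding weighted_sq_def by (intro integral_nonneg_AE AE_I2 mult_nonneg_nonneg weight_bounds(1)) simp

lemma weighted_sq_le_norm: "\<theta> \<ge> 0 \<Longrightarrow> weighted_sq \<theta> u \<le> (norm u)\<^sup>2"
  unfolding weighted_sq_def norm_bergman_integral
  using weight_bounds[of \<theta>]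
  by (intro integral_mono weighted_sq_integrable bergman_setD(2)[OF Rep_bergman]) (auto intro!: mult_left_le_one_le)

lemma weighted_sq_nn: "\<theta> \<ge> 0 \<Longrightarrow> ennreal (weighted_sq \<theta> u) = (\<integral>\<^sup>+z. ennreal (weight \<theta> z * (cmod (Rep_bergman u z))\<^sup>2) \<partial>ball_measure)"
  unfolding weighted_sq_def
  by (intro nn_integral_eq_integral[symmetric] weighted_sq_integrable AE_I2 mult_nonneg_nonneg weight_bounds(1)) auto

lemma weighted_sq_triangle:
  assumes "\<theta> \<ge> 0"
  shows "weighted_sq \<theta> u \<le> 2 * weighted_sq \<theta> v + 2 * (norm (u - v))\<^sup>2"
proof -
  have "weighted_sq \<theta> u \<le> 2 * weighted_sq \<theta> v + 2 * weighted_sq \<theta> (u - v)"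
  proof -
    have "weighted_sq \<theta> u \<le> (\<integral>z. 2 * (weight \<theta> z * (cmod (Rep_bergman v z))\<^sup>2) + 2 * (weight \<theta> z * (cmod (Rep_bergman (u - v) z))\<^sup>2) \<partial>ball_measure)"
      unfolding weighted_sq_def
    proof (intro integral_mono weighted_sq_integrable assms Bochner_Integration.integrable_add integrable_mult_right)
      fix z
      have "(cmod (Rep_bergman u z))\<^sup>2 \<le> (cmod (Rep_bergman v z) + cmod (Rep_bergman (u - v) z))\<^sup>2"
        unfolding Rep_bergman_diff by (intro power_mono) (auto simp: norm_triangle_sub)
      also have "\<dots> \<le> 2 * (cmod (Rep_bergman v z))\<^sup>2 + 2 * (cmod (Rep_bergman (u - v) z))\<^sup>2"
        using sum_squares_bound[of "cmod (Rep_bergman v z)" "cmod (Rep_bergman (u - v) z)"] by (simp add: power2_sum)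
      finally have "weight \<theta> z * (cmod (Rep_bergman u z))\<^sup>2 \<le> weight \<theta> z * (2 * (cmod (Rep_bergman v z))\<^sup>2 + 2 * (cmod (Rep_bergman (u - v) z))\<^sup>2)"
        using weight_bounds(1) by (rule mult_left_mono)
      then show "weight \<theta> z * (cmod (Rep_bergman u z))\<^sup>2 \<le> 2 * (weight \<theta> z * (cmod (Rep_bergman v z))\<^sup>2) + 2 * (weight \<theta> z * (cmod (Rep_bergman (u - v) z))\<^sup>2)"
        by (simp add: algebra_simps)
    qed
    also have "\<dots> = 2 * weighted_sq \<theta> v + 2 * weighted_sq \<theta> (u - v)"
      unfolding weighted_sq_def
      by (subst Bochner_Integration.integral_add) (auto intro!: weighted_sq_integrable assms integrable_mult_right simp del: Rep_bergman_diff)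
    finally show ?thesis .
  qed
  then show ?thesis using weighted_sq_le_norm[OF assms, of "u - v"] by linarith
qed

text \<open>From \<open>(d x) powr \<theta> \<le> 1 + d x\<close> with \<open>x = 1 - |z|\<^sup>2\<close>. It reduces all weights to the
  weight \<open>1 - |z|\<^sup>2\<close>, for which monomials are easily estimated.\<close>

lemma weighted_sq_interpolate:
  assumes \<theta>: "0 \<le> \<theta>" "\<theta> \<le> 1" and d: "d \<ge> 1"
  shows "weighted_sq \<theta> u \<le> d powr (- \<theta>) * ((norm u)\<^sup>2 + d * weighted_sq 1 u)"
proof -
  have "weighted_sq \<theta> u \<le> (\<integral>z. d powr (- \<theta>) * ((cmod (Rep_bergman u z))\<^sup>2 + d * (weight 1 z * (cmod (Rep_bergman u z))\<^sup>2)) \<partial>ball_measure)"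
    unfolding weighted_sq_def
  proof (intro integral_mono weighted_sq_integrable \<theta> Bochner_Integration.integrable_add integrable_mult_right bergman_setD(2)[OF Rep_bergman])
    fix z :: "complex ^ 'a"
    have "weight \<theta> z \<le> d powr (- \<theta>) * (1 + d * weight 1 z)"
    proof (cases "norm z < 1")
      case True
      define x where "x = 1 - (norm z)\<^sup>2"
      have x: "x > 0" using True by (simp add: x_def power_less_one_iff)
      have "(d * x) powr \<theta> \<le> 1 + d * x"
      proof (cases "d * x \<le> 1")
        case True
        then have "(d * x) powr \<theta> \<le> 1" using x d \<theta> by (intro powr_le1) auto
        moreover have "0 \<le> d * x" using x d by simp
        ultimately show ?thesis by linarith
      next
        case False
        then have "(d * x) powr \<theta> \<le> (d * x) powr 1" using \<theta> by (intro powr_mono) auto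
        then show ?thesis using x d by simp
      qed
      then have "d powr (- \<theta>) * (d * x) powr \<theta> \<le> d powr (- \<theta>) * (1 + d * x)" by (rule mult_left_mono) simp
      moreover have "d powr (- \<theta>) * (d * x) powr \<theta> = x powr \<theta>"
        using d x by (simp add: powr_mult powr_minus field_simps)
      moreover have "weight \<theta> z = x powr \<theta>" "weight 1 z = x" using True x by (auto simp: weight_def x_def)
      ultimately show ?thesis by simp
    qed (simp add: weight_def)
    then have "weight \<theta> z * (cmod (Rep_bergman u z))\<^sup>2 \<le> d powr (- \<theta>) * (1 + d * weight 1 z) * (cmod (Rep_bergman u z))\<^sup>2"
      by (rule mult_right_mono) simp
    then show "weight \<theta> z * (cmod (Rep_bergman u z))\<^sup>2 \<le> d powr (- \<theta>) * ((cmod (Rep_bergman u z))\<^sup>2 + d * (weight 1 z * (cmod (Rep_bergman u z))\<^sup>2))"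
      by (simp add: algebra_simps)
  qed simp
  also have "\<dots> = d powr (- \<theta>) * ((norm u)\<^sup>2 + d * weighted_sq 1 u)"
    unfolding weighted_sq_def norm_bergman_integral
    by (simp add: weighted_sq_integrable bergman_setD(2)[OF Rep_bergman])
  finally show ?thesis .
qed

definition rotate_coord :: "'n \<Rightarrow> real \<Rightarrow> complex ^ 'n \<Rightarrow> complex ^ 'n"
  where "rotate_coord i t z = (\<chi> k. if k = i then cis t * z $ k else z $ k)"

lemma linear_rotate_coord: "linear (rotate_coord i t)"
  by (rule linearI) (auto simp: rotate_coord_def vec_eq_iff scaleR_conv_of_real[where 'a = complex] algebra_simps)

lemma norm_rotate_coord: "norm (rotate_coord i t z) = norm z"
proof -
  have "cmod (rotate_coord i t z $ k) = cmod (z $ k)" for k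
    by (simp add: rotate_coord_def norm_mult)
  then show ?thesis by (simp add: norm_vec_def)
qed

lemma rotate_coord_measurable [measurable]: "rotate_coord i t \<in> borel_measurable borel"
  by (intro borel_measurable_continuous_onI linear_continuous_on linear_linear[THEN iffD2] linear_rotate_coord)

lemma distr_ball_measure_rotate: "distr ball_measure borel (rotate_coord i t) = (ball_measure :: (complex ^ 'n) measure)"
proof (rule measure_eqI)
  let ?U = "rotate_coord i t :: complex ^ 'n \<Rightarrow> _"
  have emb: "emeasure ball_measure A = emeasure lborel (ball 0 1 \<inter> A) / emeasure lborel (ball (0 :: complex ^ 'n) 1)" if "A \<in> sets borel" for A :: "(complex ^ 'n) set"
    unfolding ball_measure_def using that by (intro emeasure_uniform_measure) auto
  fix A assume "A \<in> sets (distr ball_measure borel ?U)"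
  then have A: "A \<in> sets borel" by simp
  have "?U -` (ball 0 1 \<inter> A) = ball 0 1 \<inter> ?U -` A"
    by (auto simp: norm_rotate_coord)
  then have "emeasure lborel (ball 0 1 \<inter> ?U -` A) = emeasure (distr lborel borel ?U) (ball 0 1 \<inter> A)"
    using A by (subst emeasure_distr) auto
  also have "\<dots> = emeasure lborel (ball 0 1 \<inter> A)"
    by (simp only: distr_lborel_isometry[OF linear_rotate_coord norm_rotate_coord])
  finally have "emeasure lborel (ball 0 1 \<inter> ?U -` A) = emeasure lborel (ball 0 1 \<inter> A)" .
  moreover have "?U -` A \<in> sets borel" using measurable_sets_borel[OF rotate_coord_measurable A] by simp
  ultimately show "emeasure (distr ball_measure borel ?U) A = emeasure ball_measure A"
    using A by (simp add: emeasure_distr emb)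
qed simp

definition monomial :: "('n::finite \<Rightarrow>\<^sub>0 nat) \<Rightarrow> 'n bergman"
  where "monomial a = bergman_of_poly (Poly_Mapping.single a 1)"

lemma Rep_monomial: "Rep_bergman (monomial a) z = (if z \<in> ball 0 1 then monomial_eval a z else 0)"
  by (simp add: monomial_def bergman_of_poly.rep_eq poly_eval_single)

text \<open>If the exponents differ in the coordinate \<open>i\<close>, a suitable rotation of this coordinate changes
  the sign of the integrand while preserving weight and measure.\<close>

lemma monomial_orthogonal:
  assumes "a \<noteq> b"
  shows "weighted_cinner \<theta> (monomial a) (monomial b) = 0"
proof -
  obtain i where i: "expo a i \<noteq> expo b i" using assms by (metis poly_mapping_eqI)
  define t where "t = pi / (real (expo a i) - real (expo b i))"
  let ?U = "rotate_coord i t"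
  define h where "h z = of_real (weight \<theta> z) * (Rep_bergman (monomial a) z * cnj (Rep_bergman (monomial b) z))" for z
  have hm [measurable]: "h \<in> borel_measurable borel" unfolding h_def by measurable
  have Um: "?U \<in> measurable ball_measure borel"
    using rotate_coord_measurable measurable_cong_sets[OF sets_ball_measure refl] by blast
  have rot: "monomial_eval c (?U z) = cis t ^ expo c i * monomial_eval c z" for c z
    unfolding monomial_eval_remove[of c _ i] by (simp add: rotate_coord_def power_mult_distrib mult_ac)
  have "cis t ^ expo a i * cnj (cis t) ^ expo b i = cis (real (expo a i) * t + real (expo b i) * (- t))"
    by (simp add: cis_cnj Complex.DeMoivre cis_mult)
  also have "real (expo a i) * t + real (expo b i) * (- t) = (real (expo a i) - real (expo b i)) * t" by (simp add: algebra_simps)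
  also have "\<dots> = pi" using i by (simp add: t_def)
  finally have m1: "cis t ^ expo a i * cnj (cis t) ^ expo b i = - 1" by simp
  have hU: "h (?U z) = - h z" for z
  proof (cases "z \<in> ball 0 1")
    case True
    then have "?U z \<in> ball 0 1" by (simp add: norm_rotate_coord)
    then have "h (?U z) = (cis t ^ expo a i * cnj (cis t) ^ expo b i) * h z"
      using True unfolding h_def Rep_monomial rot by (simp add: weight_def norm_rotate_coord mult_ac)
    then show ?thesis unfolding m1 by simp
  next
    case False
    then have "?U z \<notin> ball 0 1" by (simp add: norm_rotate_coord)
    then show ?thesis using False by (simp add: h_def Rep_monomial)
  qed
  have "(\<integral>z. h z \<partial>ball_measure) = (\<integral>z. h z \<partial>distr ball_measure borel ?U)"
    unfolding distr_ball_measure_rotate ..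
  also have "\<dots> = (\<integral>z. h (?U z) \<partial>ball_measure)"
    by (rule integral_distr[OF Um hm])
  also have "\<dots> = - (\<integral>z. h z \<partial>ball_measure)" by (simp add: hU)
  finally show ?thesis unfolding weighted_cinner_def h_def by simp
qed

section \<open>Finitely many monomials control the weighted norm\<close>

lemma nn_integral_one_minus_power:
  "(\<integral>\<^sup>+s. ennreal ((1 - s) ^ m) * indicator {0<..<1} s \<partial>lborel) \<le> ennreal (1 / (real m + 1))"
proof -
  have "((Re \<circ> (\<lambda>s. complex_of_real (1 - s) ^ m)) has_integral Re (1 / of_nat (m + 1))) {0..1}"
    by (rule has_integral_linear[OF has_integral_one_minus_power bounded_linear_Re])
  moreover have "Re (1 / of_nat (m + 1)) = 1 / (real m + 1)"
  proof -
    have "1 / of_nat (m + 1) = complex_of_real (1 / (real m + 1))" by simp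
    then show ?thesis by (simp only: Re_complex_of_real)
  qed
  moreover have "Re \<circ> (\<lambda>s. complex_of_real (1 - s) ^ m) = (\<lambda>s. (1 - s) ^ m)"
    by (rule ext) (simp only: o_def of_real_power[symmetric] Re_complex_of_real)
  ultimately have "((\<lambda>s::real. (1 - s) ^ m) has_integral 1 / (real m + 1)) {0..1}" by (simp only:)
  then have "((\<lambda>s::real. if s \<in> {0..1} then (1 - s) ^ m else 0) has_integral 1 / (real m + 1)) UNIV"
    unfolding has_integral_restrict_UNIV .
  then have "(\<integral>\<^sup>+s. ennreal (if s \<in> {0..1::real} then (1 - s) ^ m else 0) \<partial>lborel) = ennreal (1 / (real m + 1))"
    by (intro nn_integral_has_integral_lborel) auto
  moreover have "(\<integral>\<^sup>+s. ennreal ((1 - s) ^ m) * indicator {0<..<1} s \<partial>lborel)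
      \<le> (\<integral>\<^sup>+s. ennreal (if s \<in> {0..1::real} then (1 - s) ^ m else 0) \<partial>lborel)"
    by (intro nn_integral_mono) (auto simp: indicator_def)
  ultimately show ?thesis by simp
qed

text \<open>Layer cake formula: \<open>1 - |z|\<^sup>2\<close> is the measure of the \<open>s > 0\<close> with \<open>|z|\<^sup>2 < 1 - s\<close>,
  and by homogeneity the mass of a monomial in the ball of square radius \<open>1 - s\<close> is at most
  \<open>(1 - s)\<close> to the power of its degree times the total mass.\<close>

lemma monomial_boundary_decay:
  fixes a :: "'n::finite \<Rightarrow>\<^sub>0 nat"
  shows "weighted_sq 1 (monomial a) \<le> (norm (monomial a))\<^sup>2 / (real (expo_deg a) + 1)"
proof -
  let ?m = "expo_deg a"
  let ?v = "emeasure lborel (ball (0 :: complex ^ 'n) 1)"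
  define h where "h z = ennreal ((cmod (monomial_eval a z))\<^sup>2)" for z :: "complex ^ 'n"
  have hp: "h z = ennreal ((cmod (poly_eval (Poly_Mapping.single a 1) z))\<^sup>2)" for z
    by (simp add: h_def poly_eval_single)
  have [measurable]: "h \<in> borel_measurable borel"
    unfolding hp[abs_def] by measurable
  define I where "I = (indicator (ball 0 1) :: complex ^ 'n \<Rightarrow> ennreal)"
  have [measurable]: "I \<in> borel_measurable borel"
    unfolding I_def by (rule borel_measurable_indicator) simp
  define J where "J = (indicator {0<..<1} :: real \<Rightarrow> ennreal)"
  have [measurable]: "J \<in> borel_measurable borel"
    unfolding J_def by (rule borel_measurable_indicator) simp
  define H where "H = (\<integral>\<^sup>+z. h z * I z \<partial>lborel)"
  have H: "ennreal ((norm (monomial a))\<^sup>2) * ?v = H"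
    unfolding H_def I_def monomial_def norm_bergman_of_poly_lborel hp ..
  define L where "L s z = (if (norm z)\<^sup>2 < 1 - s then 1 else 0 :: ennreal)" for s :: real and z :: "complex ^ 'n"
  have [measurable]: "(\<lambda>x. L (fst x) (snd x)) \<in> borel_measurable (borel \<Otimes>\<^sub>M borel)"
    "(\<lambda>x. L (snd x) (fst x)) \<in> borel_measurable (borel \<Otimes>\<^sub>M borel)"
    unfolding L_def by measurable
  have [measurable]: "L s \<in> borel_measurable borel" "(\<lambda>s. L s z) \<in> borel_measurable borel" for s z
    unfolding L_def by measurable
  have inner: "(\<integral>\<^sup>+z. h z * L s z \<partial>lborel) \<le> ennreal ((1 - s) ^ ?m) * H" if s: "0 < s" "s < 1" for s
  proof -
    define r where "r = sqrt (1 - s)"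
    have r: "0 < r" "r \<le> 1" "r\<^sup>2 = 1 - s" using s by (auto simp: r_def)
    have *: "h z * L s z = ennreal ((1 - s) ^ ?m) * (h ((1 / r) *\<^sub>R z) * I ((1 / r) *\<^sub>R z))" for z
    proof -
      have "(norm z)\<^sup>2 < 1 - s \<longleftrightarrow> norm z < r"
        using r power2_less_imp_less[of "norm z" r] power_strict_mono[of "norm z" r 2] by auto
      also have "\<dots> \<longleftrightarrow> (1 / r) *\<^sub>R z \<in> ball 0 1" using r by (simp add: field_simps)
      finally have "L s z = I ((1 / r) *\<^sub>R z)" by (simp add: L_def I_def)
      moreover have "h z = ennreal ((1 - s) ^ ?m) * h ((1 / r) *\<^sub>R z)"
      proof -
        have "(cmod (monomial_eval a ((1 / r) *\<^sub>R z)))\<^sup>2 = (1 / r) ^ ?m * (1 / r) ^ ?m * (cmod (monomial_eval a z))\<^sup>2"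
          using r unfolding monomial_eval_scaleR norm_mult norm_power norm_of_real by (simp add: power2_eq_square)
        also have "(1 / r) ^ ?m * (1 / r) ^ ?m = 1 / (1 - s) ^ ?m"
          unfolding r(3)[symmetric] by (simp add: power2_eq_square power_divide power_mult_distrib)
        finally have "(cmod (monomial_eval a z))\<^sup>2 = (1 - s) ^ ?m * (cmod (monomial_eval a ((1 / r) *\<^sub>R z)))\<^sup>2"
          using s by simp
        then show ?thesis using s by (simp add: h_def ennreal_mult)
      qed
      ultimately show ?thesis by (simp add: mult.assoc)
    qed
    have sm: "(\<lambda>z :: complex ^ 'n. (1 / r) *\<^sub>R z) \<in> borel_measurable borel"
      by (intro borel_measurable_continuous_onI continuous_intros)
    have hI: "(\<lambda>z. h ((1 / r) *\<^sub>R z)) \<in> borel_measurable borel" "(\<lambda>z. I ((1 / r) *\<^sub>R z)) \<in> borel_measurable borel"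
      by (rule measurable_compose[OF sm], measurable)+
    then have m3: "(\<lambda>z. h ((1 / r) *\<^sub>R z) * I ((1 / r) *\<^sub>R z)) \<in> borel_measurable lborel"
      using borel_measurable_times_ennreal[OF hI] by simp
    have "(\<integral>\<^sup>+z. h z * L s z \<partial>lborel) = ennreal ((1 - s) ^ ?m) * (\<integral>\<^sup>+z. h ((1 / r) *\<^sub>R z + 0) * I ((1 / r) *\<^sub>R z + 0) \<partial>lborel)"
      unfolding * by (simp only: nn_integral_cmult[OF m3] add_0_right)
    also have "(\<integral>\<^sup>+z. h ((1 / r) *\<^sub>R z + 0) * I ((1 / r) *\<^sub>R z + 0) \<partial>lborel) \<le> ennreal (r ^ DIM(complex ^ 'n)) * H"
      unfolding H_def
    proof (rule nn_integral_linear_le)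
      show "linear ((*\<^sub>R) (1 / r) :: complex ^ 'n \<Rightarrow> _)" by (rule linear_scaleR)
    qed (use r in auto)
    also have "\<dots> \<le> 1 * H"
      using r by (intro mult_right_mono) (auto simp: ennreal_le_1 power_le_one)
    finally show ?thesis by (simp add: mult_left_mono)
  qed
  have "ennreal (weighted_sq 1 (monomial a)) * ?v = (\<integral>\<^sup>+z. ennreal (weight 1 z * (cmod (Rep_bergman (monomial a) z))\<^sup>2) * indicator (ball 0 1) z \<partial>lborel)"
    by (subst weighted_sq_nn, simp, rule nn_integral_ball_measure) measurable
  also have "\<dots> = (\<integral>\<^sup>+z. (\<integral>\<^sup>+s. h z * L s z * J s \<partial>lborel) \<partial>lborel)"
  proof (rule nn_integral_cong)
    fix z :: "complex ^ 'n"
    show "ennreal (weight 1 z * (cmod (Rep_bergman (monomial a) z))\<^sup>2) * indicator (ball 0 1) z = (\<integral>\<^sup>+s. h z * L s z * J s \<partial>lborel)"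
    proof (cases "z \<in> ball 0 1")
      case True
      then have n: "(norm z)\<^sup>2 < 1" by (simp add: power_less_one_iff)
      have aux: "x < 1" if "(norm z)\<^sup>2 < 1 - x" for x
        using that zero_le_power2[of "norm z"] by linarith
      have "(\<integral>\<^sup>+s. h z * L s z * J s \<partial>lborel) = (\<integral>\<^sup>+s. h z * indicator {0<..<1 - (norm z)\<^sup>2} s \<partial>lborel)"
        using n aux by (intro nn_integral_cong) (auto simp: L_def J_def indicator_def)
      also have "\<dots> = h z * ennreal (1 - (norm z)\<^sup>2)"
        using n by (subst nn_integral_cmult_indicator) auto
      finally show ?thesis
        using True n by (simp add: weight_def Rep_monomial h_def ennreal_mult mult.commute)
    next
      case False
      then have "1 \<le> (norm z)\<^sup>2" by simp
      then have e: "h z * L s z * J s = 0" for s by (auto simp: L_def J_def indicator_def)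
      show ?thesis unfolding e using False by simp
    qed
  qed
  also have "\<dots> = (\<integral>\<^sup>+s. (\<integral>\<^sup>+z. h z * L s z * J s \<partial>lborel) \<partial>lborel)"
    by (rule lborel_pair.Fubini') measurable
  also have "\<dots> \<le> (\<integral>\<^sup>+s. H * (ennreal ((1 - s) ^ ?m) * J s) \<partial>lborel)"
  proof (rule nn_integral_mono)
    fix s :: real
    have "(\<integral>\<^sup>+z. h z * L s z * J s \<partial>lborel) = (\<integral>\<^sup>+z. h z * L s z \<partial>lborel) * J s"
      by (rule nn_integral_multc) measurable
    also have "\<dots> \<le> ennreal ((1 - s) ^ ?m) * H * J s"
    proof (cases "s \<in> {0<..<1}")
      case True
      then show ?thesis using inner[of s] by (intro mult_right_mono) auto
    qed (simp add: J_def)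
    finally show "(\<integral>\<^sup>+z. h z * L s z * J s \<partial>lborel) \<le> H * (ennreal ((1 - s) ^ ?m) * J s)"
      by (simp add: mult_ac)
  qed
  also have "\<dots> = H * (\<integral>\<^sup>+s. ennreal ((1 - s) ^ ?m) * J s \<partial>lborel)"
    by (rule nn_integral_cmult) measurable
  also have "\<dots> \<le> H * ennreal (1 / (real ?m + 1))"
    unfolding J_def by (intro mult_left_mono nn_integral_one_minus_power) simp
  also have "\<dots> = ennreal ((norm (monomial a))\<^sup>2 / (real ?m + 1)) * ?v"
    unfolding H[symmetric] by (simp add: ennreal_mult'[symmetric] mult_ac)
  finally have "ennreal (weighted_sq 1 (monomial a)) \<le> ennreal ((norm (monomial a))\<^sup>2 / (real ?m + 1))"
    using emeasure_unit_ball_pos[where 'a = "complex ^ 'n"]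
      ennreal_mult_le_mult_iff[of ?v] by (simp only: mult.commute[of _ ?v]) simp
  then show ?thesis by simp
qed

lemma Rep_bergman_sum: "Rep_bergman (\<Sum>i\<in>I. f i) z = (\<Sum>i\<in>I. Rep_bergman (f i) z)"
  by (induction I rule: infinite_finite_induct) (auto simp: zero_bergman.rep_eq plus_bergman.rep_eq)

lemma bergman_of_poly_expansion:
  "bergman_of_poly f = (\<Sum>a\<in>Poly_Mapping.keys f. scaleC (pcoeff f a) (monomial a))"
  by (rule Rep_bergman_eqI)
    (simp add: Rep_bergman_sum scaleC_bergman.rep_eq Rep_monomial bergman_of_poly.rep_eq poly_eval_altdef)

lemma weighted_cinner_monomial:
  assumes "\<theta> \<ge> 0"
  shows "weighted_cinner \<theta> (bergman_of_poly f) (monomial a) = pcoeff f a * of_real (weighted_sq \<theta> (monomial a))"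
proof -
  have "weighted_cinner \<theta> (bergman_of_poly f) (monomial a)
      = (\<Sum>b\<in>Poly_Mapping.keys f. pcoeff f b * weighted_cinner \<theta> (monomial b) (monomial a))"
    by (simp add: bergman_of_poly_expansion weighted_cinner_sum assms weighted_cinner_scaleC)
  also have "\<dots> = (\<Sum>b\<in>Poly_Mapping.keys f. if b = a then pcoeff f a * of_real (weighted_sq \<theta> (monomial a)) else 0)"
    by (intro sum.cong refl) (auto simp: monomial_orthogonal weighted_cinner_self)
  also have "\<dots> = pcoeff f a * of_real (weighted_sq \<theta> (monomial a))"
    by (simp add: in_keys_iff)
  finally show ?thesis .
qed

lemma weighted_sq_poly:
  assumes "\<theta> \<ge> 0"
  shows "weighted_sq \<theta> (bergman_of_poly f) = (\<Sum>a\<in>Poly_Mapping.keys f. (cmod (pcoeff f a))\<^sup>2 * weighted_sq \<theta> (monomial a))"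
proof -
  let ?u = "bergman_of_poly f"
  have "complex_of_real (weighted_sq \<theta> ?u) = weighted_cinner \<theta> ?u ?u"
    by (rule weighted_cinner_self[symmetric])
  also have "\<dots> = weighted_cinner \<theta> (\<Sum>a\<in>Poly_Mapping.keys f. scaleC (pcoeff f a) (monomial a)) ?u"
    by (subst bergman_of_poly_expansion[of f]) simp
  also have "\<dots> = (\<Sum>a\<in>Poly_Mapping.keys f. pcoeff f a * weighted_cinner \<theta> (monomial a) ?u)"
    by (simp add: weighted_cinner_sum assms weighted_cinner_scaleC)
  also have "\<dots> = (\<Sum>a\<in>Poly_Mapping.keys f. of_real ((cmod (pcoeff f a))\<^sup>2 * weighted_sq \<theta> (monomial a)))"
  proof (rule sum.cong[OF refl])
    fix a
    have "weighted_cinner \<theta> (monomial a) ?u = cnj (pcoeff f a) * of_real (weighted_sq \<theta> (monomial a))"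
      unfolding weighted_cinner_commute[of \<theta> "monomial a"] weighted_cinner_monomial[OF assms] by simp
    then show "pcoeff f a * weighted_cinner \<theta> (monomial a) ?u = of_real ((cmod (pcoeff f a))\<^sup>2 * weighted_sq \<theta> (monomial a))"
      by (simp only: of_real_mult complex_norm_square mult.assoc)
  qed
  also have "\<dots> = of_real (\<Sum>a\<in>Poly_Mapping.keys f. (cmod (pcoeff f a))\<^sup>2 * weighted_sq \<theta> (monomial a))"
    by (rule of_real_sum[symmetric])
  finally show ?thesis by (simp only: of_real_eq_iff)
qed

definition expo_box :: "nat \<Rightarrow> ('n::finite \<Rightarrow>\<^sub>0 nat) set"
  where "expo_box d = {a. \<forall>i. expo a i < d}"

lemma expo_box: "finite (expo_box d :: ('n::finite \<Rightarrow>\<^sub>0 nat) set)" "card (expo_box d :: ('n \<Rightarrow>\<^sub>0 nat) set) \<le> d ^ CARD('n)"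
proof -
  have inj: "inj_on expo (expo_box d :: ('n \<Rightarrow>\<^sub>0 nat) set)"
    by (intro inj_onI poly_mapping_eqI) simp
  have sub: "expo ` (expo_box d :: ('n \<Rightarrow>\<^sub>0 nat) set) \<subseteq> (\<Pi>\<^sub>E i\<in>UNIV. {..<d})"
    by (auto simp: expo_box_def)
  have fin: "finite (\<Pi>\<^sub>E i\<in>(UNIV :: 'n set). {..<d})" by (intro finite_PiE) auto
  show "finite (expo_box d :: ('n \<Rightarrow>\<^sub>0 nat) set)"
    using finite_subset[OF sub fin] inj by (rule finite_imageD)
  show "card (expo_box d :: ('n \<Rightarrow>\<^sub>0 nat) set) \<le> d ^ CARD('n)"
    using card_mono[OF fin sub] by (simp add: card_image[OF inj] card_PiE)
qed

text \<open>Normalized so that the factor \<open>d powr (1 - \<theta>)\<close> of interpolation is part of the vector and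
  no coefficient appears in the sum of squares below.\<close>

definition scaled_monomial :: "real \<Rightarrow> nat \<Rightarrow> ('n::finite \<Rightarrow>\<^sub>0 nat) \<Rightarrow> 'n bergman"
  where "scaled_monomial \<theta> d a = scaleC (of_real (sqrt (real d powr (1 - \<theta>)) / norm (monomial a))) (monomial a)"

text \<open>By orthogonality the weighted norms are computed monomial by monomial. Outside the box some
  exponent is at least \<open>d\<close>, so the weight \<open>1 - |z|\<^sup>2\<close> gains \<open>1 / d\<close>; inside the box it is
  estimated by \<open>1\<close>.\<close>

lemma weighted_sq_tail_poly:
  fixes f :: "'n::finite cpoly"
  assumes \<theta>: "0 \<le> \<theta>" "\<theta> \<le> 1" and d: "d \<ge> 1"
  shows "weighted_sq \<theta> (bergman_of_poly f) \<le> 2 * real d powr (- \<theta>) * (norm (bergman_of_poly f))\<^sup>2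
    + (\<Sum>a\<in>expo_box d. (cmod (cinner (bergman_of_poly f) (scaled_monomial \<theta> d a)))\<^sup>2)"
proof -
  let ?u = "bergman_of_poly f"
  let ?c = "\<lambda>a. (cmod (pcoeff f a))\<^sup>2 * (norm (monomial a))\<^sup>2"
  have nrm: "(norm ?u)\<^sup>2 = (\<Sum>a\<in>Poly_Mapping.keys f. ?c a)"
    using weighted_sq_poly[of 0 f] by (simp add: weighted_sq_0)
  define S where "S = (\<Sum>a\<in>expo_box d. ?c a)"
  have "weighted_sq 1 ?u \<le> (\<Sum>a\<in>Poly_Mapping.keys f. (if a \<in> expo_box d then ?c a else 0) + ?c a / real d)"
    unfolding weighted_sq_poly[OF zero_le_one]
  proof (rule sum_mono)
    fix a :: "'n \<Rightarrow>\<^sub>0 nat"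
    have w: "weighted_sq 1 (monomial a) \<le> (norm (monomial a))\<^sup>2" by (rule weighted_sq_le_norm) simp
    show "(cmod (pcoeff f a))\<^sup>2 * weighted_sq 1 (monomial a) \<le> (if a \<in> expo_box d then ?c a else 0) + ?c a / real d"
    proof (cases "a \<in> expo_box d")
      case True
      have "(cmod (pcoeff f a))\<^sup>2 * weighted_sq 1 (monomial a) \<le> ?c a" by (rule mult_left_mono[OF w]) simp
      moreover have "0 \<le> ?c a / real d" by simp
      ultimately show ?thesis using True by (simp only: if_True)
    next
      case False
      then obtain i where "d \<le> expo a i" by (auto simp: expo_box_def not_less)
      then have "real d \<le> real (expo_deg a) + 1" using expo_le_deg[of a i] by simp
      then have "(norm (monomial a))\<^sup>2 / (real (expo_deg a) + 1) \<le> (norm (monomial a))\<^sup>2 / real d"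
        using d by (intro divide_left_mono) auto
      then have "weighted_sq 1 (monomial a) \<le> (norm (monomial a))\<^sup>2 / real d"
        using monomial_boundary_decay[of a] by linarith
      then have "(cmod (pcoeff f a))\<^sup>2 * weighted_sq 1 (monomial a) \<le> (cmod (pcoeff f a))\<^sup>2 * ((norm (monomial a))\<^sup>2 / real d)"
        by (rule mult_left_mono) simp
      then show ?thesis using False by simp
    qed
  qed
  also have "\<dots> = (\<Sum>a\<in>Poly_Mapping.keys f. if a \<in> expo_box d then ?c a else 0) + (norm ?u)\<^sup>2 / real d"
    by (simp add: sum.distrib nrm sum_divide_distrib)
  also have "(\<Sum>a\<in>Poly_Mapping.keys f. if a \<in> expo_box d then ?c a else 0) \<le> S"
  proof -
    have "(\<Sum>a\<in>Poly_Mapping.keys f. if a \<in> expo_box d then ?c a else 0) = (\<Sum>a\<in>Poly_Mapping.keys f \<inter> expo_box d. ?c a)"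
      by (simp add: sum.inter_restrict)
    also have "\<dots> \<le> S" unfolding S_def by (intro sum_mono2 expo_box) auto
    finally show ?thesis .
  qed
  finally have W1: "weighted_sq 1 ?u \<le> S + (norm ?u)\<^sup>2 / real d" by simp
  have "weighted_sq \<theta> ?u \<le> real d powr (- \<theta>) * ((norm ?u)\<^sup>2 + real d * weighted_sq 1 ?u)"
    using d by (intro weighted_sq_interpolate \<theta>) simp
  also have "\<dots> \<le> real d powr (- \<theta>) * ((norm ?u)\<^sup>2 + real d * (S + (norm ?u)\<^sup>2 / real d))"
    by (intro mult_left_mono add_left_mono W1) auto
  also have "\<dots> = 2 * real d powr (- \<theta>) * (norm ?u)\<^sup>2 + real d powr (1 - \<theta>) * S"
    using d by (simp add: powr_diff powr_minus field_simps)
  also have "real d powr (1 - \<theta>) * S = (\<Sum>a\<in>expo_box d. (cmod (cinner ?u (scaled_monomial \<theta> d a)))\<^sup>2)"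
    unfolding S_def sum_distrib_left
  proof (rule sum.cong[OF refl])
    fix a
    have c: "cinner ?u (monomial a) = pcoeff f a * of_real ((norm (monomial a))\<^sup>2)"
      using weighted_cinner_monomial[of 0 f a] by (simp only: weighted_cinner_0 weighted_sq_0 order.refl)
    have "cmod (cinner ?u (scaled_monomial \<theta> d a)) = sqrt (real d powr (1 - \<theta>)) * (cmod (pcoeff f a) * norm (monomial a))"
      unfolding scaled_monomial_def cinner_scaleC_right c by (simp add: norm_mult norm_divide norm_power power2_eq_square)
    then show "real d powr (1 - \<theta>) * ?c a = (cmod (cinner ?u (scaled_monomial \<theta> d a)))\<^sup>2"
      by (simp add: power_mult_distrib)
  qed
  finally show ?thesis .
qed

section \<open>Distance from conjugate multiples to the submodule\<close>

text \<open>How far \<open>v\<close> is from being \<open>cnj z\<^sub>j u\<close>; the latter is not holomorphic, so this is a function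
  on the ball and not an element of the Bergman space.\<close>

definition defect :: "'n::finite \<Rightarrow> 'n bergman \<Rightarrow> 'n bergman \<Rightarrow> complex ^ 'n \<Rightarrow> complex"
  where "defect j u v z = cnj (z $ j) * Rep_bergman u z - Rep_bergman v z"

definition defect_sq :: "'n::finite \<Rightarrow> 'n bergman \<Rightarrow> 'n bergman \<Rightarrow> real"
  where "defect_sq j u v = (\<integral>z. (cmod (defect j u v z))\<^sup>2 \<partial>ball_measure)"

lemma coord_measurable [measurable]: "(\<lambda>z :: complex ^ 'n. z $ j) \<in> borel_measurable borel"
  by (intro borel_measurable_continuous_onI continuous_intros)

lemma defect_measurable [measurable]: "defect j u v \<in> borel_measurable borel"
proof -
  have "(\<lambda>z :: complex ^ 'a. cnj (z $ j)) \<in> borel_measurable borel"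
    by (intro borel_measurable_continuous_onI continuous_intros)
  then show ?thesis unfolding defect_def[abs_def]
    by (intro borel_measurable_diff borel_measurable_times Rep_bergman_measurable)
qed

lemma defect_bound: "(cmod (defect j u v z))\<^sup>2 \<le> 2 * (cmod (Rep_bergman u z))\<^sup>2 + 2 * (cmod (Rep_bergman v z))\<^sup>2"
proof -
  have "cmod (cnj (z $ j) * Rep_bergman u z) \<le> cmod (Rep_bergman u z)"
  proof (cases "z \<in> ball 0 1")
    case True
    then have "cmod (z $ j) \<le> 1" using Finite_Cartesian_Product.norm_nth_le[of z j] by simp
    then show ?thesis by (simp add: norm_mult mult_left_le_one_le)
  qed (simp add: Rep_bergman_outside)
  then have "cmod (defect j u v z) \<le> cmod (Rep_bergman u z) + cmod (Rep_bergman v z)"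
    unfolding defect_def using norm_triangle_ineq4[of "cnj (z $ j) * Rep_bergman u z" "Rep_bergman v z"] by linarith
  then have "(cmod (defect j u v z))\<^sup>2 \<le> (cmod (Rep_bergman u z) + cmod (Rep_bergman v z))\<^sup>2"
    by (intro power_mono) auto
  then show ?thesis
    using sum_squares_bound[of "cmod (Rep_bergman u z)" "cmod (Rep_bergman v z)"] by (simp add: power2_sum)
qed

lemma defect_sq_integrable: "integrable ball_measure (\<lambda>z. (cmod (defect j u v z))\<^sup>2)"
proof (rule Bochner_Integration.integrable_bound)
  show "integrable ball_measure (\<lambda>z. 2 * (cmod (Rep_bergman u z))\<^sup>2 + 2 * (cmod (Rep_bergman v z))\<^sup>2)"
    by (intro Bochner_Integration.integrable_add integrable_mult_right bergman_setD(2)[OF Rep_bergman])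
  show "AE z in ball_measure. norm ((cmod (defect j u v z))\<^sup>2) \<le> norm (2 * (cmod (Rep_bergman u z))\<^sup>2 + 2 * (cmod (Rep_bergman v z))\<^sup>2)"
    using defect_bound by (intro AE_I2) auto
qed measurable

lemma defect_sq_nonneg: "defect_sq j u v \<ge> 0"
  unfolding defect_sq_def by simp

lemma square_integrable_mult_cnj:
  fixes f g :: "complex ^ 'n \<Rightarrow> complex"
  assumes [measurable]: "f \<in> borel_measurable borel" "g \<in> borel_measurable borel"
    and f: "integrable ball_measure (\<lambda>z. (cmod (f z))\<^sup>2)" and g: "integrable ball_measure (\<lambda>z. (cmod (g z))\<^sup>2)"
  shows "integrable ball_measure (\<lambda>z. f z * cnj (g z))"
    and "cmod (\<integral>z. f z * cnj (g z) \<partial>ball_measure)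
      \<le> sqrt (\<integral>z. (cmod (f z))\<^sup>2 \<partial>ball_measure) * sqrt (\<integral>z. (cmod (g z))\<^sup>2 \<partial>ball_measure)"
proof -
  show int: "integrable ball_measure (\<lambda>z. f z * cnj (g z))"
  proof (rule Bochner_Integration.integrable_bound)
    show "integrable ball_measure (\<lambda>z. (cmod (f z))\<^sup>2 + (cmod (g z))\<^sup>2)"
      by (intro Bochner_Integration.integrable_add f g)
    have "cmod a * cmod b \<le> (cmod a)\<^sup>2 + (cmod b)\<^sup>2" for a b
      using sum_squares_bound[of "cmod a" "cmod b"] mult_nonneg_nonneg[OF norm_ge_zero[of a] norm_ge_zero[of b]] by linarith
    then show "AE z in ball_measure. norm (f z * cnj (g z)) \<le> norm ((cmod (f z))\<^sup>2 + (cmod (g z))\<^sup>2)"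
      by (intro AE_I2) (simp add: norm_mult)
  qed measurable
  let ?F = "\<integral>z. (cmod (f z))\<^sup>2 \<partial>ball_measure" and ?G = "\<integral>z. (cmod (g z))\<^sup>2 \<partial>ball_measure"
  have F: "(\<integral>\<^sup>+z. (ennreal (cmod (f z)))\<^sup>2 \<partial>ball_measure) = ennreal ?F"
    by (simp add: ennreal_power nn_integral_eq_integral f)
  have G: "(\<integral>\<^sup>+z. (ennreal (cmod (g z)))\<^sup>2 \<partial>ball_measure) = ennreal ?G"
    by (simp add: ennreal_power nn_integral_eq_integral g)
  have FG: "?F \<ge> 0" "?G \<ge> 0" by simp_all
  have "ennreal (cmod (\<integral>z. f z * cnj (g z) \<partial>ball_measure)) \<le> (\<integral>\<^sup>+z. ennreal (norm (f z * cnj (g z))) \<partial>ball_measure)"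
    by (rule integral_norm_bound_ennreal[OF int])
  also have "\<dots> = (\<integral>\<^sup>+z. ennreal (cmod (f z)) * ennreal (cmod (g z)) \<partial>ball_measure)"
    by (simp add: norm_mult ennreal_mult)
  finally have "(ennreal (cmod (\<integral>z. f z * cnj (g z) \<partial>ball_measure)))\<^sup>2 \<le> (\<integral>\<^sup>+z. ennreal (cmod (f z)) * ennreal (cmod (g z)) \<partial>ball_measure)\<^sup>2"
    by (intro power_mono) auto
  also have "\<dots> \<le> ennreal ?F * ennreal ?G"
    unfolding F[symmetric] G[symmetric] by (rule Cauchy_Schwarz_nn_integral) measurable
  finally have "ennreal ((cmod (\<integral>z. f z * cnj (g z) \<partial>ball_measure))\<^sup>2) \<le> ennreal (?F * ?G)"
    using FG by (simp add: ennreal_power ennreal_mult)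
  then have "(cmod (\<integral>z. f z * cnj (g z) \<partial>ball_measure))\<^sup>2 \<le> ?F * ?G"
    using FG by simp
  then show "cmod (\<integral>z. f z * cnj (g z) \<partial>ball_measure) \<le> sqrt ?F * sqrt ?G"
    by (simp add: real_sqrt_mult[symmetric] real_le_rsqrt)
qed

lemma Rep_square_integrable: "integrable ball_measure (\<lambda>z. (cmod (Rep_bergman u z))\<^sup>2)"
  by (rule bergman_setD(2)[OF Rep_bergman])

lemma cinner_defect: "cinner (coord_mult j x) u - cinner x v = (\<integral>z. Rep_bergman x z * cnj (defect j u v z) \<partial>ball_measure)"
proof -
  have "(\<integral>z. Rep_bergman x z * cnj (defect j u v z) \<partial>ball_measure)
      = (\<integral>z. Rep_bergman (coord_mult j x) z * cnj (Rep_bergman u z) - Rep_bergman x z * cnj (Rep_bergman v z) \<partial>ball_measure)"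
    by (intro Bochner_Integration.integral_cong refl) (simp add: defect_def coord_mult.rep_eq algebra_simps)
  also have "\<dots> = cinner (coord_mult j x) u - cinner x v"
    unfolding cinner_bergman.rep_eq
    by (intro Bochner_Integration.integral_diff integrable_mult_cnj Rep_bergman)
  finally show ?thesis by simp
qed

lemma cinner_defect_bound: "cmod (cinner (coord_mult j x) u - cinner x v) \<le> norm x * sqrt (defect_sq j u v)"
proof -
  have "cmod (cinner (coord_mult j x) u - cinner x v)
      \<le> sqrt (\<integral>z. (cmod (Rep_bergman x z))\<^sup>2 \<partial>ball_measure) * sqrt (\<integral>z. (cmod (defect j u v z))\<^sup>2 \<partial>ball_measure)"
    unfolding cinner_defect by (intro square_integrable_mult_cnj(2) Rep_square_integrable defect_sq_integrable) measurable
  then show ?thesis by (simp add: defect_sq_def flip: norm_bergman_integral)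
qed

text \<open>The left hand side is the integral of one defect times the conjugate of the other, multiplied
  out.\<close>

lemma defect_product:
  "cmod (cinner (coord_mult i u) (coord_mult j u') - cinner u (coord_mult j v') - cinner (coord_mult i v) u' + cinner v v')
     \<le> sqrt (defect_sq j u v) * sqrt (defect_sq i u' v')"
proof -
  let ?R = Rep_bergman
  have "(\<integral>z. defect j u v z * cnj (defect i u' v' z) \<partial>ball_measure)
      = (\<integral>z. ?R (coord_mult i u) z * cnj (?R (coord_mult j u') z) - ?R u z * cnj (?R (coord_mult j v') z)
          - ?R (coord_mult i v) z * cnj (?R u' z) + ?R v z * cnj (?R v' z) \<partial>ball_measure)"
    by (intro Bochner_Integration.integral_cong refl) (simp add: defect_def coord_mult.rep_eq algebra_simps)
  also have "\<dots> = cinner (coord_mult i u) (coord_mult j u') - cinner u (coord_mult j v') - cinner (coord_mult i v) u' + cinner v v'"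
    unfolding cinner_bergman.rep_eq
    by (simp add: integrable_mult_cnj Rep_bergman)
  finally have "cinner (coord_mult i u) (coord_mult j u') - cinner u (coord_mult j v') - cinner (coord_mult i v) u' + cinner v v'
      = (\<integral>z. defect j u v z * cnj (defect i u' v' z) \<partial>ball_measure)" by simp
  then show ?thesis
    unfolding defect_sq_def by (simp only:) (intro square_integrable_mult_cnj(2) defect_sq_integrable, measurable)
qed

definition weighted_sq_vec :: "real \<Rightarrow> 'n::finite bergman ^ 'r \<Rightarrow> real"
  where "weighted_sq_vec \<theta> x = (\<Sum>k\<in>UNIV. weighted_sq \<theta> (x $ k))"

definition defect_sq_vec :: "'n::finite \<Rightarrow> 'n bergman ^ 'r \<Rightarrow> 'n bergman ^ 'r \<Rightarrow> real"
  where "defect_sq_vec j x y = (\<Sum>k\<in>UNIV. defect_sq j (x $ k) (y $ k))"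

lemma norm_vec_sq: "(norm x)\<^sup>2 = (\<Sum>k\<in>UNIV. (norm (x $ k))\<^sup>2)" for x :: "'a::real_normed_vector ^ 'r"
  by (simp add: norm_vec_def L2_set_def sum_nonneg)

lemma weighted_sq_vec_nonneg: "weighted_sq_vec \<theta> x \<ge> 0"
  unfolding weighted_sq_vec_def by (intro sum_nonneg weighted_sq_nonneg)

lemma weighted_sq_vec_le: "\<theta> \<ge> 0 \<Longrightarrow> weighted_sq_vec \<theta> x \<le> (norm x)\<^sup>2"
  unfolding weighted_sq_vec_def norm_vec_sq by (intro sum_mono weighted_sq_le_norm)

lemma weighted_sq_vec_triangle: "\<theta> \<ge> 0 \<Longrightarrow> weighted_sq_vec \<theta> x \<le> 2 * weighted_sq_vec \<theta> y + 2 * (norm (x - y))\<^sup>2"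
  unfolding weighted_sq_vec_def norm_vec_sq sum_distrib_left sum.distrib[symmetric] vector_minus_component
  by (intro sum_mono weighted_sq_triangle)

lemma defect_sq_vec_nonneg: "defect_sq_vec j x y \<ge> 0"
  unfolding defect_sq_vec_def by (intro sum_nonneg defect_sq_nonneg)

lemma sum_sqrt_mult_le:
  assumes "\<And>k. a k \<ge> 0" "\<And>k. b k \<ge> 0"
  shows "(\<Sum>k\<in>I. sqrt (a k) * sqrt (b k)) \<le> sqrt (\<Sum>k\<in>I. a k) * sqrt (\<Sum>k\<in>I. b k)"
  using L2_set_mult_ineq[of "\<lambda>k. sqrt (a k)" "\<lambda>k. sqrt (b k)" I] assms
  by (simp add: L2_set_def)

lemma cinner_defect_vec_bound:
  "cmod (cinner (coord_mult_vec j x) u - cinner x v) \<le> norm x * sqrt (defect_sq_vec j u v)"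
proof -
  have "cmod (cinner (coord_mult_vec j x) u - cinner x v)
      = cmod (\<Sum>k\<in>UNIV. cinner (coord_mult j (x $ k)) (u $ k) - cinner (x $ k) (v $ k))"
    by (simp add: cinner_vec_def coord_mult_vec_def sum_subtractf)
  also have "\<dots> \<le> (\<Sum>k\<in>UNIV. norm (x $ k) * sqrt (defect_sq j (u $ k) (v $ k)))"
    by (intro order_trans[OF norm_sum sum_mono] cinner_defect_bound)
  also have "\<dots> = (\<Sum>k\<in>UNIV. sqrt ((norm (x $ k))\<^sup>2) * sqrt (defect_sq j (u $ k) (v $ k)))"
    by simp
  also have "\<dots> \<le> sqrt (\<Sum>k\<in>UNIV. (norm (x $ k))\<^sup>2) * sqrt (\<Sum>k\<in>UNIV. defect_sq j (u $ k) (v $ k))"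
    by (intro sum_sqrt_mult_le defect_sq_nonneg) simp
  also have "\<dots> = norm x * sqrt (defect_sq_vec j u v)"
    by (simp add: norm_vec_sq[symmetric] defect_sq_vec_def)
  finally show ?thesis .
qed

lemma defect_product_vec:
  "cmod (cinner (coord_mult_vec i u) (coord_mult_vec j u') - cinner u (coord_mult_vec j v') - cinner (coord_mult_vec i v) u' + cinner v v')
     \<le> sqrt (defect_sq_vec j u v) * sqrt (defect_sq_vec i u' v')"
proof -
  have "cinner (coord_mult_vec i u) (coord_mult_vec j u') - cinner u (coord_mult_vec j v') - cinner (coord_mult_vec i v) u' + cinner v v'
    = (\<Sum>k\<in>UNIV. cinner (coord_mult i (u $ k)) (coord_mult j (u' $ k)) - cinner (u $ k) (coord_mult j (v' $ k))
        - cinner (coord_mult i (v $ k)) (u' $ k) + cinner (v $ k) (v' $ k))"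
    by (simp add: cinner_vec_def coord_mult_vec_def sum_subtractf sum.distrib)
  then have "cmod (cinner (coord_mult_vec i u) (coord_mult_vec j u') - cinner u (coord_mult_vec j v') - cinner (coord_mult_vec i v) u' + cinner v v')
    \<le> (\<Sum>k\<in>UNIV. sqrt (defect_sq j (u $ k) (v $ k)) * sqrt (defect_sq i (u' $ k) (v' $ k)))"
    by (simp only:) (intro order_trans[OF norm_sum sum_mono] defect_product)
  also have "\<dots> \<le> sqrt (\<Sum>k\<in>UNIV. defect_sq j (u $ k) (v $ k)) * sqrt (\<Sum>k\<in>UNIV. defect_sq i (u' $ k) (v' $ k))"
    by (intro sum_sqrt_mult_le defect_sq_nonneg)
  finally show ?thesis by (simp add: defect_sq_vec_def)
qed

text \<open>The same polynomial \<open>g\<close> works in every component, because it is built from \<open>f\<close> alone.\<close>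

theorem submodule_defect_estimate:
  fixes p :: "'n::finite cpoly ^ 'r::finite"
  assumes p: "\<And>k. total_degree (p $ k) \<le> m" and \<theta>: "0 < \<theta>" "\<theta> < 1"
  obtains C where "C \<ge> 0" "\<And>f j. \<exists>g. defect_sq_vec j (poly_vec p f) (poly_vec p g) \<le> C * weighted_sq_vec \<theta> (poly_vec p f)"
proof -
  let ?\<kappa> = "m + DIM(complex ^ 'n)"
  have \<kappa>: "2 * m + DIM(complex ^ 'n) \<le> 2 * ?\<kappa>" by simp
  let ?v = "emeasure lborel (ball (0 :: complex ^ 'n) 1)"
  obtain C where C: "C \<ge> 0" "\<And>(p :: 'n cpoly) f j. total_degree p \<le> m \<Longrightarrow>
      (\<integral>\<^sup>+z. ennreal ((cmod (poly_eval p z * (cnj (z $ j) * poly_eval f z - poly_eval (smoothed_deriv (?\<kappa> + 1) j f) z)))\<^sup>2)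
         * indicator (ball 0 1) z \<partial>lborel)
      \<le> ennreal C * weighted_mass \<theta> (\<lambda>z. poly_eval p z * poly_eval f z)"
    using weighted_defect_estimate[OF \<theta> \<kappa>] by blast
  have "\<exists>g. defect_sq_vec j (poly_vec p f) (poly_vec p g) \<le> C * weighted_sq_vec \<theta> (poly_vec p f)" for f j
  proof (intro exI)
    let ?g = "smoothed_deriv (?\<kappa> + 1) j f"
    have "defect_sq j (bergman_of_poly (p $ k * f)) (bergman_of_poly (p $ k * ?g)) \<le> C * weighted_sq \<theta> (bergman_of_poly (p $ k * f))" for k
    proof -
      let ?u = "bergman_of_poly (p $ k * f)" and ?w = "bergman_of_poly (p $ k * ?g)"
      have "ennreal (defect_sq j ?u ?w) * ?v = (\<integral>\<^sup>+z. ennreal ((cmod (defect j ?u ?w z))\<^sup>2) \<partial>ball_measure) * ?v"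
        unfolding defect_sq_def by (subst nn_integral_eq_integral[OF defect_sq_integrable]) auto
      also have "\<dots> = (\<integral>\<^sup>+z. ennreal ((cmod (defect j ?u ?w z))\<^sup>2) * indicator (ball 0 1) z \<partial>lborel)"
        by (rule nn_integral_ball_measure) measurable
      also have "\<dots> = (\<integral>\<^sup>+z. ennreal ((cmod (poly_eval (p $ k) z * (cnj (z $ j) * poly_eval f z - poly_eval ?g z)))\<^sup>2)
         * indicator (ball 0 1) z \<partial>lborel)"
      proof (rule nn_integral_cong)
        fix z :: "complex ^ 'n"
        have "defect j ?u ?w z = poly_eval (p $ k) z * (cnj (z $ j) * poly_eval f z - poly_eval ?g z)" if "z \<in> ball 0 1"
          using that by (simp add: defect_def bergman_of_poly.rep_eq poly_eval_mult algebra_simps)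
        then show "ennreal ((cmod (defect j ?u ?w z))\<^sup>2) * indicator (ball 0 1) z
          = ennreal ((cmod (poly_eval (p $ k) z * (cnj (z $ j) * poly_eval f z - poly_eval ?g z)))\<^sup>2) * indicator (ball 0 1) z"
          by (cases "z \<in> ball 0 1") (simp_all del: mem_ball)
      qed
      also have "\<dots> \<le> ennreal C * weighted_mass \<theta> (\<lambda>z. poly_eval (p $ k) z * poly_eval f z)"
        by (rule C(2)[OF p])
      also have "weighted_mass \<theta> (\<lambda>z. poly_eval (p $ k) z * poly_eval f z) = ennreal (weighted_sq \<theta> ?u) * ?v"
      proof -
        have "ennreal (weighted_sq \<theta> ?u) * ?v = (\<integral>\<^sup>+z. ennreal (weight \<theta> z * (cmod (Rep_bergman ?u z))\<^sup>2) * indicator (ball 0 1) z \<partial>lborel)"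
          using \<theta> by (subst weighted_sq_nn, simp, intro nn_integral_ball_measure) measurable
        also have "\<dots> = weighted_mass \<theta> (\<lambda>z. poly_eval (p $ k) z * poly_eval f z)"
          unfolding weighted_mass_def
          by (intro nn_integral_cong) (auto simp: weight_def bergman_of_poly.rep_eq poly_eval_mult indicator_def)
        finally show ?thesis by simp
      qed
      also have "ennreal C * (ennreal (weighted_sq \<theta> ?u) * ?v) = ennreal (C * weighted_sq \<theta> ?u) * ?v"
        using C(1) weighted_sq_nonneg[of \<theta> ?u] by (simp add: ennreal_mult mult.assoc)
      finally have "ennreal (defect_sq j ?u ?w) \<le> ennreal (C * weighted_sq \<theta> ?u)"
        using emeasure_unit_ball_pos[where 'a = "complex ^ 'n"]
          ennreal_mult_le_mult_iff[of ?v] by (simp only: mult.commute[of _ ?v]) simp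
      then show ?thesis
        using C(1) weighted_sq_nonneg[of \<theta> ?u] by simp
    qed
    then show "defect_sq_vec j (poly_vec p f) (poly_vec p ?g) \<le> C * weighted_sq_vec \<theta> (poly_vec p f)"
      unfolding defect_sq_vec_def weighted_sq_vec_def sum_distrib_left poly_vec_def vec_lambda_beta
      by (intro sum_mono)
  qed
  with C(1) show thesis by (rule that)
qed

section \<open>Commutators on the submodule\<close>

lemma cinner_axis: "cinner x (axis k v) = cinner (x $ k) v" for x :: "'a::complex_inner ^ 'r"
proof -
  have "cinner x (axis k v) = (\<Sum>l\<in>UNIV. if l = k then cinner (x $ k) v else 0)"
    unfolding cinner_vec_def by (intro sum.cong refl) (simp add: axis_def)
  then show ?thesis by simp
qed

text \<open>The expansion into monomials gives the estimate for polynomials, and it passes to limits by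
  \<open>(a + b)\<^sup>2 \<le> 2 a\<^sup>2 + 2 b\<^sup>2\<close>. This costs the factor \<open>1/2\<close> on the left.\<close>

lemma weighted_sq_tail_submodule:
  fixes p :: "'n::finite cpoly ^ 'r::finite"
  assumes \<theta>: "0 \<le> \<theta>" "\<theta> \<le> 1" and d: "d \<ge> 1" and x: "x \<in> generated_submodule p"
  shows "weighted_sq_vec \<theta> x / 2 \<le> 2 * real d powr (- \<theta>) * (norm x)\<^sup>2
    + (\<Sum>l\<in>UNIV \<times> expo_box d. (cmod (cinner x (axis (fst l) (scaled_monomial \<theta> d (snd l)))))\<^sup>2)"
proof -
  let ?S = "\<lambda>x :: 'n bergman ^ 'r. \<Sum>l\<in>UNIV \<times> expo_box d. (cmod (cinner x (axis (fst l) (scaled_monomial \<theta> d (snd l)))))\<^sup>2"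
  have S: "?S x = (\<Sum>k\<in>UNIV. \<Sum>a\<in>expo_box d. (cmod (cinner (x $ k) (scaled_monomial \<theta> d a)))\<^sup>2)" for x
    by (simp add: sum.cartesian_product case_prod_unfold cinner_axis)
  have poly: "weighted_sq_vec \<theta> (poly_vec p f) \<le> 2 * real d powr (- \<theta>) * (norm (poly_vec p f))\<^sup>2 + ?S (poly_vec p f)" for f
    unfolding S weighted_sq_vec_def norm_vec_sq sum_distrib_left sum.distrib[symmetric] poly_vec_def vec_lambda_beta
    by (intro sum_mono weighted_sq_tail_poly \<theta> d)
  obtain f where f: "(\<lambda>k. poly_vec p (f k)) \<longlonglongrightarrow> x" using x by (rule submodule_approx)
  let ?y = "\<lambda>k. poly_vec p (f k)"
  have "weighted_sq_vec \<theta> x \<le> 2 * (2 * real d powr (- \<theta>) * (norm x)\<^sup>2 + ?S x) + 2 * (norm (x - x))\<^sup>2"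
  proof (rule LIMSEQ_le_const)
    show "(\<lambda>k. 2 * (2 * real d powr (- \<theta>) * (norm (?y k))\<^sup>2 + ?S (?y k)) + 2 * (norm (x - ?y k))\<^sup>2)
      \<longlonglongrightarrow> 2 * (2 * real d powr (- \<theta>) * (norm x)\<^sup>2 + ?S x) + 2 * (norm (x - x))\<^sup>2"
      by (intro tendsto_intros f bounded_linear.tendsto[OF bounded_linear_cinner_left])
    have "weighted_sq_vec \<theta> x \<le> 2 * (2 * real d powr (- \<theta>) * (norm (?y k))\<^sup>2 + ?S (?y k)) + 2 * (norm (x - ?y k))\<^sup>2" for k
      by (rule order_trans[OF weighted_sq_vec_triangle[OF \<theta>(1), of x "?y k"] add_right_mono[OF mult_left_mono[OF poly[of "f k"]]]]) simp
    then show "\<exists>N. \<forall>k\<ge>N. weighted_sq_vec \<theta> x \<le> 2 * (2 * real d powr (- \<theta>) * (norm (?y k))\<^sup>2 + ?S (?y k)) + 2 * (norm (x - ?y k))\<^sup>2"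
      by blast
  qed
  then show ?thesis by simp
qed

context
  fixes p :: "'n::finite cpoly ^ 'r::finite"
begin

abbreviation (input) "M \<equiv> generated_submodule p"
abbreviation (input) "S_adj j \<equiv> adjoint_on M (coord_mult_vec j)"

lemma S_adj:
  shows "S_adj j g \<in> M" "f \<in> M \<Longrightarrow> cinner (coord_mult_vec j f) g = cinner f (S_adj j g)"
proof -
  have bd: "norm (coord_mult_vec j f) \<le> 1 * norm f" for f :: "'n bergman ^ 'r"
    using norm_coord_mult_vec_le[of j f] by simp
  note * = adjoint_on_characterization[OF csubspace_generated_submodule[of p] complete_generated_submodule[of p]
      coord_mult_vec_add coord_mult_vec_scaleC bd]
  show "S_adj j g \<in> M" by (rule *(1))
  show "cinner (coord_mult_vec j f) g = cinner f (S_adj j g)" if "f \<in> M" by (rule *(2)) (use that in auto)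
qed

lemma submodule_eqI:
  assumes "x \<in> M" "y \<in> M" "\<And>f. f \<in> M \<Longrightarrow> cinner f x = cinner f y"
  shows "x = y"
proof -
  have "x - y \<in> M" by (rule csubspace_closed(5)[OF csubspace_generated_submodule assms(1,2)])
  then have "cinner (x - y) (x - y) = 0" using assms(3)[of "x - y"] by (simp add: cinner_diff_right)
  then show ?thesis by (simp add: cinner_self)
qed

lemma S_adj_add: "S_adj j (g + h) = S_adj j g + S_adj j h"
  by (rule submodule_eqI[OF S_adj(1) csubspace_closed(2)[OF csubspace_generated_submodule S_adj(1) S_adj(1)]])
    (simp add: cinner_add_right flip: S_adj(2))

lemma S_adj_scaleC: "S_adj j (scaleC c g) = scaleC c (S_adj j g)"
  by (rule submodule_eqI[OF S_adj(1) csubspace_closed(3)[OF csubspace_generated_submodule S_adj(1)]])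
    (simp add: cinner_scaleC_right flip: S_adj(2))

lemma norm_S_adj_le: "norm (S_adj j g) \<le> norm g"
proof (cases "S_adj j g = 0")
  case False
  have "norm (S_adj j g) * norm (S_adj j g) = cmod (cinner (S_adj j g) (S_adj j g))"
    unfolding cinner_self norm_of_real by (simp add: power2_eq_square)
  also have "\<dots> = cmod (cinner (coord_mult_vec j (S_adj j g)) g)"
    by (simp add: S_adj)
  also have "\<dots> \<le> norm (coord_mult_vec j (S_adj j g)) * norm g" by (rule cinner_Cauchy_Schwarz)
  also have "\<dots> \<le> norm (S_adj j g) * norm g" by (intro mult_right_mono norm_coord_mult_vec_le) simp
  finally show ?thesis using False by (simp add: mult_le_cancel_left)
qed simp

abbreviation (input) "comm i j \<equiv> commutator (coord_mult_vec i) (S_adj j)"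

lemma comm_in: "f \<in> M \<Longrightarrow> comm i j f \<in> M"
  unfolding commutator_def
  by (intro csubspace_closed(5)[OF csubspace_generated_submodule] coord_mult_vec_in S_adj(1))

lemma comm_add: "comm i j (f + g) = comm i j f + comm i j g"
  by (simp add: commutator_def S_adj_add coord_mult_vec_add)

lemma scaleC_diff_right: "scaleC c (x - y) = scaleC c x - scaleC c (y :: 'a::complex_inner)"
  by (rule complex_vector.scale_right_diff_distrib)

lemma comm_scaleC: "comm i j (scaleC c f) = scaleC c (comm i j f)"
  by (simp add: commutator_def S_adj_scaleC coord_mult_vec_scaleC scaleC_diff_right)

lemma comm_bounded_linear: "bounded_linear (comm i j)"
proof (rule bounded_linear_intro[where K = 2])
  show "comm i j (f + g) = comm i j f + comm i j g" for f g by (rule comm_add)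
  show "comm i j (r *\<^sub>R f) = r *\<^sub>R comm i j f" for r f
    using comm_scaleC[of i j "of_real r" f] by (simp add: scaleC_of_real)
  show "norm (comm i j f) \<le> norm f * 2" for f
  proof -
    have "norm (comm i j f) \<le> norm (coord_mult_vec i (S_adj j f)) + norm (S_adj j (coord_mult_vec i f))"
      unfolding commutator_def by (rule norm_triangle_ineq4)
    also have "\<dots> \<le> norm f + norm f"
      by (intro add_mono order_trans[OF norm_coord_mult_vec_le norm_S_adj_le] order_trans[OF norm_S_adj_le norm_coord_mult_vec_le])
    finally show ?thesis by simp
  qed
qed

text \<open>For \<open>x\<close> in \<open>M\<close> the pairing of \<open>x\<close> with \<open>S_adj j u - v\<close> equals its pairing with the defect;
  the case \<open>x = S_adj j u - v\<close> says that projecting to \<open>M\<close> does not increase norms.\<close>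

lemma norm_S_adj_diff_le:
  assumes "v \<in> M"
  shows "norm (S_adj j u - v) \<le> sqrt (defect_sq_vec j u v)"
proof (cases "S_adj j u = v")
  case False
  let ?x = "S_adj j u - v"
  have x: "?x \<in> M" by (intro csubspace_closed(5)[OF csubspace_generated_submodule] S_adj(1) assms)
  have "norm ?x * norm ?x = cmod (cinner ?x ?x)"
    unfolding cinner_self norm_of_real by (simp add: power2_eq_square)
  also have "cinner ?x ?x = cinner ?x (S_adj j u) - cinner ?x v" by (rule cinner_diff_right)
  also have "\<dots> = cinner (coord_mult_vec j ?x) u - cinner ?x v" by (simp only: S_adj(2)[OF x])
  also have "cmod \<dots> \<le> norm ?x * sqrt (defect_sq_vec j u v)" by (rule cinner_defect_vec_bound)
  finally show ?thesis using False by (simp add: mult_le_cancel_left)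
qed (simp add: defect_sq_vec_nonneg)

text \<open>Since \<open>cnj z\<^sub>j\<close> and \<open>z\<^sub>i\<close> commute as functions, the two products of the commutator differ
  only through the projection to \<open>M\<close>. Subtracting \<open>v\<close> and \<open>v'\<close> changes both terms on the right
  by the same amount, because \<open>v\<close> and \<open>v'\<close> lie in \<open>M\<close>.\<close>

lemma comm_form_identity:
  assumes "u \<in> M" "u' \<in> M" "v \<in> M" "v' \<in> M"
  shows "cinner (comm i j u) u' = cinner (S_adj j u - v) (S_adj i u' - v')
    - (cinner (coord_mult_vec i u) (coord_mult_vec j u') - cinner u (coord_mult_vec j v') - cinner (coord_mult_vec i v) u' + cinner v v')"
proof -
  have adj': "cinner (S_adj j w) x = cinner w (coord_mult_vec j x)" if "x \<in> M" for j w x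
    using S_adj(2)[OF that, of j w] by (metis cinner_commute)
  have "cinner (comm i j u) u' = cinner (S_adj j u) (S_adj i u') - cinner (coord_mult_vec i u) (coord_mult_vec j u')"
    unfolding commutator_def cinner_diff_left by (simp add: S_adj assms adj')
  moreover have "cinner (S_adj j u - v) (S_adj i u' - v')
      = cinner (S_adj j u) (S_adj i u') - cinner u (coord_mult_vec j v') - cinner (coord_mult_vec i v) u' + cinner v v'"
    by (simp add: cinner_diff_left cinner_diff_right adj' assms flip: S_adj(2))
  ultimately show ?thesis by simp
qed

text \<open>Approximants \<open>v\<close> are available for polynomial multiples of \<open>p\<close> only. The bound is extended to
  \<open>M\<close> one argument at a time; each passage to the limit costs a factor \<open>sqrt 2\<close>, since only the
  triangle inequality up to \<open>2\<close> is used for the weighted norm.\<close>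

lemma comm_form_bound:
  assumes deg: "\<And>k. total_degree (p $ k) \<le> m" and \<theta>: "0 < \<theta>" "\<theta> < 1"
  obtains C where "C \<ge> 0" "\<And>i j u u'. u \<in> M \<Longrightarrow> u' \<in> M \<Longrightarrow>
    cmod (cinner (comm i j u) u') \<le> C * (sqrt (weighted_sq_vec \<theta> u) * sqrt (weighted_sq_vec \<theta> u'))"
proof -
  let ?W = "weighted_sq_vec \<theta> :: 'n bergman ^ 'r \<Rightarrow> real"
  obtain C where C: "C \<ge> 0"
    "\<And>f j. \<exists>g. defect_sq_vec j (poly_vec p f) (poly_vec p g) \<le> C * ?W (poly_vec p f)"
    using submodule_defect_estimate[OF deg \<theta>] by blast
  have W0: "?W x \<ge> 0" for x by (rule weighted_sq_vec_nonneg)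
  have tri: "?W x \<le> 2 * ?W y + 2 * (norm (x - y))\<^sup>2" for x y
    using \<theta> by (intro weighted_sq_vec_triangle) simp
  have both: "cmod (cinner (comm i j (poly_vec p f)) (poly_vec p f'))
      \<le> 2 * C * (sqrt (?W (poly_vec p f)) * sqrt (?W (poly_vec p f')))" for i j f f'
  proof -
    let ?u = "poly_vec p f" and ?u' = "poly_vec p f'"
    obtain g where g: "defect_sq_vec j ?u (poly_vec p g) \<le> C * ?W ?u" using C(2) by blast
    obtain g' where g': "defect_sq_vec i ?u' (poly_vec p g') \<le> C * ?W ?u'" using C(2) by blast
    let ?v = "poly_vec p g" and ?v' = "poly_vec p g'"
    let ?B = "cinner (coord_mult_vec i ?u) (coord_mult_vec j ?u') - cinner ?u (coord_mult_vec j ?v') - cinner (coord_mult_vec i ?v) ?u' + cinner ?v ?v'"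
    have "cmod (cinner (comm i j ?u) ?u') \<le> cmod (cinner (S_adj j ?u - ?v) (S_adj i ?u' - ?v')) + cmod ?B"
      unfolding comm_form_identity[OF poly_vec_in poly_vec_in poly_vec_in[of p g] poly_vec_in[of p g']] by (rule norm_triangle_ineq4)
    also have "\<dots> \<le> norm (S_adj j ?u - ?v) * norm (S_adj i ?u' - ?v') + sqrt (defect_sq_vec j ?u ?v) * sqrt (defect_sq_vec i ?u' ?v')"
      by (intro add_mono cinner_Cauchy_Schwarz defect_product_vec)
    also have "\<dots> \<le> sqrt (defect_sq_vec j ?u ?v) * sqrt (defect_sq_vec i ?u' ?v') + sqrt (defect_sq_vec j ?u ?v) * sqrt (defect_sq_vec i ?u' ?v')"
      by (intro add_right_mono mult_mono norm_S_adj_diff_le poly_vec_in) (auto simp: defect_sq_vec_nonneg)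
    also have "\<dots> = 2 * (sqrt (defect_sq_vec j ?u ?v) * sqrt (defect_sq_vec i ?u' ?v'))" by simp
    also have "\<dots> \<le> 2 * (sqrt (C * ?W ?u) * sqrt (C * ?W ?u'))"
      using g g' C(1) W0 by (intro mult_left_mono mult_mono real_sqrt_le_mono) (auto simp: defect_sq_vec_nonneg)
    also have "\<dots> = 2 * ((sqrt C * sqrt C) * (sqrt (?W ?u) * sqrt (?W ?u')))"
      by (simp only: real_sqrt_mult mult_ac)
    also have "sqrt C * sqrt C = C" using C(1) by simp
    finally show ?thesis by (simp only: mult.assoc)
  qed
  have one: "cmod (cinner (comm i j u) (poly_vec p f')) \<le> 2 * C * (sqrt (2 * ?W u) * sqrt (?W (poly_vec p f')))"
    if u: "u \<in> M" for i j u f'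
  proof -
    obtain f where f: "(\<lambda>k. poly_vec p (f k)) \<longlonglongrightarrow> u" using u by (rule submodule_approx)
    have "cmod (cinner (comm i j u) (poly_vec p f')) \<le> 2 * C * (sqrt (2 * ?W u + 2 * (norm (u - u))\<^sup>2) * sqrt (?W (poly_vec p f')))"
    proof (rule LIMSEQ_le)
      show "(\<lambda>k. cmod (cinner (comm i j (poly_vec p (f k))) (poly_vec p f'))) \<longlonglongrightarrow> cmod (cinner (comm i j u) (poly_vec p f'))"
        by (intro tendsto_norm bounded_linear.tendsto[OF bounded_linear_cinner_left] bounded_linear.tendsto[OF comm_bounded_linear] f)
      show "(\<lambda>k. 2 * C * (sqrt (2 * ?W u + 2 * (norm (poly_vec p (f k) - u))\<^sup>2) * sqrt (?W (poly_vec p f'))))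
          \<longlonglongrightarrow> 2 * C * (sqrt (2 * ?W u + 2 * (norm (u - u))\<^sup>2) * sqrt (?W (poly_vec p f')))"
        by (intro tendsto_intros f)
      have "cmod (cinner (comm i j (poly_vec p (f k))) (poly_vec p f')) \<le> 2 * C * (sqrt (2 * ?W u + 2 * (norm (poly_vec p (f k) - u))\<^sup>2) * sqrt (?W (poly_vec p f')))" for k
        using C(1) W0 tri by (intro order_trans[OF both] mult_left_mono mult_right_mono real_sqrt_le_mono) auto
      then show "\<exists>N. \<forall>k\<ge>N. cmod (cinner (comm i j (poly_vec p (f k))) (poly_vec p f')) \<le> 2 * C * (sqrt (2 * ?W u + 2 * (norm (poly_vec p (f k) - u))\<^sup>2) * sqrt (?W (poly_vec p f')))"
        by blast
    qed
    then show ?thesis by simp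
  qed
  have "cmod (cinner (comm i j u) u') \<le> 4 * C * (sqrt (?W u) * sqrt (?W u'))" if u: "u \<in> M" "u' \<in> M" for i j u u'
  proof -
    obtain f where f: "(\<lambda>k. poly_vec p (f k)) \<longlonglongrightarrow> u'" using u(2) by (rule submodule_approx)
    have "cmod (cinner (comm i j u) u') \<le> 2 * C * (sqrt (2 * ?W u) * sqrt (2 * ?W u' + 2 * (norm (u' - u'))\<^sup>2))"
    proof (rule LIMSEQ_le)
      show "(\<lambda>k. cmod (cinner (comm i j u) (poly_vec p (f k)))) \<longlonglongrightarrow> cmod (cinner (comm i j u) u')"
        by (intro tendsto_norm bounded_linear.tendsto[OF bounded_linear_cinner_right] f)
      show "(\<lambda>k. 2 * C * (sqrt (2 * ?W u) * sqrt (2 * ?W u' + 2 * (norm (poly_vec p (f k) - u'))\<^sup>2)))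
          \<longlonglongrightarrow> 2 * C * (sqrt (2 * ?W u) * sqrt (2 * ?W u' + 2 * (norm (u' - u'))\<^sup>2))"
        by (intro tendsto_intros f)
      have "cmod (cinner (comm i j u) (poly_vec p (f k))) \<le> 2 * C * (sqrt (2 * ?W u) * sqrt (2 * ?W u' + 2 * (norm (poly_vec p (f k) - u'))\<^sup>2))" for k
        using C(1) W0 tri by (intro order_trans[OF one[OF u(1)]] mult_left_mono real_sqrt_le_mono) auto
      then show "\<exists>N. \<forall>k\<ge>N. cmod (cinner (comm i j u) (poly_vec p (f k))) \<le> 2 * C * (sqrt (2 * ?W u) * sqrt (2 * ?W u' + 2 * (norm (poly_vec p (f k) - u'))\<^sup>2))"
        by blast
    qed
    also have "\<dots> = 2 * C * ((sqrt 2 * sqrt 2) * (sqrt (?W u) * sqrt (?W u')))"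
      by (simp add: real_sqrt_mult)
    also have "\<dots> = 4 * C * (sqrt (?W u) * sqrt (?W u'))" by simp
    finally show ?thesis .
  qed
  moreover have "0 \<le> 4 * C" using C(1) by simp
  ultimately show thesis by (rule that[rotated])
qed

end

theorem mainTheorem2:
  fixes p :: "('n::finite) cpoly ^ ('r::finite)" and m :: nat and q :: real
  assumes "\<And>k. total_degree (p $ k) \<le> m"
    and "real CARD('n) < q"
  shows "essentially_normal q (generated_submodule p)"
  unfolding essentially_normal_def
proof (intro allI)
  fix i j :: 'n
  define t where "t = real CARD('n) / q"
  \<comment> \<open>Any exponent strictly between \<open>n / q\<close> and \<open>1\<close> would do.\<close>
  define \<theta> where "\<theta> = (t + 1) / 2"
  have n: "0 < real CARD('n)" by simp
  then have q: "q > 0" using assms(2) by linarith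
  have "0 < t" "t < 1" using n assms(2) q by (auto simp: t_def)
  then have exponent: "0 < \<theta>" "\<theta> < 1" "t < \<theta>" by (simp_all add: \<theta>_def)
  obtain C where C: "C \<ge> 0" "\<And>i j u u'. u \<in> generated_submodule p \<Longrightarrow> u' \<in> generated_submodule p \<Longrightarrow>
    cmod (cinner (commutator (coord_mult_vec i) (adjoint_on (generated_submodule p) (coord_mult_vec j)) u) u')
      \<le> C * (sqrt (weighted_sq_vec \<theta> u) * sqrt (weighted_sq_vec \<theta> u'))"
    using comm_form_bound[OF assms(1) exponent(1,2)] by blast
  \<comment> \<open>The summand \<open>1\<close> makes the constant positive; halving the weighted norm matches the tail
    estimate on \<open>M\<close>.\<close>
  interpret weakly_bounded_operator "generated_submodule p"
    "commutator (coord_mult_vec i) (adjoint_on (generated_submodule p) (coord_mult_vec j))"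
    "\<lambda>u. weighted_sq_vec \<theta> u / 2" "2 * C + 1" \<theta> "real CARD('r)" "CARD('n)"
    "\<lambda>d. UNIV \<times> expo_box d" "\<lambda>d l. axis (fst l) (scaled_monomial \<theta> d (snd l))"
  proof
    fix f g :: "'n bergman ^ 'r"
    show "weighted_sq_vec \<theta> f / 2 \<ge> 0" by (simp add: weighted_sq_vec_nonneg)
    show "weighted_sq_vec \<theta> f / 2 \<le> (norm f)\<^sup>2"
      using weighted_sq_vec_le[of \<theta> f] weighted_sq_vec_nonneg[of \<theta> f] exponent by simp
    show "cmod (cinner (commutator (coord_mult_vec i) (adjoint_on (generated_submodule p) (coord_mult_vec j)) f) g)
      \<le> (2 * C + 1) * (sqrt (weighted_sq_vec \<theta> f / 2) * sqrt (weighted_sq_vec \<theta> g / 2))"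
      if "f \<in> generated_submodule p" "g \<in> generated_submodule p"
    proof -
      let ?a = "sqrt (weighted_sq_vec \<theta> f / 2)" and ?b = "sqrt (weighted_sq_vec \<theta> g / 2)"
      have ab: "0 \<le> ?a * ?b" by (simp add: weighted_sq_vec_nonneg)
      have "sqrt (weighted_sq_vec \<theta> f) = sqrt 2 * ?a" "sqrt (weighted_sq_vec \<theta> g) = sqrt 2 * ?b"
        by (simp_all flip: real_sqrt_mult)
      then have "C * (sqrt (weighted_sq_vec \<theta> f) * sqrt (weighted_sq_vec \<theta> g)) = C * ((sqrt 2 * sqrt 2) * (?a * ?b))"
        by (simp only: mult_ac)
      also have "\<dots> = 2 * C * (?a * ?b)" by simp
      also have "\<dots> \<le> (2 * C + 1) * (?a * ?b)" using ab by (intro mult_right_mono) auto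
      finally show ?thesis using C(2)[OF that, of i j] by linarith
    qed
    show "weighted_sq_vec \<theta> f / 2 \<le> 2 * real d powr - \<theta> * (norm f)\<^sup>2
        + (\<Sum>l\<in>UNIV \<times> expo_box d. (cmod (cinner f (axis (fst l) (scaled_monomial \<theta> d (snd l)))))\<^sup>2)"
      if "1 \<le> d" "f \<in> generated_submodule p" for d
      using exponent that by (intro weighted_sq_tail_submodule) auto
  next
    fix d :: nat assume "1 \<le> d"
    show "finite (UNIV \<times> (expo_box d :: ('n \<Rightarrow>\<^sub>0 nat) set) :: ('r \<times> _) set)" by (simp add: expo_box)
    have "card (UNIV \<times> (expo_box d :: ('n \<Rightarrow>\<^sub>0 nat) set) :: ('r \<times> _) set) \<le> CARD('r) * d ^ CARD('n)"
      unfolding card_cartesian_product by (intro mult_left_mono expo_box) simp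
    then have "real (card (UNIV \<times> (expo_box d :: ('n \<Rightarrow>\<^sub>0 nat) set) :: ('r \<times> _) set)) \<le> real (CARD('r) * d ^ CARD('n))"
      by (rule of_nat_mono)
    then show "real (card (UNIV \<times> (expo_box d :: ('n \<Rightarrow>\<^sub>0 nat) set) :: ('r \<times> _) set)) \<le> real CARD('r) * real d ^ CARD('n)"
      by simp
  qed (use exponent C(1) in \<open>auto simp: csubspace_generated_submodule complete_generated_submodule comm_in comm_add comm_scaleC\<close>)
  show "commutator (coord_mult_vec i) (adjoint_on (generated_submodule p) (coord_mult_vec j)) \<in> schatten_class q (generated_submodule p)"
    using exponent(3) q by (intro in_schatten_class) (simp add: t_def field_simps)
qed

end
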